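(* Let $P_1,P_2>0$ and $\mathcal D=\mathcal D_f\times\mathcal D_g$, where $$\mathcal D_f=\left\{f(\lambda)\ \Big|\ \frac1{2\pi}\int_{-\pi}^{\pi}f(\lambda)d\lambda\le P_1\right\},\qquad\mathcal D_g=\left\{g(\lambda)\ \Big|\ \frac1{2\pi}\int_{-\pi}^{\pi}g(\lambda)d\lambda\le P_2\right\}.$$ Suppose that $f^0\in\mathcal D_f$ and $g^0\in\mathcal D_g$ satisfy $\int_{-\pi}^{\pi}\frac{d\lambda}{f^0(\lambda)+g^0(\lambda)}<\infty$ and that the functions $$h_f(f^0,g^0)=\frac{\left|A(e^{i\lambda})g^0(\lambda)+C^0(\lambda)\right|}{f^0(\lambda)+g^0(\lambda)},\qquad h_g(f^0,g^0)=\frac{\left|A(e^{i\lambda})f^0(\lambda)-C^0(\lambda)\right|}{f^0(\lambda)+g^0(\lambda)},\qquad C^0(\lambda)=\sum_{k=0}^\infty((\mathbf P^0)^{-1}\mathbf R^0\mathbf a)_ke^{i\lambda(k+1)},$$ are bounded. Suppose that $f^0,g^0$ satisfy the equations $$\left|A(e^{i\lambda})g^0(\lambda)+C^0(\lambda)\right|=\alpha_1\,(f^0(\lambda)+g^0(\lambda)),\qquad\left|A(e^{i\lambda})f^0(\lambda)-C^0(\lambda)\right|=\alpha_2\,(f^0(\lambda)+g^0(\lambda)),$$ with constants $\alpha_1\ge0$, $\alpha_2\ge0$, where $\alpha_1\ne0$ if $\int_{-\pi}^{\pi}f^0(\lambda)d\lambda=2\pi P_1$ and $\alpha_2\neq0$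 if $\int_{-\pi}^{\pi}g^0(\lambda)d\lambda=2\pi P_2$. If $(f^0,g^0)$ determines a solution of the optimization problem $$\max_{(f,g)\in\mathcal D}\left(\langle\mathbf R\mathbf a,\mathbf P^{-1}\mathbf R\mathbf a\rangle+\langle\mathbf Q\mathbf a,\mathbf a\rangle\right)=\langle\mathbf R^0\mathbf a,(\mathbf P^0)^{-1}\mathbf R^0\mathbf a\rangle+\langle\mathbf Q^0\mathbf a,\mathbf a\rangle,$$ then $f^0,g^0$ are least favorable in the class $\mathcal D$ for the optimal linear filtering of $A\xi=\sum_{k=0}^\infty a(k)\xi(-k)$, and the function $h(f^0,g^0)$ is the minimax-robust spectral characteristic of the optimal estimate of $A\xi$.
   Context: Setting: $\xi,\eta$ are zero-mean, mutually uncorrelated (wide-sense) stationary sequences with spectral densities $f,g\ge0$, integrable on $[-\pi,\pi)$, normalized by $\mathsf E\,\xi(m+k)\overline{\xi(m)}=\frac1{2\pi}\int e^{ik\lambda}f\,d\lambda$ (similarly $\eta,g$); $\xi(m)=\int e^{im\lambda}dZ_\xi(\lambda)$, $\eta(m)=\int e^{im\lambda}dZ_\eta(\lambda)$, $Z_{\xi+\eta}=Z_\xi+Z_\eta$. The functional $A\xi=\sum_{k\ge0}a(k)\xi(-k)$ is estimated by $\int h(\lambda)dZ_{\xi+\eta}(\lambda)$ from observations of $\xi(m)+\eta(m)$, $m=0,-1,-2,\ldots$. The coefficients satisfy $\sum|a(k)|<\infty$, $\sum(k+1)|a(k)|^2<\infty$; $\mathbf a=(a(0),a(1),\ldots)'$,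 $A(e^{i\lambda})=\sum_{k\ge0}a(k)e^{-i\lambda k}$. Operators: $\langle x,y\rangle=\sum_{k\ge0}x_k\overline{y_k}$ on $\ell_2$. For a pair $(f,g)$ with $\int\frac{d\lambda}{f+g}<\infty$, $\mathbf P,\mathbf R,\mathbf Q$ are the linear operators on $\ell_2$ with matrices ($l,k,m\ge0$) $$(\mathbf P)_{l,k}=\frac1{2\pi}\int_{-\pi}^{\pi}\frac{e^{i\lambda(k-l)}}{f+g}d\lambda,\quad(\mathbf R)_{l,m}=\frac1{2\pi}\int_{-\pi}^{\pi}e^{-i\lambda(l+1+m)}\frac{f}{f+g}d\lambda,\quad(\mathbf Q)_{l,k}=\frac1{2\pi}\int_{-\pi}^{\pi}e^{i\lambda(l-k)}\frac{fg}{f+g}d\lambda ;$$ $\mathbf P^0,\mathbf R^0,\mathbf Q^0$ are those built from $(f^0,g^0)$. Expressions involving these operators are considered for pairs with $\int\frac{d\lambda}{f+g}<\infty$ for which the matrices define operators on $\ell_2$ and $\mathbf P$ is invertible. Spectral characteristic and error: the optimal spectral characteristic for $(f,g)$ is $$h(f,g)(\lambda)=A(e^{i\lambda})\frac{f(\lambda)}{f(\lambda)+g(\lambda)}-\frac{\sum_{k\ge0}(\mathbf P^{-1}\mathbf R\mathbf a)_ke^{i\lambda(k+1)}}{f(\lambda)+g(\lambda)},$$ and $\Delta(h;f,g)=\frac1{2\pi}\int_{-\pi}^{\pi}|A(e^{i\lambda})-h(\lambda)|^2f(\lambda)d\lambda+\frac1{2\pi}\int_{-\pi}^{\pi}|h(\lambda)|^2g(\lambda)d\lambda$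 is the mean-square error of the estimate with spectral characteristic $h$. Definitions: $(f^0,g^0)\in\mathcal D$ are least favorable in $\mathcal D$ for the optimal linear filtering of $A\xi$ if $\Delta(h(f^0,g^0);f^0,g^0)=\max_{(f,g)\in\mathcal D}\Delta(h(f,g);f,g)$. A spectral characteristic $h^0$ is minimax-robust for $\mathcal D$ if $h^0\in H_{\mathcal D}=\bigcap_{(f,g)\in\mathcal D}L_2^0(f+g)$ and $\min_{h\in H_{\mathcal D}}\max_{(f,g)\in\mathcal D}\Delta(h;f,g)=\sup_{(f,g)\in\mathcal D}\Delta(h^0;f,g)$, where $L_2^0(f+g)$ is the closed subspace of $L_2(f+g)$ generated by $\{e^{im\lambda}:m=0,-1,-2,\ldots\}$. *)

theory Defs
  imports "HOL-Analysis.Analysis"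
begin

text \<open>
  Densities and spectral characteristics are functions on the half-open interval from
  \<open>-\<pi>\<close> to \<open>\<pi>\<close>; their values elsewhere are irrelevant.  They matter only up to
  Lebesgue null sets, so equations and bounds for them are understood almost everywhere.
\<close>

abbreviation circ :: "real measure" where
  "circ \<equiv> lebesgue_on {-pi..<pi}"

definition spectral_density :: "(real \<Rightarrow> real) \<Rightarrow> bool" where
  "spectral_density f \<longleftrightarrow> (\<forall>t\<in>{-pi..<pi}. 0 \<le> f t) \<and> integrable circ f"

definition density_class :: "real \<Rightarrow> (real \<Rightarrow> real) set" where
  "density_class P = {f. spectral_density f \<and> (1 / (2 * pi)) * (\<integral>t. f t \<partial>circ) \<le> P}"


definition ell2 :: "(nat \<Rightarrow> complex) set" where
  "ell2 = {x. summable (\<lambda>k. (cmod (x k))\<^sup>2)}"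

definition ell2_norm :: "(nat \<Rightarrow> complex) \<Rightarrow> real" where
  "ell2_norm x = sqrt (\<Sum>k. (cmod (x k))\<^sup>2)"

definition ell2_inner :: "(nat \<Rightarrow> complex) \<Rightarrow> (nat \<Rightarrow> complex) \<Rightarrow> complex" where
  "ell2_inner x y = (\<Sum>k. x k * cnj (y k))"

definition mat_app :: "(nat \<Rightarrow> nat \<Rightarrow> complex) \<Rightarrow> (nat \<Rightarrow> complex) \<Rightarrow> nat \<Rightarrow> complex" where
  "mat_app M x = (\<lambda>l. \<Sum>k. M l k * x k)"

text \<open>
  Operators on \<open>\<ell>\<^sub>2\<close> are bounded operators, and invertibility is invertibility among these.
  Boundedness excludes nothing: a matrix whose rows converge on \<open>\<ell>\<^sub>2\<close> and which maps
  \<open>\<ell>\<^sub>2\<close> into itself is bounded by the closed graph theorem, and so is the inverse of a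
  bijective one.
\<close>

definition bounded_on_ell2 :: "((nat \<Rightarrow> complex) \<Rightarrow> nat \<Rightarrow> complex) \<Rightarrow> bool" where
  "bounded_on_ell2 T \<longleftrightarrow>
     (\<exists>B. \<forall>x\<in>ell2. T x \<in> ell2 \<and> ell2_norm (T x) \<le> B * ell2_norm x)"

definition mat_operator :: "(nat \<Rightarrow> nat \<Rightarrow> complex) \<Rightarrow> bool" where
  "mat_operator M \<longleftrightarrow>
     (\<forall>x\<in>ell2. \<forall>l. summable (\<lambda>k. M l k * x k)) \<and> bounded_on_ell2 (mat_app M)"

definition mat_inv_app :: "(nat \<Rightarrow> nat \<Rightarrow> complex) \<Rightarrow> (nat \<Rightarrow> complex) \<Rightarrow> nat \<Rightarrow> complex" where
  "mat_inv_app M = inv_into ell2 (mat_app M)"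

definition mat_invertible :: "(nat \<Rightarrow> nat \<Rightarrow> complex) \<Rightarrow> bool" where
  "mat_invertible M \<longleftrightarrow>
     bij_betw (mat_app M) ell2 ell2 \<and> bounded_on_ell2 (mat_inv_app M)"


definition mat_P :: "(real \<Rightarrow> real) \<Rightarrow> (real \<Rightarrow> real) \<Rightarrow> nat \<Rightarrow> nat \<Rightarrow> complex" where
  "mat_P f g l k =
     (1 / (2 * pi)) * (\<integral>t. cis (t * (real k - real l)) / of_real (f t + g t) \<partial>circ)"

definition mat_R :: "(real \<Rightarrow> real) \<Rightarrow> (real \<Rightarrow> real) \<Rightarrow> nat \<Rightarrow> nat \<Rightarrow> complex" where
  "mat_R f g l m =
     (1 / (2 * pi)) *
     (\<integral>t. cis (- t * real (l + 1 + m)) * of_real (f t / (f t + g t)) \<partial>circ)"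

definition mat_Q :: "(real \<Rightarrow> real) \<Rightarrow> (real \<Rightarrow> real) \<Rightarrow> nat \<Rightarrow> nat \<Rightarrow> complex" where
  "mat_Q f g l k =
     (1 / (2 * pi)) *
     (\<integral>t. cis (t * (real l - real k)) * of_real (f t * g t / (f t + g t)) \<partial>circ)"

text \<open>
  The pairs for which the operators, and hence the optimal spectral characteristic, make
  sense.  The integral of \<open>1 / (f + g)\<close> is taken in the extended nonnegative reals,
  where the inverse of 0 is \<open>\<infinity>\<close>; its finiteness therefore forces \<open>f + g > 0\<close> a.e.
\<close>

definition admissible_pair :: "(real \<Rightarrow> real) \<Rightarrow> (real \<Rightarrow> real) \<Rightarrow> bool" where
  "admissible_pair f g \<longleftrightarrow>
     (\<integral>\<^sup>+t. inverse (ennreal (f t + g t)) \<partial>circ) < \<infinity> \<and>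
     mat_operator (mat_P f g) \<and> mat_operator (mat_R f g) \<and> mat_operator (mat_Q f g) \<and>
     mat_invertible (mat_P f g)"

text \<open>
  The quadratic forms below are real because the matrices of \<open>P\<close> and \<open>Q\<close> are Hermitian;
  \<open>Re\<close> only changes the type.
\<close>

definition operator_error :: "(nat \<Rightarrow> complex) \<Rightarrow> (real \<Rightarrow> real) \<Rightarrow> (real \<Rightarrow> real) \<Rightarrow> real" where
  "operator_error a f g =
     Re (ell2_inner (mat_app (mat_R f g) a) (mat_inv_app (mat_P f g) (mat_app (mat_R f g) a))
         + ell2_inner (mat_app (mat_Q f g) a) a)"


definition A_fun :: "(nat \<Rightarrow> complex) \<Rightarrow> real \<Rightarrow> complex" where
  "A_fun a t = (\<Sum>k. a k * cis (- t * real k))"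

text \<open>
  A trigonometric series with square-summable coefficients is summed in the mean square sense.
  By Riesz--Fischer the sum exists and is unique up to null sets; \<open>L2_sum\<close> picks a
  representative.
\<close>

definition has_L2_sum :: "(nat \<Rightarrow> real \<Rightarrow> complex) \<Rightarrow> (real \<Rightarrow> complex) \<Rightarrow> bool" where
  "has_L2_sum u F \<longleftrightarrow>
     F \<in> borel_measurable circ \<and>
     (\<lambda>N. \<integral>\<^sup>+t. ennreal ((cmod (F t - (\<Sum>k<N. u k t)))\<^sup>2) \<partial>circ) \<longlonglongrightarrow> 0"

definition L2_sum :: "(nat \<Rightarrow> real \<Rightarrow> complex) \<Rightarrow> real \<Rightarrow> complex" where
  "L2_sum u = (SOME F. has_L2_sum u F)"

definition C_fun :: "(nat \<Rightarrow> complex) \<Rightarrow> (real \<Rightarrow> real) \<Rightarrow> (real \<Rightarrow> real) \<Rightarrow> real \<Rightarrow> complex" where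
  "C_fun a f g =
     L2_sum (\<lambda>k t. mat_inv_app (mat_P f g) (mat_app (mat_R f g) a) k * cis (t * real (k + 1)))"

definition spec_char :: "(nat \<Rightarrow> complex) \<Rightarrow> (real \<Rightarrow> real) \<Rightarrow> (real \<Rightarrow> real) \<Rightarrow> real \<Rightarrow> complex" where
  "spec_char a f g t =
     A_fun a t * of_real (f t / (f t + g t)) - C_fun a f g t / of_real (f t + g t)"

definition mse ::
  "(nat \<Rightarrow> complex) \<Rightarrow> (real \<Rightarrow> complex) \<Rightarrow> (real \<Rightarrow> real) \<Rightarrow> (real \<Rightarrow> real) \<Rightarrow> ennreal" where
  "mse a h f g =
     ennreal (1 / (2 * pi)) * (\<integral>\<^sup>+t. ennreal ((cmod (A_fun a t - h t))\<^sup>2 * f t) \<partial>circ) +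
     ennreal (1 / (2 * pi)) * (\<integral>\<^sup>+t. ennreal ((cmod (h t))\<^sup>2 * g t) \<partial>circ)"


definition L2_weighted :: "(real \<Rightarrow> real) \<Rightarrow> (real \<Rightarrow> complex) set" where
  "L2_weighted F =
     {h. h \<in> borel_measurable circ \<and> integrable circ (\<lambda>t. (cmod (h t))\<^sup>2 * F t)}"

text \<open>The closed linear span of the functions \<open>t \<mapsto> exp (\<i> m t)\<close>, \<open>m = 0, -1, -2, \<dots>\<close>.\<close>

definition L2_past :: "(real \<Rightarrow> real) \<Rightarrow> (real \<Rightarrow> complex) set" where
  "L2_past F =
     {h \<in> L2_weighted F. \<forall>\<epsilon>>0. \<exists>N c.
        (\<integral>t. (cmod (h t - (\<Sum>k\<le>N. c k * cis (- t * real (k::nat)))))\<^sup>2 * F t \<partial>circ) < \<epsilon>}"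

definition H_class :: "((real \<Rightarrow> real) \<times> (real \<Rightarrow> real)) set \<Rightarrow> (real \<Rightarrow> complex) set" where
  "H_class D = (\<Inter>(f, g)\<in>D. L2_past (\<lambda>t. f t + g t))"

text \<open>
  The maximum in the first definition ranges over the pairs for which the optimal spectral
  characteristic is defined; the suprema in the second one range over the whole class.
\<close>

definition least_favorable ::
  "(nat \<Rightarrow> complex) \<Rightarrow> ((real \<Rightarrow> real) \<times> (real \<Rightarrow> real)) set \<Rightarrow>
   (real \<Rightarrow> real) \<Rightarrow> (real \<Rightarrow> real) \<Rightarrow> bool" where
  "least_favorable a D f0 g0 \<longleftrightarrow>
     (f0, g0) \<in> D \<and> admissible_pair f0 g0 \<and>
     (\<forall>(f, g)\<in>D. admissible_pair f g \<longrightarrow>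
        mse a (spec_char a f g) f g \<le> mse a (spec_char a f0 g0) f0 g0)"

definition minimax_robust ::
  "(nat \<Rightarrow> complex) \<Rightarrow> ((real \<Rightarrow> real) \<times> (real \<Rightarrow> real)) set \<Rightarrow> (real \<Rightarrow> complex) \<Rightarrow> bool" where
  "minimax_robust a D h0 \<longleftrightarrow>
     h0 \<in> H_class D \<and>
     (INF h\<in>H_class D. SUP (f, g)\<in>D. mse a h f g) = (SUP (f, g)\<in>D. mse a h0 f g)"

end

theory Submission
  imports Defs
begin

text \<open>
  Write \<open>s = f0 + g0\<close>, \<open>A\<close> for \<open>A_fun a\<close>, \<open>C\<close> for \<open>C_fun a f0 g0\<close> and \<open>h0\<close> for the spectral
  characteristic \<open>spec_char a f0 g0\<close>.  Since \<open>A g0 + C = (A - h0) s\<close> and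
  \<open>A f0 - C = h0 s\<close>, the two equations say that \<open>\<bar>A - h0\<bar> = \<alpha>1\<close> and \<open>\<bar>h0\<bar> = \<alpha>2\<close> almost
  everywhere.  The error of \<open>h0\<close> at a pair \<open>(f, g)\<close> is therefore \<open>\<alpha>1\<^sup>2\<close> times the power of \<open>f\<close>
  plus \<open>\<alpha>2\<^sup>2\<close> times the power of \<open>g\<close>, and on the whole class it is at most
  \<open>v = \<alpha>1\<^sup>2 P1 + \<alpha>2\<^sup>2 P2\<close>.  So \<open>(h0, (f0, g0))\<close> is a saddle point with value \<open>v\<close> as soon as
  three things are known.

  \<^item> The value \<open>v\<close> is attained at \<open>(f0, g0)\<close>, that is, a coefficient \<open>\<alpha>i\<close> vanishes when its
    power constraint is not exhausted.  If \<open>f0\<close> has power to spare, the pair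
    \<open>(f0 + e s, g0)\<close> still belongs to the class for a small \<open>e > 0\<close>.  In this direction the
    operators are under control: the matrices of \<open>P\<close> and \<open>R\<close> are merely divided by \<open>1 + e\<close>,
    because a constant symbol has Hankel matrix zero, so \<open>C\<close> does not change.  Maximality
    of \<open>(f0, g0)\<close> then says that \<open>A\<close> itself has at \<open>(f0, g0)\<close> no larger error than \<open>h0\<close>.  The
    optimal characteristic is unique, so \<open>h0 = A\<close> and \<open>\<alpha>1 = 0\<close> (\<open>power_slack_f\<close>).  Adding
    \<open>e s\<close> to \<open>g0\<close> gives \<open>h0 = 0\<close> and \<open>\<alpha>2 = 0\<close> in the same way (\<open>power_slack_g\<close>).

  \<^item> No competitor does better at \<open>(f0, g0)\<close>.  The normal equation \<open>P c = R a\<close> for the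
    coefficients \<open>c\<close> of \<open>C\<close> expresses that \<open>h0\<close> has no positive frequencies, while \<open>C\<close> has
    only positive ones.  As \<open>C = (A - h0) f0 - h0 g0\<close> is, up to a constant factor, the gradient
    of the error at \<open>h0\<close>, the error of any other causal \<open>h\<close> exceeds that of \<open>h0\<close> by the
    weighted squared distance from \<open>h\<close> to \<open>h0\<close> (\<open>quadratic_error_causal\<close>).

  \<^item> The function \<open>h0\<close> lies in the past of every pair of the class.  It is bounded and causal, so
    its Fejer means are causal polynomials under the same bound; a subsequence converges almost
    everywhere, hence in \<open>L\<^sub>2\<close> for every integrable weight (\<open>bounded_causal_in_L2_past\<close>).

  That \<open>(f0, g0)\<close> is least favorable is the maximality hypothesis, once the error of the optimal
  characteristic is identified with \<open>operator_error\<close> for every admissible pair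
  (\<open>mse_spec_char\<close>).  The computations for admissible pairs take place in unweighted \<open>L\<^sub>2\<close> of
  the circle, because admissibility confines \<open>f + g\<close> between two positive constants (\<open>sum_bounds\<close>): the quadratic
  form of the Toeplitz matrix \<open>P\<close>, tested on polynomials, bounds its symbol \<open>1 / (f + g)\<close> from
  both sides.
\<close>

section \<open>Square-integrable functions\<close>

definition sq_integrable :: "'a measure \<Rightarrow> ('a \<Rightarrow> complex) \<Rightarrow> bool" where
  "sq_integrable M F \<longleftrightarrow> F \<in> borel_measurable M \<and> integrable M (\<lambda>t. (cmod (F t))\<^sup>2)"

lemma sq_integrable_measurable [dest]: "sq_integrable M F \<Longrightarrow> F \<in> borel_measurable M"
  by (simp add: sq_integrable_def)

lemma sq_integrable_integrable [dest]: "sq_integrable M F \<Longrightarrow> integrable M (\<lambda>t. (cmod (F t))\<^sup>2)"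
  by (simp add: sq_integrable_def)

lemma integrable_mult_of_sq_integrable:
  assumes "sq_integrable M F" "sq_integrable M G"
  shows "integrable M (\<lambda>t. F t * G t)"
proof (rule Bochner_Integration.integrable_bound)
  show "integrable M (\<lambda>t. (cmod (F t))\<^sup>2 + (cmod (G t))\<^sup>2)"
    using assms by (auto simp: sq_integrable_def)
  show "(\<lambda>t. F t * G t) \<in> borel_measurable M"
    using assms by (auto simp: sq_integrable_def)
  show "AE t in M. cmod (F t * G t) \<le> norm ((cmod (F t))\<^sup>2 + (cmod (G t))\<^sup>2)"
  proof (rule AE_I2)
    fix t
    have "2 * (cmod (F t) * cmod (G t)) \<le> (cmod (F t))\<^sup>2 + (cmod (G t))\<^sup>2"
      using sum_squares_bound[of "cmod (F t)" "cmod (G t)"] by simp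
    moreover have "0 \<le> cmod (F t) * cmod (G t)" by simp
    ultimately have "cmod (F t) * cmod (G t) \<le> (cmod (F t))\<^sup>2 + (cmod (G t))\<^sup>2" by linarith
    then show "cmod (F t * G t) \<le> norm ((cmod (F t))\<^sup>2 + (cmod (G t))\<^sup>2)"
      by (simp add: norm_mult)
  qed
qed

lemma cmod_add_sq_le: "(cmod (x + y))\<^sup>2 \<le> 2 * (cmod x)\<^sup>2 + 2 * (cmod y)\<^sup>2"
proof -
  have "(cmod (x + y))\<^sup>2 \<le> (cmod x + cmod y)\<^sup>2"
    by (intro power_mono norm_triangle_ineq) simp
  also have "\<dots> \<le> 2 * (cmod x)\<^sup>2 + 2 * (cmod y)\<^sup>2"
    using sum_squares_bound[of "cmod x" "cmod y"] by (simp add: power2_sum)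
  finally show ?thesis .
qed

lemma sq_integrable_add:
  assumes "sq_integrable M F" "sq_integrable M G"
  shows "sq_integrable M (\<lambda>t. F t + G t)"
  unfolding sq_integrable_def
proof
  show m: "(\<lambda>t. F t + G t) \<in> borel_measurable M"
    using assms by (auto simp: sq_integrable_def)
  show "integrable M (\<lambda>t. (cmod (F t + G t))\<^sup>2)"
  proof (rule Bochner_Integration.integrable_bound)
    show "integrable M (\<lambda>t. 2 * (cmod (F t))\<^sup>2 + 2 * (cmod (G t))\<^sup>2)"
      using assms by (auto simp: sq_integrable_def)
    show "(\<lambda>t. (cmod (F t + G t))\<^sup>2) \<in> borel_measurable M"
      using m by measurable
  qed (simp add: cmod_add_sq_le)
qed

lemma sq_integrable_mult_bounded:
  assumes "sq_integrable M F" "u \<in> borel_measurable M" "AE t in M. cmod (u t) \<le> B"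
  shows "sq_integrable M (\<lambda>t. u t * F t)"
  unfolding sq_integrable_def
proof
  show m: "(\<lambda>t. u t * F t) \<in> borel_measurable M"
    using assms by (auto simp: sq_integrable_def)
  show "integrable M (\<lambda>t. (cmod (u t * F t))\<^sup>2)"
  proof (rule Bochner_Integration.integrable_bound)
    show "integrable M (\<lambda>t. B\<^sup>2 * (cmod (F t))\<^sup>2)"
      using assms by (auto simp: sq_integrable_def)
    show "(\<lambda>t. (cmod (u t * F t))\<^sup>2) \<in> borel_measurable M"
      using m by measurable
    show "AE t in M. norm ((cmod (u t * F t))\<^sup>2) \<le> norm (B\<^sup>2 * (cmod (F t))\<^sup>2)"
      using assms(3) by eventually_elim (simp add: norm_mult power_mult_distrib mult_right_mono power_mono)
  qed
qed

lemma sq_integrable_cmult: "sq_integrable M F \<Longrightarrow> sq_integrable M (\<lambda>t. c * F t)"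
  by (rule sq_integrable_mult_bounded[where B = "cmod c"]) auto

lemma sq_integrable_diff:
  assumes "sq_integrable M F" "sq_integrable M G"
  shows "sq_integrable M (\<lambda>t. F t - G t)"
  using sq_integrable_add[OF assms(1) sq_integrable_cmult[OF assms(2), of "-1"]] by simp

lemma sq_integrable_sum:
  "(\<And>i. i \<in> I \<Longrightarrow> sq_integrable M (F i)) \<Longrightarrow> sq_integrable M (\<lambda>t. \<Sum>i\<in>I. F i t)"
proof (induction I rule: infinite_finite_induct)
  case (insert x I)
  then show ?case by (simp add: sq_integrable_add)
qed (auto simp: sq_integrable_def)

lemma sq_integrable_cnj: "sq_integrable M F \<Longrightarrow> sq_integrable M (\<lambda>t. cnj (F t))"
  by (auto simp: sq_integrable_def intro: borel_measurable_continuous_on continuous_intros)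

lemma sq_integrable_bounded:
  assumes "finite_measure M" "F \<in> borel_measurable M" "AE t in M. cmod (F t) \<le> B"
  shows "sq_integrable M F"
proof -
  interpret finite_measure M by fact
  have "sq_integrable M (\<lambda>t. F t * 1)"
    by (rule sq_integrable_mult_bounded[OF _ assms(2,3)]) (simp add: sq_integrable_def)
  then show ?thesis by simp
qed

lemma sq_integrable_imp_integrable:
  assumes "finite_measure M" "sq_integrable M F"
  shows "integrable M F"
  using integrable_mult_of_sq_integrable[OF assms(2) sq_integrable_bounded[OF assms(1), of "\<lambda>_. 1" 1]]
  by simp

lemma L2_Cauchy_Schwarz:
  assumes F: "sq_integrable M F" and G: "sq_integrable M G"
  shows "(cmod (\<integral>t. F t * G t \<partial>M))\<^sup>2 \<le> (\<integral>t. (cmod (F t))\<^sup>2 \<partial>M) * (\<integral>t. (cmod (G t))\<^sup>2 \<partial>M)"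
proof -
  note [measurable] = sq_integrable_measurable[OF F] sq_integrable_measurable[OF G]
  have int: "integrable M (\<lambda>t. cmod (F t * G t))"
    using integrable_mult_of_sq_integrable[OF F G] by simp
  have "ennreal ((\<integral>t. cmod (F t * G t) \<partial>M)\<^sup>2) = (\<integral>\<^sup>+t. ennreal (cmod (F t)) * ennreal (cmod (G t)) \<partial>M)\<^sup>2"
    using nn_integral_eq_integral[OF int] by (simp add: norm_mult ennreal_mult' ennreal_power)
  also have "\<dots> \<le> (\<integral>\<^sup>+t. (ennreal (cmod (F t)))\<^sup>2 \<partial>M) * (\<integral>\<^sup>+t. (ennreal (cmod (G t)))\<^sup>2 \<partial>M)"
    by (rule Cauchy_Schwarz_nn_integral) measurable
  also have "\<dots> = ennreal ((\<integral>t. (cmod (F t))\<^sup>2 \<partial>M) * (\<integral>t. (cmod (G t))\<^sup>2 \<partial>M))"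
    using nn_integral_eq_integral[OF sq_integrable_integrable[OF F]]
      nn_integral_eq_integral[OF sq_integrable_integrable[OF G]]
    by (simp add: ennreal_power ennreal_mult')
  finally have "(\<integral>t. cmod (F t * G t) \<partial>M)\<^sup>2 \<le> (\<integral>t. (cmod (F t))\<^sup>2 \<partial>M) * (\<integral>t. (cmod (G t))\<^sup>2 \<partial>M)"
    by (subst (asm) ennreal_le_iff) (auto intro!: mult_nonneg_nonneg)
  moreover have "(cmod (\<integral>t. F t * G t \<partial>M))\<^sup>2 \<le> (\<integral>t. cmod (F t * G t) \<partial>M)\<^sup>2"
    by (intro power_mono integral_norm_bound) simp
  ultimately show ?thesis by (rule order_trans[rotated])
qed

lemma L2_inner_tendsto:
  assumes F: "sq_integrable M F" and Fn: "\<And>n. sq_integrable M (Fn n)" and G: "sq_integrable M G"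
    and lim: "(\<lambda>n. \<integral>t. (cmod (F t - Fn n t))\<^sup>2 \<partial>M) \<longlonglongrightarrow> 0"
  shows "(\<lambda>n. \<integral>t. Fn n t * G t \<partial>M) \<longlonglongrightarrow> (\<integral>t. F t * G t \<partial>M)"
proof -
  have "(\<lambda>n. (cmod (\<integral>t. (F t - Fn n t) * G t \<partial>M))\<^sup>2) \<longlonglongrightarrow> 0"
  proof (rule Lim_null_comparison)
    show "(\<lambda>n. (\<integral>t. (cmod (F t - Fn n t))\<^sup>2 \<partial>M) * (\<integral>t. (cmod (G t))\<^sup>2 \<partial>M)) \<longlonglongrightarrow> 0"
      using tendsto_mult_right[OF lim, of "\<integral>t. (cmod (G t))\<^sup>2 \<partial>M"] by simp
    have "(cmod (\<integral>t. (F t - Fn n t) * G t \<partial>M))\<^sup>2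
        \<le> (\<integral>t. (cmod (F t - Fn n t))\<^sup>2 \<partial>M) * (\<integral>t. (cmod (G t))\<^sup>2 \<partial>M)" for n
      by (intro L2_Cauchy_Schwarz sq_integrable_diff F Fn G)
    then show "\<forall>\<^sub>F n in sequentially. norm ((cmod (\<integral>t. (F t - Fn n t) * G t \<partial>M))\<^sup>2)
        \<le> (\<integral>t. (cmod (F t - Fn n t))\<^sup>2 \<partial>M) * (\<integral>t. (cmod (G t))\<^sup>2 \<partial>M)"
      by simp
  qed
  then have "(\<lambda>n. \<integral>t. (F t - Fn n t) * G t \<partial>M) \<longlonglongrightarrow> 0"
    by (simp add: tendsto_norm_zero_iff)
  moreover have "(\<integral>t. (F t - Fn n t) * G t \<partial>M) = (\<integral>t. F t * G t \<partial>M) - (\<integral>t. Fn n t * G t \<partial>M)" for n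
    using integrable_mult_of_sq_integrable[OF F G] integrable_mult_of_sq_integrable[OF Fn G]
    by (simp add: left_diff_distrib)
  ultimately have "(\<lambda>n. (\<integral>t. F t * G t \<partial>M) - (\<integral>t. Fn n t * G t \<partial>M)) \<longlonglongrightarrow> 0" by simp
  from tendsto_diff[OF tendsto_const[of "\<integral>t. F t * G t \<partial>M"] this] show ?thesis by simp
qed

section \<open>The characters of the circle\<close>

lemma circ_finite: "finite_measure circ"
  by (intro finite_measureI) (simp add: emeasure_restrict_space)

definition trig :: "int \<Rightarrow> real \<Rightarrow> complex" where
  "trig m t = cis (t * of_int m)"

lemma cmod_trig [simp]: "cmod (trig m t) = 1"
  by (simp add: trig_def)

lemma trig_0 [simp]: "trig 0 t = 1"
  by (simp add: trig_def)

lemma trig_add: "trig (m + n) t = trig m t * trig n t"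
  by (simp add: trig_def cis_mult algebra_simps)

lemma cnj_trig: "cnj (trig m t) = trig (- m) t"
  by (simp add: trig_def cis_cnj)

lemma continuous_on_trig [continuous_intros]: "continuous_on S (trig m)"
  unfolding trig_def by (intro continuous_intros)

lemma trig_measurable [measurable]: "trig m \<in> borel_measurable circ"
  by (intro continuous_imp_measurable_on_sets_lebesgue continuous_on_trig) simp

lemma sq_integrable_trig: "sq_integrable circ (trig m)"
  by (rule sq_integrable_bounded[OF circ_finite, where B = 1]) auto

lemma integral_trig: "(\<integral>t. trig m t \<partial>circ) = (if m = 0 then 2 * pi else 0)"
proof -
  have "(\<integral>t. trig m t \<partial>circ) = integral {-pi..<pi} (trig m)"
    by (rule lebesgue_integral_eq_integral)
      (auto intro: sq_integrable_imp_integrable[OF circ_finite sq_integrable_trig])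
  also have "\<dots> = integral {-pi..pi} (trig m)"
    by (rule integral_spike_set) (auto intro: negligible_subset[of "{pi}"])
  also have "\<dots> = (if m = 0 then 2 * pi else 0)"
  proof (cases "m = 0")
    case True
    then have "trig m = (\<lambda>t. 1)" by auto
    with True show ?thesis by (simp add: scaleR_conv_of_real)
  next
    case False
    have "(trig m has_integral trig m pi / (\<i> * m) - trig m (-pi) / (\<i> * m)) {-pi..pi}"
    proof (rule fundamental_theorem_of_calculus)
      fix t :: real
      show "((\<lambda>t. trig m t / (\<i> * m)) has_vector_derivative trig m t) (at t within {-pi..pi})"
      proof -
        have "((\<lambda>z. exp (\<i> * (z * m)) / (\<i> * m)) has_field_derivative exp (\<i> * (of_real t * m))) (at (of_real t))"
          using False by (auto intro!: derivative_eq_intros simp: field_simps)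
        from has_vector_derivative_real_field[OF this] show ?thesis
          by (simp add: trig_def cis_conv_exp)
      qed
    qed simp
    moreover have "trig m pi = trig m (-pi)"
      by (simp add: trig_def complex_eq_iff sin_int_times_real)
    ultimately show ?thesis using False by (simp add: integral_unique)
  qed
  finally show ?thesis .
qed

section \<open>Square-summable trigonometric series\<close>

lemma integral_cmod_diff_sq:
  assumes F: "sq_integrable M F" and G: "sq_integrable M G"
  shows "(\<integral>t. (cmod (F t - G t))\<^sup>2 \<partial>M) =
    (\<integral>t. (cmod (F t))\<^sup>2 \<partial>M) - 2 * Re (\<integral>t. F t * cnj (G t) \<partial>M) + (\<integral>t. (cmod (G t))\<^sup>2 \<partial>M)"
proof -
  have int: "integrable M (\<lambda>t. F t * cnj (G t))"
    by (intro integrable_mult_of_sq_integrable sq_integrable_cnj F G)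
  define R where "R t = Re (F t * cnj (G t))" for t
  have R: "integrable M R" "(\<integral>t. R t \<partial>M) = Re (\<integral>t. F t * cnj (G t) \<partial>M)"
    unfolding R_def by (rule integrable_Re[OF int], rule integral_Re[OF int])
  have "(cmod (F t - G t))\<^sup>2 = (cmod (F t))\<^sup>2 - 2 * R t + (cmod (G t))\<^sup>2" for t
    unfolding cmod_power2 R_def by (simp add: power2_eq_square algebra_simps)
  then show ?thesis
    using sq_integrable_integrable[OF F] sq_integrable_integrable[OF G] R by simp
qed

definition fourier_coeff :: "(real \<Rightarrow> complex) \<Rightarrow> int \<Rightarrow> complex" where
  "fourier_coeff F m = (1 / (2 * pi)) * (\<integral>t. F t * trig (- m) t \<partial>circ)"

text \<open>
  The frequencies are listed by a map \<open>n\<close>, so that one notion serves the series of \<open>A\<close>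
  (\<open>n k = - k\<close>), the series of \<open>C\<close> (\<open>n k = k + 1\<close>) and analytic polynomials (\<open>n k = k\<close>).
\<close>

definition trig_sum :: "(nat \<Rightarrow> int) \<Rightarrow> (nat \<Rightarrow> complex) \<Rightarrow> nat set \<Rightarrow> real \<Rightarrow> complex" where
  "trig_sum n c K t = (\<Sum>k\<in>K. c k * trig (n k) t)"

lemma sq_integrable_trig_sum: "sq_integrable circ (trig_sum n c K)"
  unfolding trig_sum_def by (intro sq_integrable_sum sq_integrable_cmult sq_integrable_trig)

lemma integral_mult_cnj_trig_sum:
  assumes F: "sq_integrable circ F"
  shows "(\<integral>t. F t * cnj (trig_sum n c K t) \<partial>circ) = (2 * pi) * (\<Sum>k\<in>K. fourier_coeff F (n k) * cnj (c k))"
proof -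
  have int: "integrable circ (\<lambda>t. F t * trig m t)" for m
    by (intro integrable_mult_of_sq_integrable F sq_integrable_trig)
  have "(\<integral>t. F t * cnj (trig_sum n c K t) \<partial>circ) = (\<integral>t. (\<Sum>k\<in>K. cnj (c k) * (F t * trig (- n k) t)) \<partial>circ)"
    by (simp add: trig_sum_def cnj_trig sum_distrib_left mult_ac)
  also have "\<dots> = (\<Sum>k\<in>K. cnj (c k) * (\<integral>t. F t * trig (- n k) t \<partial>circ))"
    by (subst Bochner_Integration.integral_sum) (auto intro!: int)
  finally show ?thesis
    by (simp add: fourier_coeff_def sum_distrib_left mult_ac)
qed

lemma fourier_coeff_trig_sum:
  assumes "inj n" "finite K"
  shows "fourier_coeff (trig_sum n c K) m = (\<Sum>k\<in>K. if n k = m then c k else 0)"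
proof -
  have "(\<integral>t. trig_sum n c K t * trig (- m) t \<partial>circ) = (\<integral>t. (\<Sum>k\<in>K. c k * trig (n k - m) t) \<partial>circ)"
    by (simp add: trig_sum_def sum_distrib_right mult.assoc flip: trig_add)
  also have "\<dots> = (\<Sum>k\<in>K. c k * (\<integral>t. trig (n k - m) t \<partial>circ))"
    by (subst Bochner_Integration.integral_sum)
      (auto intro!: integrable_mult_right sq_integrable_imp_integrable circ_finite sq_integrable_trig)
  also have "\<dots> = (\<Sum>k\<in>K. 2 * pi * (if n k = m then c k else 0))"
    by (intro sum.cong) (auto simp: integral_trig)
  finally show ?thesis by (simp add: fourier_coeff_def flip: sum_distrib_left)
qed

lemma integral_trig_sum_sq:
  assumes "inj n" "finite K"
  shows "(\<integral>t. (cmod (trig_sum n c K t))\<^sup>2 \<partial>circ) = 2 * pi * (\<Sum>k\<in>K. (cmod (c k))\<^sup>2)"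
proof -
  have eq: "fourier_coeff (trig_sum n c K) (n k) = c k" if "k \<in> K" for k
    using that assms by (simp add: fourier_coeff_trig_sum inj_eq)
  have "of_real (\<integral>t. (cmod (trig_sum n c K t))\<^sup>2 \<partial>circ) = (\<integral>t. trig_sum n c K t * cnj (trig_sum n c K t) \<partial>circ)"
    by (simp only: complex_norm_square flip: integral_complex_of_real)
  also have "\<dots> = of_real (2 * pi * (\<Sum>k\<in>K. (cmod (c k))\<^sup>2))"
    by (subst integral_mult_cnj_trig_sum[OF sq_integrable_trig_sum])
      (simp add: eq flip: complex_norm_square)
  finally show ?thesis by (simp only: of_real_eq_iff)
qed

text \<open>
  The squared distance from \<open>F\<close> to the partial sums of its Fourier series is nonnegative.
\<close>

lemma Bessel_inequality:
  assumes F: "sq_integrable circ F" and n: "inj n"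
  shows "summable (\<lambda>k. (cmod (fourier_coeff F (n k)))\<^sup>2)"
    and "2 * pi * (\<Sum>k. (cmod (fourier_coeff F (n k)))\<^sup>2) \<le> (\<integral>t. (cmod (F t))\<^sup>2 \<partial>circ)"
proof -
  let ?d = "\<lambda>k. fourier_coeff F (n k)"
  have bd: "2 * pi * (\<Sum>k<N. (cmod (?d k))\<^sup>2) \<le> (\<integral>t. (cmod (F t))\<^sup>2 \<partial>circ)" for N
  proof -
    have "0 \<le> (\<integral>t. (cmod (F t - trig_sum n ?d {..<N} t))\<^sup>2 \<partial>circ)" by simp
    also have "\<dots> = (\<integral>t. (cmod (F t))\<^sup>2 \<partial>circ) - 2 * Re ((2 * pi) * (\<Sum>k<N. ?d k * cnj (?d k)))
        + 2 * pi * (\<Sum>k<N. (cmod (?d k))\<^sup>2)"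
      using n by (simp add: integral_cmod_diff_sq[OF F sq_integrable_trig_sum]
          integral_mult_cnj_trig_sum[OF F] integral_trig_sum_sq)
    also have "(\<Sum>k<N. ?d k * cnj (?d k)) = of_real (\<Sum>k<N. (cmod (?d k))\<^sup>2)"
      by (simp flip: complex_norm_square)
    finally show ?thesis by (simp del: of_real_sum)
  qed
  then have bd': "(\<Sum>k<N. (cmod (?d k))\<^sup>2) \<le> (\<integral>t. (cmod (F t))\<^sup>2 \<partial>circ) / (2 * pi)" for N
    by (simp add: field_simps)
  show s: "summable (\<lambda>k. (cmod (?d k))\<^sup>2)"
    by (rule summableI_nonneg_bounded[OF _ bd']) simp
  show "2 * pi * (\<Sum>k. (cmod (?d k))\<^sup>2) \<le> (\<integral>t. (cmod (F t))\<^sup>2 \<partial>circ)"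
    using suminf_le_const[OF s bd'] by (simp add: field_simps)
qed

lemma integral_trig_sum_diff_sq_le:
  assumes n: "inj n" and c: "c \<in> ell2"
  shows "(\<integral>t. (cmod (trig_sum n c {..<M} t - trig_sum n c {..<N} t))\<^sup>2 \<partial>circ)
    \<le> 2 * pi * ((\<Sum>k. (cmod (c (k + M)))\<^sup>2) + (\<Sum>k. (cmod (c (k + N)))\<^sup>2))"
proof -
  have sm: "summable (\<lambda>k. (cmod (c k))\<^sup>2)" using c by (simp add: ell2_def)
  have *: "(\<integral>t. (cmod (trig_sum n c {..<M} t - trig_sum n c {..<N} t))\<^sup>2 \<partial>circ)
      \<le> 2 * pi * (\<Sum>k. (cmod (c (k + N)))\<^sup>2)" if "N \<le> M" for M N
  proof -
    have "trig_sum n c {..<M} t - trig_sum n c {..<N} t = trig_sum n c {N..<M} t" for t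
      using sum_diff_nat_ivl[of 0 N M "\<lambda>k. c k * trig (n k) t"] that
      by (simp add: trig_sum_def atLeast0LessThan)
    then have "(\<integral>t. (cmod (trig_sum n c {..<M} t - trig_sum n c {..<N} t))\<^sup>2 \<partial>circ)
        = 2 * pi * (\<Sum>k\<in>{N..<M}. (cmod (c k))\<^sup>2)"
      using n by (simp add: integral_trig_sum_sq)
    also have "(\<Sum>k\<in>{N..<M}. (cmod (c k))\<^sup>2) = (\<Sum>k\<in>{0..<M-N}. (cmod (c (k + N)))\<^sup>2)"
      using sum.shift_bounds_nat_ivl[of "\<lambda>k. (cmod (c k))\<^sup>2" 0 N "M - N"] that by simp
    also have "\<dots> \<le> (\<Sum>k. (cmod (c (k + N)))\<^sup>2)"
      by (rule sum_le_suminf) (use summable_ignore_initial_segment[OF sm] in auto)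
    finally show ?thesis by simp
  qed
  have nn: "0 \<le> (\<Sum>k. (cmod (c (k + N)))\<^sup>2)" for N
    by (intro suminf_nonneg summable_ignore_initial_segment sm) simp
  show ?thesis
  proof (cases "N \<le> M")
    case True
    then show ?thesis using *[OF True] mult_nonneg_nonneg[OF _ nn[of M], of "2 * pi"]
      by (simp add: distrib_left)
  next
    case False
    then have "M \<le> N" by simp
    from *[OF this] show ?thesis using mult_nonneg_nonneg[OF _ nn[of N], of "2 * pi"]
      by (subst norm_minus_commute) (simp add: distrib_left)
  qed
qed

text \<open>
  Riesz--Fischer.  Along a subsequence \<open>r\<close> of indices with tails at most \<open>4\<^sup>-\<^sup>j\<close> the
  increments of the partial sums have summable \<open>L\<^sub>1\<close> norms, so these partial sums converge almost
  everywhere; Fatou's lemma identifies the pointwise limit as the limit in mean square.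
\<close>

theorem Riesz_Fischer:
  assumes n: "inj n" and c: "c \<in> ell2"
  shows "\<exists>F. has_L2_sum (\<lambda>k t. c k * trig (n k) t) F"
proof -
  define tail where "tail N = (\<Sum>k. (cmod (c (k + N)))\<^sup>2)" for N
  have sm: "summable (\<lambda>k. (cmod (c k))\<^sup>2)" using c by (simp add: ell2_def)
  have tail0: "tail \<longlonglongrightarrow> 0"
    unfolding tail_def by (rule suminf_exist_split2[OF sm])
  have tail_nn: "0 \<le> tail N" for N
    unfolding tail_def by (intro suminf_nonneg summable_ignore_initial_segment sm) simp
  have "\<exists>N. tail N < (1/4)^j" for j :: nat
    using order_tendstoD(2)[OF tail0, of "(1/4)^j"] by (auto simp: eventually_sequentially)
  then obtain r where r: "tail (r j) < (1/4)^j" for j :: nat by metis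
  define S where "S N t = trig_sum n c {..<N} t" for N t
  have sqS: "sq_integrable circ (S N)" for N
    unfolding S_def by (rule sq_integrable_trig_sum)
  note [measurable] = sq_integrable_measurable[OF sqS]
  have diffS: "(\<integral>t. (cmod (S M t - S N t))\<^sup>2 \<partial>circ) \<le> 2 * pi * (tail M + tail N)" for M N
    unfolding S_def tail_def by (rule integral_trig_sum_diff_sq_le[OF n c])
  have diffS_nn: "(\<integral>\<^sup>+t. ennreal ((cmod (S M t - S N t))\<^sup>2) \<partial>circ) \<le> ennreal (2 * pi * (tail M + tail N))" for M N
    using diffS[of M N]
    by (subst nn_integral_eq_integral[OF sq_integrable_integrable[OF sq_integrable_diff[OF sqS sqS]]])
      (auto intro: ennreal_leI)
  define D where "D j t = cmod (S (r (Suc j)) t - S (r j) t)" for j t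
  have [measurable]: "D j \<in> borel_measurable circ" for j unfolding D_def by measurable
  have D1: "(\<integral>\<^sup>+t. ennreal (D j t) \<partial>circ) \<le> ennreal (8 * pi * (1/2)^j)" for j
  proof -
    have "D j t \<le> (1/2)^j + 2^j * (D j t)\<^sup>2" for t
    proof -
      have "2 * D j t \<le> (1/2)^j * (1 + (2^j * D j t)\<^sup>2)"
        using mult_left_mono[OF sum_squares_bound[of 1 "2^j * D j t"], of "(1/2)^j"]
        by (simp add: power_one_over field_simps)
      also have "\<dots> = (1/2)^j + 2^j * (D j t)\<^sup>2"
        by (simp add: power_one_over field_simps power2_eq_square)
      moreover have "0 \<le> D j t" by (simp add: D_def)
      ultimately show ?thesis by linarith
    qed
    then have "(\<integral>\<^sup>+t. ennreal (D j t) \<partial>circ) \<le> (\<integral>\<^sup>+t. ennreal ((1/2)^j) + ennreal (2^j) * ennreal ((D j t)\<^sup>2) \<partial>circ)"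
      by (intro nn_integral_mono) (simp add: ennreal_leI flip: ennreal_mult ennreal_plus)
    also have "\<dots> = ennreal ((1/2)^j) * emeasure circ (space circ) + ennreal (2^j) * (\<integral>\<^sup>+t. ennreal ((D j t)\<^sup>2) \<partial>circ)"
      by (subst nn_integral_add) (auto simp: nn_integral_cmult)
    also have "\<dots> \<le> ennreal ((1/2)^j) * ennreal (2 * pi) + ennreal (2^j) * ennreal (2 * pi * (tail (r (Suc j)) + tail (r j)))"
      unfolding D_def
      by (intro add_mono mult_left_mono diffS_nn) (simp_all add: emeasure_restrict_space)
    also have "\<dots> = ennreal ((1/2)^j * (2 * pi) + 2^j * (2 * pi * (tail (r (Suc j)) + tail (r j))))"
      using tail_nn by (simp flip: ennreal_mult ennreal_plus)
    also have "\<dots> \<le> ennreal (8 * pi * (1/2)^j)"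
    proof (rule ennreal_leI)
      have "tail (r (Suc j)) + tail (r j) \<le> 2 * (1/4)^j"
        using r[of j] r[of "Suc j"] tail_nn[of "r (Suc j)"] by simp
      then have "2^j * (2 * pi * (tail (r (Suc j)) + tail (r j))) \<le> 2^j * (2 * pi * (2 * (1/4)^j))"
        by (intro mult_left_mono) auto
      also have "\<dots> = 4 * pi * (2^j * (1/4)^j)" by simp
      also have "(2::real)^j * (1/4)^j = (1/2)^j"
        by (simp flip: power_mult_distrib)
      finally have "2^j * (2 * pi * (tail (r (Suc j)) + tail (r j))) \<le> 4 * (pi * (1/2)^j)" by simp
      moreover have "0 \<le> pi * (1/2)^j" by simp
      moreover have "(1/2)^j * (2 * pi) = 2 * (pi * (1/2)^j)" by simp
      ultimately show "(1/2)^j * (2 * pi) + 2^j * (2 * pi * (tail (r (Suc j)) + tail (r j))) \<le> 8 * pi * (1/2)^j"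
        by linarith
    qed
    finally show ?thesis .
  qed
  have "(\<integral>\<^sup>+t. (\<Sum>j. ennreal (D j t)) \<partial>circ) = (\<Sum>j. \<integral>\<^sup>+t. ennreal (D j t) \<partial>circ)"
    by (rule nn_integral_suminf) measurable
  also have "\<dots> \<le> (\<Sum>j. ennreal (8 * pi * (1/2)^j))"
    by (intro suminf_le D1) auto
  also have "\<dots> = ennreal (\<Sum>j. 8 * pi * (1/2)^j)"
    by (intro suminf_ennreal2 summable_mult summable_geometric) auto
  also have "\<dots> < \<infinity>" by simp
  finally have "(\<integral>\<^sup>+t. (\<Sum>j. ennreal (D j t)) \<partial>circ) \<noteq> \<infinity>" by simp
  then have "AE t in circ. (\<Sum>j. ennreal (D j t)) \<noteq> \<infinity>"
    by (intro nn_integral_noteq_infinite) measurable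
  then have conv: "AE t in circ. convergent (\<lambda>j. S (r j) t)"
  proof eventually_elim
    case (elim t)
    then have "summable (\<lambda>j. D j t)"
      by (intro summable_suminf_not_top) (auto simp: D_def)
    then have "summable (\<lambda>j. S (r (Suc j)) t - S (r j) t)"
      unfolding D_def by (rule summable_norm_cancel)
    then obtain l where "(\<lambda>j. S (r j) t - S (r 0) t) \<longlonglongrightarrow> l"
      using sum_lessThan_telescope[of "\<lambda>j. S (r j) t"] by (auto simp: summable_def sums_def)
    from tendsto_add[OF this tendsto_const[of "S (r 0) t"]] show ?case
      by (auto simp: convergent_def)
  qed
  define F where "F t = lim (\<lambda>j. S (r j) t)" for t
  have [measurable]: "F \<in> borel_measurable circ"
    unfolding F_def by measurable
  have lim: "AE t in circ. (\<lambda>j. S (r j) t) \<longlonglongrightarrow> F t"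
    using conv unfolding F_def by eventually_elim (simp add: convergent_LIMSEQ_iff)
  have bound: "(\<integral>\<^sup>+t. ennreal ((cmod (F t - S N t))\<^sup>2) \<partial>circ) \<le> ennreal (2 * pi * tail N)" for N
  proof -
    have "(\<integral>\<^sup>+t. ennreal ((cmod (F t - S N t))\<^sup>2) \<partial>circ)
        = (\<integral>\<^sup>+t. liminf (\<lambda>j. ennreal ((cmod (S (r j) t - S N t))\<^sup>2)) \<partial>circ)"
    proof (rule nn_integral_cong_AE)
      show "AE t in circ. ennreal ((cmod (F t - S N t))\<^sup>2) = liminf (\<lambda>j. ennreal ((cmod (S (r j) t - S N t))\<^sup>2))"
        using lim
      proof eventually_elim
        case (elim t)
        then have "(\<lambda>j. ennreal ((cmod (S (r j) t - S N t))\<^sup>2)) \<longlonglongrightarrow> ennreal ((cmod (F t - S N t))\<^sup>2)"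
          by (intro tendsto_intros)
        then show ?case by (intro lim_imp_Liminf[symmetric]) auto
      qed
    qed
    also have "\<dots> \<le> liminf (\<lambda>j. \<integral>\<^sup>+t. ennreal ((cmod (S (r j) t - S N t))\<^sup>2) \<partial>circ)"
      by (rule nn_integral_liminf) measurable
    also have "\<dots> \<le> liminf (\<lambda>j. ennreal (2 * pi * ((1/4)^j + tail N)))"
    proof (intro Liminf_mono always_eventually allI)
      fix j
      show "(\<integral>\<^sup>+t. ennreal ((cmod (S (r j) t - S N t))\<^sup>2) \<partial>circ) \<le> ennreal (2 * pi * ((1/4)^j + tail N))"
        using r[of j] by (intro order_trans[OF diffS_nn] ennreal_leI) auto
    qed
    also have "\<dots> = ennreal (2 * pi * (0 + tail N))"
      by (intro lim_imp_Liminf tendsto_intros LIMSEQ_realpow_zero) auto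
    finally show ?thesis by simp
  qed
  have "(\<lambda>N. \<integral>\<^sup>+t. ennreal ((cmod (F t - S N t))\<^sup>2) \<partial>circ) \<longlonglongrightarrow> 0"
  proof (rule tendsto_sandwich[of "\<lambda>_. 0"])
    have "(\<lambda>N. ennreal (2 * pi * tail N)) \<longlonglongrightarrow> ennreal (2 * pi * 0)"
      by (intro tendsto_intros tail0)
    then show "(\<lambda>N. ennreal (2 * pi * tail N)) \<longlonglongrightarrow> 0" by simp
    show "\<forall>\<^sub>F N in sequentially. (\<integral>\<^sup>+t. ennreal ((cmod (F t - S N t))\<^sup>2) \<partial>circ) \<le> ennreal (2 * pi * tail N)"
      using bound by simp
  qed simp_all
  then have "has_L2_sum (\<lambda>k t. c k * trig (n k) t) F"
    by (simp add: has_L2_sum_def S_def trig_sum_def)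
  then show ?thesis by blast
qed

lemma has_L2_sum_tendsto:
  assumes sum: "has_L2_sum (\<lambda>k t. c k * trig (n k) t) F"
  shows "sq_integrable circ F"
    and "(\<lambda>N. \<integral>t. (cmod (F t - trig_sum n c {..<N} t))\<^sup>2 \<partial>circ) \<longlonglongrightarrow> 0"
proof -
  have [measurable]: "F \<in> borel_measurable circ" using sum by (simp add: has_L2_sum_def)
  have lim: "(\<lambda>N. \<integral>\<^sup>+t. ennreal ((cmod (F t - trig_sum n c {..<N} t))\<^sup>2) \<partial>circ) \<longlonglongrightarrow> 0"
    using sum by (simp add: has_L2_sum_def trig_sum_def)
  note [measurable] = sq_integrable_measurable[OF sq_integrable_trig_sum]
  obtain N where "(\<integral>\<^sup>+t. ennreal ((cmod (F t - trig_sum n c {..<N} t))\<^sup>2) \<partial>circ) < 1"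
    using order_tendstoD(2)[OF lim, of 1] by (auto simp: eventually_sequentially)
  then have "integrable circ (\<lambda>t. (cmod (F t - trig_sum n c {..<N} t))\<^sup>2)"
    by (intro integrableI_nonneg) (auto intro: order.strict_trans)
  then have "sq_integrable circ (\<lambda>t. F t - trig_sum n c {..<N} t)"
    by (simp add: sq_integrable_def)
  from sq_integrable_add[OF this sq_integrable_trig_sum[of n c "{..<N}"]] show F: "sq_integrable circ F" by simp
  have "(\<integral>\<^sup>+t. ennreal ((cmod (F t - trig_sum n c {..<N} t))\<^sup>2) \<partial>circ)
      = ennreal (\<integral>t. (cmod (F t - trig_sum n c {..<N} t))\<^sup>2 \<partial>circ)" for N
    by (intro nn_integral_eq_integral sq_integrable_integrable sq_integrable_diff F sq_integrable_trig_sum) simp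
  with lim show "(\<lambda>N. \<integral>t. (cmod (F t - trig_sum n c {..<N} t))\<^sup>2 \<partial>circ) \<longlonglongrightarrow> 0"
    by (simp add: tendsto_ennreal_iff[where x = 0, simplified])
qed

text \<open>
  Convergence in mean square passes to inner products.  All identities for \<open>L\<^sub>2\<close> sums below
  come from this and the corresponding identity for finite sums.
\<close>

lemma has_L2_sum_inner_tendsto:
  assumes sum: "has_L2_sum (\<lambda>k t. c k * trig (n k) t) F" and G: "sq_integrable circ G"
  shows "(\<lambda>N. \<integral>t. trig_sum n c {..<N} t * G t \<partial>circ) \<longlonglongrightarrow> (\<integral>t. F t * G t \<partial>circ)"
  by (rule L2_inner_tendsto[OF has_L2_sum_tendsto(1)[OF sum] sq_integrable_trig_sum G
        has_L2_sum_tendsto(2)[OF sum]])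

lemma fourier_coeff_L2_sum:
  assumes sum: "has_L2_sum (\<lambda>k t. c k * trig (n k) t) F" and n: "inj n"
  shows "fourier_coeff F (n k) = c k" and "m \<notin> range n \<Longrightarrow> fourier_coeff F m = 0"
proof -
  have lim: "(\<lambda>N. fourier_coeff (trig_sum n c {..<N}) m) \<longlonglongrightarrow> fourier_coeff F m" for m
    unfolding fourier_coeff_def
    by (intro tendsto_mult_left has_L2_sum_inner_tendsto[OF sum] sq_integrable_trig)
  have "\<forall>\<^sub>F N in sequentially. fourier_coeff (trig_sum n c {..<N}) (n k) = c k"
    unfolding eventually_sequentially using n
    by (intro exI[of _ "Suc k"]) (auto simp: fourier_coeff_trig_sum inj_eq)
  then have "(\<lambda>N. fourier_coeff (trig_sum n c {..<N}) (n k)) \<longlonglongrightarrow> c k"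
    by (rule tendsto_eventually)
  then show "fourier_coeff F (n k) = c k"
    using lim[of "n k"] by (rule LIMSEQ_unique[rotated])
  show "fourier_coeff F m = 0" if "m \<notin> range n"
  proof -
    have "fourier_coeff (trig_sum n c {..<N}) m = 0" for N
      using n that by (auto simp: fourier_coeff_trig_sum intro!: sum.neutral)
    with lim[of m] show ?thesis by (simp add: LIMSEQ_const_iff)
  qed
qed

lemma Parseval_L2_sum:
  assumes sum: "has_L2_sum (\<lambda>k t. c k * trig (n k) t) F" and G: "sq_integrable circ G"
  shows "(\<lambda>k. fourier_coeff G (n k) * cnj (c k)) sums ((1 / (2 * pi)) * (\<integral>t. G t * cnj (F t) \<partial>circ))"
proof -
  have "(\<lambda>N. \<integral>t. trig_sum n c {..<N} t * cnj (G t) \<partial>circ) \<longlonglongrightarrow> (\<integral>t. F t * cnj (G t) \<partial>circ)"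
    by (intro has_L2_sum_inner_tendsto[OF sum] sq_integrable_cnj G)
  from tendsto_cnj[OF this]
  have "(\<lambda>N. \<integral>t. cnj (trig_sum n c {..<N} t * cnj (G t)) \<partial>circ) \<longlonglongrightarrow> (\<integral>t. cnj (F t * cnj (G t)) \<partial>circ)"
    by (simp only: Bochner_Integration.integral_cnj)
  then have "(\<lambda>N. \<integral>t. G t * cnj (trig_sum n c {..<N} t) \<partial>circ) \<longlonglongrightarrow> (\<integral>t. G t * cnj (F t) \<partial>circ)"
    by (simp add: mult.commute)
  then have "(\<lambda>N. (2 * pi) * (\<Sum>k<N. fourier_coeff G (n k) * cnj (c k))) \<longlonglongrightarrow> (\<integral>t. G t * cnj (F t) \<partial>circ)"
    by (simp add: integral_mult_cnj_trig_sum[OF G])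
  from tendsto_mult_left[OF this, of "1 / (2 * pi)"] show ?thesis
    by (simp add: sums_def)
qed

section \<open>Nonnegativity tested on polynomials\<close>

text \<open>
  The real trigonometric polynomials, as functions of \<open>z\<close> on the unit circle: Laurent polynomials
  \<open>p z / z ^ N\<close> with real values.  In this form \<open>(f z)\<^sup>2 = \<bar>p z\<bar>\<^sup>2\<close> on the circle, so squares of
  such functions are squared moduli of analytic polynomials.
\<close>

definition trig_real :: "(complex \<Rightarrow> real) set" where
  "trig_real = {f. continuous_on (sphere 0 1) f \<and>
     (\<exists>p N. \<forall>z\<in>sphere 0 1. of_real (f z) * z ^ N = poly p z)}"

interpretation trig_real: function_ring_on trig_real "sphere 0 1"
proof
  show "compact (sphere (0::complex) 1)" by simp
  show "continuous_on (sphere 0 1) f" if "f \<in> trig_real" for f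
    using that by (simp add: trig_real_def)
  show "(\<lambda>z. f z + g z) \<in> trig_real" if "f \<in> trig_real" "g \<in> trig_real" for f g
  proof -
    from that obtain p N q M where
      pq: "\<forall>z\<in>sphere 0 1. of_real (f z) * z ^ N = poly p z" "\<forall>z\<in>sphere 0 1. of_real (g z) * z ^ M = poly q z"
      by (auto simp: trig_real_def)
    have "\<forall>z\<in>sphere 0 1. of_real (f z + g z) * z ^ (N + M) = poly (p * monom 1 M + q * monom 1 N) z"
    proof
      fix z :: complex assume z: "z \<in> sphere 0 1"
      have "of_real (f z + g z) * z ^ (N + M) = (of_real (f z) * z ^ N) * z ^ M + (of_real (g z) * z ^ M) * z ^ N"
        by (simp add: power_add algebra_simps)
      also have "\<dots> = poly (p * monom 1 M + q * monom 1 N) z"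
        using pq z by (simp add: poly_monom)
      finally show "of_real (f z + g z) * z ^ (N + M) = poly (p * monom 1 M + q * monom 1 N) z" .
    qed
    then have "\<exists>p N. \<forall>z\<in>sphere 0 1. of_real (f z + g z) * z ^ N = poly p z" by blast
    with that show ?thesis by (simp add: trig_real_def continuous_on_add)
  qed
  show "(\<lambda>z. f z * g z) \<in> trig_real" if "f \<in> trig_real" "g \<in> trig_real" for f g
  proof -
    from that obtain p N q M where
      pq: "\<forall>z\<in>sphere 0 1. of_real (f z) * z ^ N = poly p z" "\<forall>z\<in>sphere 0 1. of_real (g z) * z ^ M = poly q z"
      by (auto simp: trig_real_def)
    have "\<forall>z\<in>sphere 0 1. of_real (f z * g z) * z ^ (N + M) = poly (p * q) z"
    proof
      fix z :: complex assume z: "z \<in> sphere 0 1"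
      have "of_real (f z * g z) * z ^ (N + M) = (of_real (f z) * z ^ N) * (of_real (g z) * z ^ M)"
        by (simp add: power_add)
      also have "\<dots> = poly (p * q) z"
        using pq z by simp
      finally show "of_real (f z * g z) * z ^ (N + M) = poly (p * q) z" .
    qed
    then have "\<exists>p N. \<forall>z\<in>sphere 0 1. of_real (f z * g z) * z ^ N = poly p z" by blast
    with that show ?thesis by (simp add: trig_real_def continuous_on_mult)
  qed
  show "(\<lambda>_. c) \<in> trig_real" for c
  proof -
    have "\<forall>z\<in>sphere 0 1. of_real c * z ^ 0 = poly [:of_real c:] z" by simp
    then have "\<exists>p N. \<forall>z\<in>sphere 0 1. of_real c * z ^ N = poly p z" by blast
    then show ?thesis by (simp add: trig_real_def)
  qed
  show "\<exists>f\<in>trig_real. f z \<noteq> f w" if "z \<in> sphere 0 1" "w \<in> sphere 0 1" "z \<noteq> w" for z w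
  proof -
    have cnj: "z * cnj z = 1" if "z \<in> sphere 0 1" for z
      using that by (simp add: complex_norm_square[symmetric])
    have "Re \<in> trig_real"
    proof -
      have "of_real (Re z) * z ^ 1 = poly [:1/2, 0, 1/2:] z" if "z \<in> sphere 0 1" for z
      proof -
        have "of_real (Re z) * z = (z * z + z * cnj z) / 2"
          using complex_add_cnj[of z] by (simp add: mult.commute flip: distrib_left)
        then show ?thesis by (simp add: cnj[OF that] field_simps)
      qed
      then have "\<exists>p N. \<forall>z\<in>sphere 0 1. of_real (Re z) * z ^ N = poly p z" by blast
      then show ?thesis by (simp add: trig_real_def continuous_on_Re)
    qed
    moreover have "Im \<in> trig_real"
    proof -
      have "of_real (Im z) * z ^ 1 = poly [:\<i>/2, 0, -\<i>/2:] z" if "z \<in> sphere 0 1" for z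
      proof -
        have "of_real (Im z) * z = - \<i> * (z * z - z * cnj z) / 2"
          using complex_diff_cnj[of z] by (simp add: field_simps complex_eq_iff)
        then show ?thesis by (simp add: cnj[OF that] field_simps)
      qed
      then have "\<exists>p N. \<forall>z\<in>sphere 0 1. of_real (Im z) * z ^ N = poly p z" by blast
      then show ?thesis by (simp add: trig_real_def continuous_on_Im)
    qed
    ultimately show ?thesis using that(3) complex_eq_iff[of z w] by (cases "Re z = Re w") blast+
  qed
qed

lemma poly_cis_measurable [measurable]: "(\<lambda>t. poly p (cis t)) \<in> borel_measurable circ"
  by (intro continuous_imp_measurable_on_sets_lebesgue continuous_intros) simp

lemma integrable_mult_continuous_circle:
  fixes \<psi> :: "real \<Rightarrow> real"
  assumes \<psi>: "integrable circ \<psi>" and u: "continuous_on (sphere 0 1) (u :: complex \<Rightarrow> real)"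
  shows "integrable circ (\<lambda>t. \<psi> t * u (cis t))"
proof -
  have "compact (u ` sphere 0 1)" by (intro compact_continuous_image u) simp
  then obtain B where B: "\<And>z. z \<in> sphere 0 1 \<Longrightarrow> norm (u z) \<le> B"
    by (meson bounded_iff compact_imp_bounded imageI)
  have [measurable]: "(\<lambda>t. u (cis t)) \<in> borel_measurable circ"
    by (intro continuous_imp_measurable_on_sets_lebesgue continuous_on_compose2[OF u] continuous_intros) auto
  show ?thesis
  proof (rule Bochner_Integration.integrable_bound)
    show "integrable circ (\<lambda>t. B * \<psi> t)" using \<psi> by simp
    show "(\<lambda>t. \<psi> t * u (cis t)) \<in> borel_measurable circ"
      using \<psi> by measurable
    show "AE t in circ. norm (\<psi> t * u (cis t)) \<le> norm (B * \<psi> t)"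
    proof (rule AE_I2)
      fix t
      have "\<bar>u (cis t)\<bar> \<le> \<bar>B\<bar>" using B[of "cis t"] by simp
      then have "\<bar>\<psi> t\<bar> * \<bar>u (cis t)\<bar> \<le> \<bar>\<psi> t\<bar> * \<bar>B\<bar>" by (intro mult_left_mono) auto
      then show "norm (\<psi> t * u (cis t)) \<le> norm (B * \<psi> t)"
        by (simp add: abs_mult mult.commute)
    qed
  qed
qed

text \<open>
  By Stone--Weierstrass every real continuous function \<open>u\<close> on the circle is a uniform limit of real
  trigonometric polynomials, so the hypothesis extends from \<open>\<bar>p\<bar>\<^sup>2\<close> to \<open>u\<^sup>2\<close>, and then to
  indicators of closed sets.  If \<open>\<psi>\<close> were negative on a set of positive measure, it would be
  negative on a compact set \<open>T\<close> of positive measure, and the image of \<open>T\<close> on the circle would be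
  a closed set with a negative integral.
\<close>

lemma AE_nonneg_if_nonneg_on_polynomials:
  fixes \<psi> :: "real \<Rightarrow> real"
  assumes \<psi>: "integrable circ \<psi>"
    and pos: "\<And>p. 0 \<le> (\<integral>t. \<psi> t * (cmod (poly p (cis t)))\<^sup>2 \<partial>circ)"
  shows "AE t in circ. 0 \<le> \<psi> t"
proof -
  have [measurable]: "\<psi> \<in> borel_measurable circ" using \<psi> by simp
  have cont: "0 \<le> (\<integral>t. \<psi> t * (u (cis t))\<^sup>2 \<partial>circ)" if u: "continuous_on (sphere 0 1) u" for u :: "complex \<Rightarrow> real"
  proof -
    have "\<exists>v\<in>trig_real. \<forall>z\<in>sphere 0 1. \<bar>u z - v z\<bar> < 1 / real (Suc n)" for n
      by (rule trig_real.Stone_Weierstrass_basic[OF u]) simp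
    then obtain v where v: "\<And>n. v n \<in> trig_real" "\<And>n z. z \<in> sphere 0 1 \<Longrightarrow> \<bar>u z - v n z\<bar> < 1 / real (Suc n)"
      by metis
    have nonneg: "0 \<le> (\<integral>t. \<psi> t * (v n (cis t))\<^sup>2 \<partial>circ)" for n
    proof -
      obtain p N where pN: "\<forall>z\<in>sphere 0 1. of_real (v n z) * z ^ N = poly p z"
        using v(1)[of n] by (auto simp: trig_real_def)
      have "(v n (cis t))\<^sup>2 = (cmod (poly p (cis t)))\<^sup>2" for t
      proof -
        have "cmod (poly p (cis t)) = cmod (of_real (v n (cis t)) * cis t ^ N)" using pN by simp
        then show ?thesis by (simp add: norm_mult norm_power)
      qed
      with pos[of p] show ?thesis by simp
    qed
    have lim: "(\<lambda>n. v n z) \<longlonglongrightarrow> u z" if "z \<in> sphere 0 1" for z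
    proof -
      have "(\<lambda>n. u z - v n z) \<longlonglongrightarrow> 0"
      proof (rule Lim_null_comparison)
        show "\<forall>\<^sub>F n in sequentially. norm (u z - v n z) \<le> inverse (real (Suc n))"
          using less_imp_le[OF v(2)[OF that]] by (simp add: inverse_eq_divide)
      qed (rule LIMSEQ_inverse_real_of_nat)
      from tendsto_diff[OF tendsto_const[of "u z"] this] show ?thesis by simp
    qed
    have "compact (u ` sphere 0 1)" by (intro compact_continuous_image u) simp
    then obtain B where B: "\<And>z. z \<in> sphere 0 1 \<Longrightarrow> norm (u z) \<le> B"
      by (meson bounded_iff compact_imp_bounded imageI)
    have "(\<lambda>n. \<integral>t. \<psi> t * (v n (cis t))\<^sup>2 \<partial>circ) \<longlonglongrightarrow> (\<integral>t. \<psi> t * (u (cis t))\<^sup>2 \<partial>circ)"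
    proof (rule integral_dominated_convergence)
      show "(\<lambda>t. \<psi> t * (u (cis t))\<^sup>2) \<in> borel_measurable circ"
        by (rule borel_measurable_integrable[OF integrable_mult_continuous_circle[OF \<psi>
                continuous_on_power[OF u]]])
      show "(\<lambda>t. \<psi> t * (v n (cis t))\<^sup>2) \<in> borel_measurable circ" for n
        by (rule borel_measurable_integrable[OF integrable_mult_continuous_circle[OF \<psi>
                continuous_on_power[OF trig_real.continuous[OF v(1)]]]])
      show "integrable circ (\<lambda>t. \<bar>\<psi> t\<bar> * (B + 1)\<^sup>2)" using \<psi> by simp
      show "AE t in circ. (\<lambda>n. \<psi> t * (v n (cis t))\<^sup>2) \<longlonglongrightarrow> \<psi> t * (u (cis t))\<^sup>2"
        by (intro AE_I2 tendsto_intros lim) simp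
      show "AE t in circ. norm (\<psi> t * (v n (cis t))\<^sup>2) \<le> \<bar>\<psi> t\<bar> * (B + 1)\<^sup>2" for n
      proof (rule AE_I2)
        fix t
        have "1 / real (Suc n) \<le> 1" by simp
        then have "\<bar>v n (cis t)\<bar> \<le> \<bar>B + 1\<bar>"
          using B[of "cis t"] v(2)[of "cis t" n] unfolding mem_sphere dist_0_norm norm_cis real_norm_def
          by linarith
        then have "(v n (cis t))\<^sup>2 \<le> (B + 1)\<^sup>2" by (simp add: abs_le_square_iff)
        then show "norm (\<psi> t * (v n (cis t))\<^sup>2) \<le> \<bar>\<psi> t\<bar> * (B + 1)\<^sup>2"
          by (simp add: abs_mult mult_left_mono)
      qed
    qed
    then show ?thesis by (rule LIMSEQ_le_const) (use nonneg in auto)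
  qed
  have closed: "0 \<le> (\<integral>t. \<psi> t * indicator K (cis t) \<partial>circ)" if K: "closed K" "K \<noteq> {}" for K :: "complex set"
  proof -
    \<comment> \<open>continuous functions decreasing to the indicator of \<open>K\<close>\<close>
    define u where "u n z = 1 - min 1 (real n * infdist z K)" for n and z :: complex
    have cu: "continuous_on S (u n)" for S n
      unfolding u_def by (intro continuous_intros)
    have "(\<lambda>n. \<integral>t. \<psi> t * (u n (cis t))\<^sup>2 \<partial>circ) \<longlonglongrightarrow> (\<integral>t. \<psi> t * indicator K (cis t) \<partial>circ)"
    proof (rule integral_dominated_convergence)
      have "cis \<in> circ \<rightarrow>\<^sub>M borel"
        by (intro continuous_imp_measurable_on_sets_lebesgue continuous_intros) simp
      moreover have "indicator K \<in> (borel :: complex measure) \<rightarrow>\<^sub>M (borel :: real measure)"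
        using K by (intro borel_measurable_indicator) simp
      ultimately have [measurable]: "(\<lambda>t. indicator K (cis t)::real) \<in> borel_measurable circ"
        by (rule measurable_compose)
      show "(\<lambda>t. \<psi> t * indicator K (cis t)) \<in> borel_measurable circ" by measurable
      show "(\<lambda>t. \<psi> t * (u n (cis t))\<^sup>2) \<in> borel_measurable circ" for n
        by (rule borel_measurable_integrable[OF integrable_mult_continuous_circle[OF \<psi>
                continuous_on_power[OF cu]]])
      show "integrable circ (\<lambda>t. \<bar>\<psi> t\<bar>)" using \<psi> by simp
      show "AE t in circ. (\<lambda>n. \<psi> t * (u n (cis t))\<^sup>2) \<longlonglongrightarrow> \<psi> t * indicator K (cis t)"
      proof (intro AE_I2 tendsto_mult tendsto_const)
        fix t
        show "(\<lambda>n. (u n (cis t))\<^sup>2) \<longlonglongrightarrow> indicator K (cis t)"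
        proof (cases "cis t \<in> K")
          case True
          then show ?thesis by (simp add: u_def)
        next
          case False
          then have d: "0 < infdist (cis t) K"
            using K by (simp add: in_closed_iff_infdist_zero infdist_nonneg order_less_le)
          obtain N :: nat where N: "1 / infdist (cis t) K < N" using reals_Archimedean2 by blast
          have "(u n (cis t))\<^sup>2 = indicator K (cis t)" if "n \<ge> N" for n
          proof -
            have "1 / infdist (cis t) K < real n" using N that by linarith
            then have "1 \<le> real n * infdist (cis t) K" using d by (simp add: field_simps)
            then show ?thesis using False by (simp add: u_def)
          qed
          then show ?thesis by (intro tendsto_eventually) (auto simp: eventually_sequentially)
        qed
      qed
      show "AE t in circ. norm (\<psi> t * (u n (cis t))\<^sup>2) \<le> \<bar>\<psi> t\<bar>" for n
      proof (rule AE_I2)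
        fix t
        have "\<bar>u n (cis t)\<bar> \<le> 1" using infdist_nonneg[of "cis t" K] by (auto simp: u_def)
        then have "(u n (cis t))\<^sup>2 \<le> 1" by (simp add: abs_square_le_1)
        then show "norm (\<psi> t * (u n (cis t))\<^sup>2) \<le> \<bar>\<psi> t\<bar>"
          by (simp add: abs_mult mult_left_le)
      qed
    qed
    then show ?thesis by (rule LIMSEQ_le_const) (use cont[OF cu] in auto)
  qed
  define N where "N = {t \<in> {-pi..<pi}. \<psi> t < 0}"
  have "N = {t \<in> space circ. \<psi> t < 0}" by (simp add: N_def)
  also have "\<dots> \<in> sets circ" by measurable
  finally have Nc: "N \<in> sets circ" .
  then have N: "N \<in> sets lebesgue" by (simp add: sets_restrict_space_iff)
  have eN: "emeasure circ T = emeasure lebesgue T" if "T \<subseteq> {-pi..<pi}" for T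
    using that by (subst emeasure_restrict_space) auto
  have "emeasure lebesgue N = 0"
  proof (rule ccontr)
    assume pos: "emeasure lebesgue N \<noteq> 0"
    then obtain d where d: "0 < d" "d < emeasure lebesgue N"
      using dense[of 0 "emeasure lebesgue N"] by (auto simp: zero_less_iff_neq_zero)
    then obtain e :: real where e: "0 < e" "ennreal e < emeasure lebesgue N"
      by (cases d) auto
    obtain T where T: "closed T" "T \<subseteq> N" "emeasure lebesgue (N - T) < ennreal e"
      using sets_lebesgue_inner_closed[OF N e(1)] by metis
    have T_sets: "T \<in> sets lebesgue" using T(1) by auto
    have "emeasure lebesgue T \<noteq> 0"
    proof
      assume "emeasure lebesgue T = 0"
      then have "emeasure lebesgue N = emeasure lebesgue (N - T)"
        using T_sets N by (simp add: emeasure_Diff_null_set null_setsI)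
      with T(3) e(2) show False by simp
    qed
    have T_sub: "T \<subseteq> {-pi..<pi}" using T(2) by (auto simp: N_def)
    have "compact T"
      using T(1) bounded_subset[OF bounded_closed_interval[of "-pi" pi], of T] T_sub
      by (force simp: compact_eq_bounded_closed)
    then have "compact (cis ` T)" by (intro compact_continuous_image continuous_intros)
    moreover have "T \<noteq> {}" using \<open>emeasure lebesgue T \<noteq> 0\<close> by auto
    ultimately have "0 \<le> (\<integral>t. \<psi> t * indicator (cis ` T) (cis t) \<partial>circ)"
      by (intro closed) (auto simp: compact_imp_closed)
    also have "\<dots> = (\<integral>t. \<psi> t * indicator T t \<partial>circ)"
    proof (intro Bochner_Integration.integral_cong refl)
      fix t assume t: "t \<in> space circ"
      have "cis t \<in> cis ` T \<longleftrightarrow> t \<in> T"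
      proof
        assume "cis t \<in> cis ` T"
        then obtain s where s: "s \<in> T" "cis t = cis s" by auto
        have "t = s"
        proof -
          have "sin t = sin s" "cos t = cos s" using s(2) by (auto simp: complex_eq_iff)
          \<comment> \<open>both points lie in the half-open period interval, where \<open>cis\<close> is injective\<close>
          then obtain k :: int where k: "t = s + 2 * pi * k" using sin_cos_eq_iff by metis
          have "\<bar>2 * pi * k\<bar> < 2 * pi" using k t s(1) T_sub by force
          then have "\<bar>k\<bar> < 1" by (simp add: abs_mult)
          with k show ?thesis by simp
        qed
        with s(1) show "t \<in> T" by simp
      qed auto
      then show "\<psi> t * indicator (cis ` T) (cis t) = \<psi> t * indicator T t"
        by (simp add: indicator_def)
    qed
    finally have ge: "0 \<le> (\<integral>t. \<psi> t * indicator T t \<partial>circ)" .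
    have Tc: "T \<in> sets circ" using T_sets T_sub by (simp add: sets_restrict_space_iff)
    have int: "integrable circ (\<lambda>t. - (\<psi> t * indicator T t))"
      using integrable_mult_indicator[OF Tc \<psi>] by (simp add: mult.commute)
    have nn: "AE t in circ. 0 \<le> - (\<psi> t * indicator T t)"
      using T(2) by (intro AE_I2) (auto simp: indicator_def N_def)
    have "0 \<le> (\<integral>t. - (\<psi> t * indicator T t) \<partial>circ)"
      by (rule integral_nonneg_AE[OF nn])
    with ge have "(\<integral>t. - (\<psi> t * indicator T t) \<partial>circ) = 0" by simp
    then have "AE t in circ. - (\<psi> t * indicator T t) = 0"
      using integral_nonneg_eq_0_iff_AE[OF int nn] by simp
    then have "AE t in circ. t \<notin> T"
      by eventually_elim (use T(2) in \<open>auto simp: N_def\<close>)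
    then have "T \<in> null_sets circ"
      using AE_iff_null_sets[OF Tc] by simp
    then have "emeasure circ T = 0" by auto
    with \<open>emeasure lebesgue T \<noteq> 0\<close> show False by (simp add: eN[OF T_sub])
  qed
  then have "N \<in> null_sets circ"
    using Nc eN[of N] by (simp add: N_def null_sets_def subset_iff)
  then have "AE t in circ. t \<notin> N" by (rule AE_not_in)
  then show ?thesis
    using AE_space by eventually_elim (auto simp: N_def not_less)
qed


lemma poly_cis_eq_trig_sum: "poly p (cis t) = trig_sum int (coeff p) {..degree p} t"
proof -
  have "cis t ^ k = trig (int k) t" for k
    by (simp only: Complex.DeMoivre trig_def of_int_of_nat_eq mult.commute)
  then show ?thesis by (simp add: poly_altdef trig_sum_def)
qed

lemma integral_mult_trig_sum:
  assumes F: "integrable circ F"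
  shows "integrable circ (\<lambda>t. F t * trig_sum n c K t)"
    and "(\<integral>t. F t * trig_sum n c K t \<partial>circ) = (2 * pi) * (\<Sum>k\<in>K. fourier_coeff F (- n k) * c k)"
proof -
  have int: "integrable circ (\<lambda>t. F t * trig m t)" for m
    by (rule Bochner_Integration.integrable_bound[OF F]) (use F in \<open>auto simp: norm_mult\<close>)
  have eq: "(\<lambda>t. F t * trig_sum n c K t) = (\<lambda>t. \<Sum>k\<in>K. c k * (F t * trig (n k) t))"
    by (simp add: trig_sum_def sum_distrib_left mult_ac)
  show "integrable circ (\<lambda>t. F t * trig_sum n c K t)"
    unfolding eq by (intro Bochner_Integration.integrable_sum integrable_mult_right int)
  have "(\<integral>t. F t * trig_sum n c K t \<partial>circ) = (\<Sum>k\<in>K. c k * (\<integral>t. F t * trig (n k) t \<partial>circ))"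
    unfolding eq by (subst Bochner_Integration.integral_sum) (auto intro!: int)
  then show "(\<integral>t. F t * trig_sum n c K t \<partial>circ) = (2 * pi) * (\<Sum>k\<in>K. fourier_coeff F (- n k) * c k)"
    by (simp add: fourier_coeff_def sum_distrib_left mult_ac)
qed

lemma fourier_coeff_mult_trig: "fourier_coeff (\<lambda>t. F t * trig m t) l = fourier_coeff F (l - m)"
proof -
  have "trig m t * trig (- l) t = trig (- (l - m)) t" for t
    by (simp flip: trig_add)
  then show ?thesis by (simp add: fourier_coeff_def mult.assoc)
qed

lemma fourier_coeff_mult_trig_sum:
  assumes F: "integrable circ F"
  shows "fourier_coeff (\<lambda>t. F t * trig_sum n c K t) l = (\<Sum>k\<in>K. fourier_coeff F (l - n k) * c k)"
proof -
  have int: "integrable circ (\<lambda>t. F t * trig (- l) t)"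
    by (rule Bochner_Integration.integrable_bound[OF F]) (use F in \<open>auto simp: norm_mult\<close>)
  have "fourier_coeff (\<lambda>t. F t * trig_sum n c K t) l =
      (1 / (2 * pi)) * (\<integral>t. (F t * trig (- l) t) * trig_sum n c K t \<partial>circ)"
    by (simp add: fourier_coeff_def mult_ac)
  also have "\<dots> = (\<Sum>k\<in>K. fourier_coeff F (l - n k) * c k)"
    by (simp add: integral_mult_trig_sum[OF int] fourier_coeff_mult_trig)
  finally show ?thesis .
qed

text \<open>
  The quadratic form of a Toeplitz matrix at the coefficient sequence of a polynomial is the integral
  of its symbol against the squared modulus of the polynomial.
\<close>

lemma integral_mult_poly_sq:
  fixes \<psi> :: "real \<Rightarrow> real"
  assumes \<psi>: "integrable circ \<psi>"
  shows "(\<Sum>l\<le>degree p. (\<Sum>k\<le>degree p. fourier_coeff (\<lambda>t. of_real (\<psi> t)) (int l - int k) * coeff p k) * cnj (coeff p l))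
    = of_real ((1 / (2 * pi)) * (\<integral>t. \<psi> t * (cmod (poly p (cis t)))\<^sup>2 \<partial>circ))"
proof -
  let ?x = "coeff p" and ?K = "{..degree p}"
  let ?S = "trig_sum int ?x ?K"
  have \<psi>': "integrable circ (\<lambda>t. complex_of_real (\<psi> t))" using \<psi> by simp
  have cnj: "cnj (?S t) = trig_sum (\<lambda>k. - int k) (\<lambda>k. cnj (?x k)) ?K t" for t
    by (simp add: trig_sum_def cnj_trig)
  have "of_real (\<psi> t * (cmod (poly p (cis t)))\<^sup>2) = (of_real (\<psi> t) * ?S t) * cnj (?S t)" for t
    by (simp only: of_real_mult complex_norm_square poly_cis_eq_trig_sum mult.assoc)
  then have "of_real (\<integral>t. \<psi> t * (cmod (poly p (cis t)))\<^sup>2 \<partial>circ) = (\<integral>t. (of_real (\<psi> t) * ?S t) * cnj (?S t) \<partial>circ)"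
    by (simp only: flip: integral_complex_of_real)
  also have "\<dots> = (2 * pi) * (\<Sum>l\<in>?K. fourier_coeff (\<lambda>t. of_real (\<psi> t) * ?S t) (int l) * cnj (?x l))"
    unfolding cnj by (subst integral_mult_trig_sum(2)[OF integral_mult_trig_sum(1)[OF \<psi>']]) simp
  finally show ?thesis
    by (simp add: fourier_coeff_mult_trig_sum[OF \<psi>'])
qed

text \<open>
  Vanishing Fourier coefficients make every integral of \<open>c F\<close> against \<open>\<bar>p\<bar>\<^sup>2\<close> vanish, so
  \<open>Re (c F)\<close> is nonnegative for \<open>c = \<plusminus>1, \<plusminus>\<i>\<close>.
\<close>

lemma AE_zero_if_fourier_coeff_zero:
  assumes F: "integrable circ F" and zero: "\<And>m. fourier_coeff F m = 0"
  shows "AE t in circ. F t = 0"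
proof -
  have Re0: "AE t in circ. 0 \<le> Re (c * F t)" for c
  proof (rule AE_nonneg_if_nonneg_on_polynomials)
    have cF: "integrable circ (\<lambda>t. c * F t)" using F by simp
    then show "integrable circ (\<lambda>t. Re (c * F t))" by (rule integrable_Re)
    fix p
    let ?S = "trig_sum int (coeff p) {..degree p}"
    have FS: "integrable circ (\<lambda>t. c * F t * ?S t)" by (rule integral_mult_trig_sum(1)[OF cF])
    have cnj: "cnj (?S t) = trig_sum (\<lambda>k. - int k) (\<lambda>k. cnj (coeff p k)) {..degree p} t" for t
      by (simp add: trig_sum_def cnj_trig)
    have z: "fourier_coeff (\<lambda>t. c * F t) m = 0" for m
      using zero[of m] by (simp add: fourier_coeff_def mult.assoc)
    have int: "integrable circ (\<lambda>t. c * F t * ?S t * cnj (?S t))"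
      unfolding cnj by (rule integral_mult_trig_sum(1)[OF FS])
    have "(\<integral>t. c * F t * ?S t * cnj (?S t) \<partial>circ) = 0"
      unfolding cnj by (subst integral_mult_trig_sum(2)[OF FS]) (simp add: fourier_coeff_mult_trig_sum[OF cF] z)
    then have "(\<integral>t. Re (c * F t * ?S t * cnj (?S t)) \<partial>circ) = 0"
      using integral_Re[OF int] by simp
    moreover have "Re (c * F t * ?S t * cnj (?S t)) = Re (c * F t) * (cmod (poly p (cis t)))\<^sup>2" for t
    proof -
      have "c * F t * ?S t * cnj (?S t) = c * F t * of_real ((cmod (poly p (cis t)))\<^sup>2)"
        by (simp only: poly_cis_eq_trig_sum complex_norm_square mult.assoc)
      then show ?thesis by (simp only: Re_complex_of_real times_complex.sel Im_complex_of_real mult_zero_right diff_zero)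
    qed
    ultimately show "0 \<le> (\<integral>t. Re (c * F t) * (cmod (poly p (cis t)))\<^sup>2 \<partial>circ)" by simp
  qed
  show ?thesis
    using Re0[of 1] Re0[of "-1"] Re0[of \<i>] Re0[of "-\<i>"]
    by eventually_elim (simp add: complex_eq_iff)
qed

section \<open>Admissible pairs have densities bounded away from zero and infinity\<close>

lemma mat_P_eq_fourier_coeff:
  "mat_P f g l k = fourier_coeff (\<lambda>t. of_real (1 / (f t + g t))) (int l - int k)"
proof -
  have "cis (t * (real k - real l)) / of_real (f t + g t) = of_real (1 / (f t + g t)) * trig (- (int l - int k)) t" for t
    by (simp add: trig_def)
  then show ?thesis unfolding mat_P_def fourier_coeff_def by (simp only:)
qed

lemma mat_R_eq_fourier_coeff:
  "mat_R f g l m = fourier_coeff (\<lambda>t. of_real (f t / (f t + g t))) (int l + 1 + int m)"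
proof -
  have "- t * real (l + 1 + m) = t * of_int (- (int l + 1 + int m))" for t :: real
    by (simp add: algebra_simps)
  then have "cis (- t * real (l + 1 + m)) * of_real (f t / (f t + g t))
      = of_real (f t / (f t + g t)) * trig (- (int l + 1 + int m)) t" for t
    unfolding trig_def by (simp only: mult.commute)
  then show ?thesis unfolding mat_R_def fourier_coeff_def by (simp only:)
qed

lemma mat_Q_eq_fourier_coeff:
  "mat_Q f g l k = fourier_coeff (\<lambda>t. of_real (f t * g t / (f t + g t))) (int k - int l)"
proof -
  have "t * (real l - real k) = t * of_int (- (int k - int l))" for t :: real
    by simp
  then have "cis (t * (real l - real k)) * of_real (f t * g t / (f t + g t))
      = of_real (f t * g t / (f t + g t)) * trig (- (int k - int l)) t" for t
    unfolding trig_def by (simp only: mult.commute)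
  then show ?thesis unfolding mat_Q_def fourier_coeff_def by (simp only:)
qed

text \<open>
  Boundedness in a form without square roots and with a constant that may be divided by.
\<close>

lemma bounded_on_ell2_sq:
  assumes "bounded_on_ell2 T"
  obtains B where "B > 0"
    "\<And>x. x \<in> ell2 \<Longrightarrow> T x \<in> ell2 \<and> (\<Sum>k. (cmod (T x k))\<^sup>2) \<le> B * (\<Sum>k. (cmod (x k))\<^sup>2)"
proof -
  obtain B where B: "\<And>x. x \<in> ell2 \<Longrightarrow> T x \<in> ell2 \<and> ell2_norm (T x) \<le> B * ell2_norm x"
    using assms by (auto simp: bounded_on_ell2_def)
  show thesis
  proof (rule that)
    show "0 < (\<bar>B\<bar> + 1)\<^sup>2" by (simp add: add_nonneg_pos)
    fix x assume x: "x \<in> ell2"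
    have nn: "0 \<le> (\<Sum>k. (cmod (x k))\<^sup>2)" if "x \<in> ell2" for x
      using that by (auto simp: ell2_def intro: suminf_nonneg)
    have "ell2_norm (T x) \<le> B * ell2_norm x" using B[OF x] by blast
    also have "\<dots> \<le> (\<bar>B\<bar> + 1) * ell2_norm x"
      by (intro mult_right_mono) (auto simp: ell2_norm_def nn x)
    finally have "(ell2_norm (T x))\<^sup>2 \<le> ((\<bar>B\<bar> + 1) * ell2_norm x)\<^sup>2"
      by (intro power_mono) (use B[OF x] in \<open>auto simp: ell2_norm_def nn\<close>)
    then show "T x \<in> ell2 \<and> (\<Sum>k. (cmod (T x k))\<^sup>2) \<le> (\<bar>B\<bar> + 1)\<^sup>2 * (\<Sum>k. (cmod (x k))\<^sup>2)"
      using B[OF x] x by (simp add: ell2_norm_def nn power_mult_distrib)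
  qed
qed

lemma coeff_in_ell2: "coeff p \<in> ell2"
  unfolding ell2_def by (auto intro!: summable_finite[of "{..degree p}"] intro: le_degree)

lemma coeff_norm_sq:
  "2 * pi * (\<Sum>k. (cmod (coeff p k))\<^sup>2) = (\<integral>t. (cmod (poly p (cis t)))\<^sup>2 \<partial>circ)"
proof -
  have "(\<Sum>k. (cmod (coeff p k))\<^sup>2) = (\<Sum>k\<le>degree p. (cmod (coeff p k))\<^sup>2)"
    by (rule suminf_finite) (auto simp: coeff_eq_0)
  then show ?thesis
    by (simp add: poly_cis_eq_trig_sum integral_trig_sum_sq inj_on_def)
qed

lemma sq_integrable_poly_cis: "sq_integrable circ (\<lambda>t. poly p (cis t))"
  unfolding poly_cis_eq_trig_sum by (rule sq_integrable_trig_sum)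

text \<open>
  The matrix \<open>P\<close> is Toeplitz with symbol \<open>1 / (f + g)\<close>.  An upper bound for the operator gives an
  upper bound for the symbol, and an upper bound for the inverse gives a lower bound.
\<close>

locale admissible_densities =
  fixes f g :: "real \<Rightarrow> real"
  assumes f: "spectral_density f" and g: "spectral_density g" and adm: "admissible_pair f g"
begin

lemma f_measurable [measurable]: "f \<in> borel_measurable circ"
  using f by (auto simp: spectral_density_def)

lemma g_measurable [measurable]: "g \<in> borel_measurable circ"
  using g by (auto simp: spectral_density_def)

lemma nonneg: "AE t in circ. 0 \<le> f t \<and> 0 \<le> g t"
  using f g by (intro AE_I2) (auto simp: spectral_density_def)

lemma sum_pos: "AE t in circ. 0 < f t + g t"
proof -
  have "AE t in circ. inverse (ennreal (f t + g t)) \<noteq> \<infinity>"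
    using adm by (intro nn_integral_noteq_infinite) (auto simp: admissible_pair_def)
  then show ?thesis
    using nonneg by eventually_elim (auto simp: ennreal_inverse_eq_top_iff ennreal_eq_0_iff)
qed

lemma integrable_inverse_sum: "integrable circ (\<lambda>t. 1 / (f t + g t))"
proof (rule integrableI_nonneg)
  show "AE t in circ. 0 \<le> 1 / (f t + g t)" using sum_pos by eventually_elim simp
  have "(\<integral>\<^sup>+t. ennreal (1 / (f t + g t)) \<partial>circ) = (\<integral>\<^sup>+t. inverse (ennreal (f t + g t)) \<partial>circ)"
    by (rule nn_integral_cong_AE) (use sum_pos in eventually_elim, simp add: inverse_ennreal inverse_eq_divide)
  then show "(\<integral>\<^sup>+t. ennreal (1 / (f t + g t)) \<partial>circ) < \<infinity>"
    using adm by (simp add: admissible_pair_def)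
qed measurable

lemma mat_app_P_coeff:
  "mat_app (mat_P f g) (coeff p) l =
    (\<Sum>k\<le>degree p. fourier_coeff (\<lambda>t. of_real (1 / (f t + g t))) (int l - int k) * coeff p k)"
  unfolding mat_app_def mat_P_eq_fourier_coeff
  by (rule suminf_finite) (auto simp: coeff_eq_0)

lemma mat_P_form:
  "(1 / (2 * pi)) * (\<integral>t. 1 / (f t + g t) * (cmod (poly p (cis t)))\<^sup>2 \<partial>circ)
    = Re (\<Sum>l\<le>degree p. mat_app (mat_P f g) (coeff p) l * cnj (coeff p l))"
  unfolding mat_app_P_coeff by (subst integral_mult_poly_sq[OF integrable_inverse_sum]) (simp only: Re_complex_of_real)

lemma inverse_sum_upper: "\<exists>B>0. AE t in circ. 1 / (f t + g t) \<le> B"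
proof -
  have "bounded_on_ell2 (mat_app (mat_P f g))"
    using adm by (simp add: admissible_pair_def mat_operator_def)
  then obtain B where B: "B > 0" "\<And>x. x \<in> ell2 \<Longrightarrow> mat_app (mat_P f g) x \<in> ell2 \<and>
      (\<Sum>k. (cmod (mat_app (mat_P f g) x k))\<^sup>2) \<le> B * (\<Sum>k. (cmod (x k))\<^sup>2)"
    by (rule bounded_on_ell2_sq) blast
  have "AE t in circ. 0 \<le> (1 + B) / 2 - 1 / (f t + g t)"
  proof (rule AE_nonneg_if_nonneg_on_polynomials)
    show "integrable circ (\<lambda>t. (1 + B) / 2 - 1 / (f t + g t))"
      using integrable_inverse_sum finite_measure.integrable_const[OF circ_finite] by (rule Bochner_Integration.integrable_diff[rotated])
    fix p :: "complex poly"
    let ?x = "coeff p"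
    let ?y = "mat_app (mat_P f g) ?x"
    let ?X = "\<Sum>k. (cmod (?x k))\<^sup>2"
    have y: "?y \<in> ell2" "(\<Sum>k. (cmod (?y k))\<^sup>2) \<le> B * ?X"
      using B(2)[OF coeff_in_ell2] by auto
    have "Re (\<Sum>l\<le>degree p. ?y l * cnj (?x l)) \<le> (\<Sum>l\<le>degree p. ((cmod (?y l))\<^sup>2 + (cmod (?x l))\<^sup>2) / 2)"
      unfolding Re_sum
    proof (rule sum_mono)
      fix l
      \<comment> \<open>the arithmetic-geometric mean inequality is enough, since the size of the bound is immaterial\<close>
      have "2 * Re (?y l * cnj (?x l)) \<le> 2 * (cmod (?y l) * cmod (?x l))"
        using complex_Re_le_cmod[of "?y l * cnj (?x l)"] by (simp add: norm_mult)
      also have "\<dots> \<le> (cmod (?y l))\<^sup>2 + (cmod (?x l))\<^sup>2"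
        using sum_squares_bound[of "cmod (?y l)" "cmod (?x l)"] by simp
      finally show "Re (?y l * cnj (?x l)) \<le> ((cmod (?y l))\<^sup>2 + (cmod (?x l))\<^sup>2) / 2" by simp
    qed
    also have "\<dots> = ((\<Sum>l\<le>degree p. (cmod (?y l))\<^sup>2) + (\<Sum>l\<le>degree p. (cmod (?x l))\<^sup>2)) / 2"
      by (simp add: sum.distrib flip: sum_divide_distrib)
    finally have "Re (\<Sum>l\<le>degree p. ?y l * cnj (?x l))
        \<le> ((\<Sum>l\<le>degree p. (cmod (?y l))\<^sup>2) + (\<Sum>l\<le>degree p. (cmod (?x l))\<^sup>2)) / 2" .
    moreover have "(\<Sum>l\<le>degree p. (cmod (?y l))\<^sup>2) \<le> (\<Sum>k. (cmod (?y k))\<^sup>2)"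
      using y by (intro sum_le_suminf) (auto simp: ell2_def)
    moreover have "(\<Sum>l\<le>degree p. (cmod (?x l))\<^sup>2) \<le> ?X"
      using coeff_in_ell2[of p] by (intro sum_le_suminf) (auto simp: ell2_def)
    ultimately have "Re (\<Sum>l\<le>degree p. ?y l * cnj (?x l)) \<le> (B * ?X + ?X) / 2"
      using y(2) by argo
    then have "(1 / (2 * pi)) * (\<integral>t. 1 / (f t + g t) * (cmod (poly p (cis t)))\<^sup>2 \<partial>circ) \<le> (B * ?X + ?X) / 2"
      unfolding mat_P_form .
    then have "(\<integral>t. 1 / (f t + g t) * (cmod (poly p (cis t)))\<^sup>2 \<partial>circ) \<le> (1 + B) / 2 * (2 * pi * ?X)"
      by (simp add: field_simps)
    also have "\<dots> = (1 + B) / 2 * (\<integral>t. (cmod (poly p (cis t)))\<^sup>2 \<partial>circ)"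
      by (simp only: coeff_norm_sq)
    finally have "(\<integral>t. 1 / (f t + g t) * (cmod (poly p (cis t)))\<^sup>2 \<partial>circ) \<le> (1 + B) / 2 * (\<integral>t. (cmod (poly p (cis t)))\<^sup>2 \<partial>circ)" .
    moreover have "(\<integral>t. ((1 + B) / 2 - 1 / (f t + g t)) * (cmod (poly p (cis t)))\<^sup>2 \<partial>circ)
        = (1 + B) / 2 * (\<integral>t. (cmod (poly p (cis t)))\<^sup>2 \<partial>circ) - (\<integral>t. 1 / (f t + g t) * (cmod (poly p (cis t)))\<^sup>2 \<partial>circ)"
      unfolding left_diff_distrib
      by (subst Bochner_Integration.integral_diff)
        (auto intro!: integrable_mult_right sq_integrable_integrable[OF sq_integrable_poly_cis]
          integrable_mult_continuous_circle[OF integrable_inverse_sum, of "\<lambda>z. (cmod (poly p z))\<^sup>2"] continuous_intros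
          simp del: times_divide_eq_left)
    ultimately show "0 \<le> (\<integral>t. ((1 + B) / 2 - 1 / (f t + g t)) * (cmod (poly p (cis t)))\<^sup>2 \<partial>circ)" by simp
  qed
  then show ?thesis using B(1) by (intro exI[of _ "(1 + B) / 2"]) simp
qed

text \<open>
  With \<open>\<phi> = 1 / (f + g) \<le> U\<close>, Bessel's inequality and a bound \<open>B\<close> for the squared norm of the
  inverse of \<open>P\<close> give
  \<open>\<integral>\<bar>p\<bar>\<^sup>2 \<le> B \<integral>\<phi>\<^sup>2\<bar>p\<bar>\<^sup>2 \<le> B U \<integral>\<phi>\<bar>p\<bar>\<^sup>2\<close> for every polynomial \<open>p\<close>.
\<close>

lemma inverse_sum_lower: "\<exists>d>0. AE t in circ. d \<le> 1 / (f t + g t)"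
proof -
  obtain U where U: "U > 0" "AE t in circ. 1 / (f t + g t) \<le> U"
    using inverse_sum_upper by blast
  have inv: "bij_betw (mat_app (mat_P f g)) ell2 ell2" "bounded_on_ell2 (mat_inv_app (mat_P f g))"
    using adm by (auto simp: admissible_pair_def mat_invertible_def)
  from inv(2) obtain B where B: "B > 0" "\<And>x. x \<in> ell2 \<Longrightarrow> mat_inv_app (mat_P f g) x \<in> ell2 \<and>
      (\<Sum>k. (cmod (mat_inv_app (mat_P f g) x k))\<^sup>2) \<le> B * (\<Sum>k. (cmod (x k))\<^sup>2)"
    by (rule bounded_on_ell2_sq) blast
  let ?\<phi> = "\<lambda>t. 1 / (f t + g t)"
  have "AE t in circ. 0 \<le> ?\<phi> t - 1 / (B * U)"
  proof (rule AE_nonneg_if_nonneg_on_polynomials)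
    show "integrable circ (\<lambda>t. ?\<phi> t - 1 / (B * U))"
      using integrable_inverse_sum finite_measure.integrable_const[OF circ_finite] by (rule Bochner_Integration.integrable_diff)
    fix p :: "complex poly"
    let ?S = "\<lambda>t. poly p (cis t)"
    let ?G = "\<lambda>t. of_real (?\<phi> t) * ?S t"
    let ?x = "coeff p"
    let ?y = "mat_app (mat_P f g) ?x"
    have G: "sq_integrable circ ?G"
    proof (rule sq_integrable_mult_bounded[OF sq_integrable_poly_cis])
      show "AE t in circ. cmod (of_real (?\<phi> t)) \<le> U"
        using U(2) sum_pos by eventually_elim (simp only: norm_of_real, simp)
    qed measurable
    have y: "?y \<in> ell2" using inv(1) coeff_in_ell2 by (auto simp: bij_betw_def)
    have yl: "?y l = fourier_coeff ?G (int l)" for l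
      unfolding mat_app_P_coeff poly_cis_eq_trig_sum
      by (subst fourier_coeff_mult_trig_sum[OF integrable_of_real[OF integrable_inverse_sum]]) simp
    have "mat_inv_app (mat_P f g) ?y = ?x"
      using inv(1) coeff_in_ell2 by (simp add: mat_inv_app_def bij_betw_def)
    then have "(\<Sum>k. (cmod (?x k))\<^sup>2) \<le> B * (\<Sum>k. (cmod (?y k))\<^sup>2)"
      using B(2)[OF y] by simp
    then have "2 * pi * (\<Sum>k. (cmod (?x k))\<^sup>2) \<le> B * (2 * pi * (\<Sum>k. (cmod (?y k))\<^sup>2))"
      by simp
    also have "\<dots> \<le> B * (\<integral>t. (cmod (?G t))\<^sup>2 \<partial>circ)"
      unfolding yl using B(1) by (intro mult_left_mono Bessel_inequality[OF G]) (auto simp: inj_on_def)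
    finally have low: "2 * pi * (\<Sum>k. (cmod (?x k))\<^sup>2) \<le> B * (\<integral>t. (cmod (?G t))\<^sup>2 \<partial>circ)" .
    have "(\<integral>t. (cmod (?G t))\<^sup>2 \<partial>circ) \<le> (\<integral>t. U * (?\<phi> t * (cmod (?S t))\<^sup>2) \<partial>circ)"
    proof (rule integral_mono_AE)
      show "integrable circ (\<lambda>t. (cmod (?G t))\<^sup>2)" using G by auto
      show "integrable circ (\<lambda>t. U * (?\<phi> t * (cmod (?S t))\<^sup>2))"
        by (intro integrable_mult_right integrable_mult_continuous_circle[OF integrable_inverse_sum, of "\<lambda>z. (cmod (poly p z))\<^sup>2"] continuous_intros)
      show "AE t in circ. (cmod (?G t))\<^sup>2 \<le> U * (?\<phi> t * (cmod (?S t))\<^sup>2)"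
        using U(2) sum_pos
      proof eventually_elim
        case (elim t)
        have "(cmod (?G t))\<^sup>2 = ?\<phi> t * (?\<phi> t * (cmod (?S t))\<^sup>2)"
          using elim by (simp add: norm_mult norm_divide power_mult_distrib power2_eq_square del: of_real_add)
        also have "\<dots> \<le> U * (?\<phi> t * (cmod (?S t))\<^sup>2)"
          using elim by (intro mult_right_mono) auto
        finally show ?case .
      qed
    qed
    also have "\<dots> = U * (\<integral>t. ?\<phi> t * (cmod (?S t))\<^sup>2 \<partial>circ)"
      by (rule integral_mult_right_zero)
    finally have "B * (\<integral>t. (cmod (?G t))\<^sup>2 \<partial>circ) \<le> B * (U * (\<integral>t. ?\<phi> t * (cmod (?S t))\<^sup>2 \<partial>circ))"
      using B(1) by (intro mult_left_mono) auto
    from order_trans[OF low this] have "(\<integral>t. (cmod (?S t))\<^sup>2 \<partial>circ) \<le> B * (U * (\<integral>t. ?\<phi> t * (cmod (?S t))\<^sup>2 \<partial>circ))"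
      by (simp only: coeff_norm_sq)
    then have "1 / (B * U) * (\<integral>t. (cmod (?S t))\<^sup>2 \<partial>circ) \<le> (\<integral>t. ?\<phi> t * (cmod (?S t))\<^sup>2 \<partial>circ)"
      using B(1) U(1) by (simp add: divide_le_eq mult_ac)
    moreover have "(\<integral>t. (?\<phi> t - 1 / (B * U)) * (cmod (?S t))\<^sup>2 \<partial>circ)
        = (\<integral>t. ?\<phi> t * (cmod (?S t))\<^sup>2 \<partial>circ) - 1 / (B * U) * (\<integral>t. (cmod (?S t))\<^sup>2 \<partial>circ)"
      unfolding left_diff_distrib
      by (subst Bochner_Integration.integral_diff)
        (auto intro!: integrable_mult_right sq_integrable_integrable[OF sq_integrable_poly_cis]
          integrable_mult_continuous_circle[OF integrable_inverse_sum, of "\<lambda>z. (cmod (poly p z))\<^sup>2"] continuous_intros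
          simp del: times_divide_eq_left)
    ultimately show "0 \<le> (\<integral>t. (?\<phi> t - 1 / (B * U)) * (cmod (?S t))\<^sup>2 \<partial>circ)" by simp
  qed
  then show ?thesis using B(1) U(1) by (intro exI[of _ "1 / (B * U)"]) simp
qed

lemma sum_bounds:
  obtains m M where "0 < m" "0 < M" "AE t in circ. m \<le> f t + g t \<and> f t + g t \<le> M"
proof -
  obtain B where B: "B > 0" "AE t in circ. 1 / (f t + g t) \<le> B" using inverse_sum_upper by blast
  obtain d where d: "d > 0" "AE t in circ. d \<le> 1 / (f t + g t)" using inverse_sum_lower by blast
  have "AE t in circ. 1 / B \<le> f t + g t \<and> f t + g t \<le> 1 / d"
    using B(2) d(2) sum_pos by eventually_elim (use B(1) d(1) in \<open>auto simp: field_simps\<close>)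
  then show thesis using B(1) d(1) by (intro that[of "1 / B" "1 / d"]) auto
qed

end

section \<open>Toeplitz and Hankel matrices with bounded symbols\<close>

lemma fourier_coeff_bounded_mult_L2_sum:
  assumes u: "u \<in> borel_measurable circ" "AE t in circ. cmod (u t) \<le> B"
    and sum: "has_L2_sum (\<lambda>k t. x k * trig (n k) t) F"
  shows "(\<lambda>k. fourier_coeff u (m - n k) * x k) sums fourier_coeff (\<lambda>t. u t * F t) m"
proof -
  have u_sq: "sq_integrable circ u"
    by (rule sq_integrable_bounded[OF circ_finite u])
  have "sq_integrable circ (\<lambda>t. u t * trig (- m) t)"
    by (rule sq_integrable_mult_bounded[OF sq_integrable_trig u])
  from tendsto_mult_left[OF has_L2_sum_inner_tendsto[OF sum this], of "1 / (2 * pi)"]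
  have "(\<lambda>N. fourier_coeff (\<lambda>t. u t * trig_sum n x {..<N} t) m) \<longlonglongrightarrow> fourier_coeff (\<lambda>t. u t * F t) m"
    by (simp add: fourier_coeff_def mult_ac)
  then show ?thesis
    by (simp add: sums_def fourier_coeff_mult_trig_sum[OF sq_integrable_imp_integrable[OF circ_finite u_sq]])
qed

lemma L2_sum_norm_sq:
  assumes sum: "has_L2_sum (\<lambda>k t. c k * trig (n k) t) F" and n: "inj n"
  shows "(\<integral>t. (cmod (F t))\<^sup>2 \<partial>circ) = 2 * pi * (\<Sum>k. (cmod (c k))\<^sup>2)"
proof -
  have "(\<lambda>k. c k * cnj (c k)) sums ((1 / (2 * pi)) * (\<integral>t. F t * cnj (F t) \<partial>circ))"
    using Parseval_L2_sum[OF sum has_L2_sum_tendsto(1)[OF sum]] by (simp add: fourier_coeff_L2_sum[OF sum n])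
  also have "(1 / (2 * pi)) * (\<integral>t. F t * cnj (F t) \<partial>circ) = of_real ((1 / (2 * pi)) * (\<integral>t. (cmod (F t))\<^sup>2 \<partial>circ))"
    by (simp flip: complex_norm_square of_real_power)
  also have "(\<lambda>k. c k * cnj (c k)) = (\<lambda>k. of_real ((cmod (c k))\<^sup>2))"
    by (simp only: complex_norm_square)
  finally have "(\<lambda>k. (cmod (c k))\<^sup>2) sums ((1 / (2 * pi)) * (\<integral>t. (cmod (F t))\<^sup>2 \<partial>circ))"
    by (simp only: sums_of_real_iff)
  from sums_unique[OF this] show ?thesis by (simp add: field_simps)
qed

text \<open>
  The matrix is multiplication by \<open>u\<close> between coefficient sequences, so it is bounded by Bessel's
  inequality and the bound of \<open>u\<close>.  The index maps \<open>i\<close> and \<open>n\<close> cover Toeplitz and Hankel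
  matrices alike.
\<close>

lemma mat_operator_bounded_symbol:
  assumes u: "u \<in> borel_measurable circ" "AE t in circ. cmod (u t) \<le> B"
    and i: "inj i" and n: "inj n"
  shows "mat_operator (\<lambda>l k. fourier_coeff u (i l - n k))"
proof -
  let ?M = "\<lambda>l k. fourier_coeff u (i l - n k)"
  have *: "(\<forall>l. summable (\<lambda>k. ?M l k * x k)) \<and> mat_app ?M x \<in> ell2 \<and> ell2_norm (mat_app ?M x) \<le> \<bar>B\<bar> * ell2_norm x"
    if x: "x \<in> ell2" for x
  proof -
    obtain F where F: "has_L2_sum (\<lambda>k t. x k * trig (n k) t) F"
      using Riesz_Fischer[OF n x] by blast
    have sums: "(\<lambda>k. ?M l k * x k) sums fourier_coeff (\<lambda>t. u t * F t) (i l)" for l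
      by (rule fourier_coeff_bounded_mult_L2_sum[OF u F])
    then have app: "mat_app ?M x l = fourier_coeff (\<lambda>t. u t * F t) (i l)" for l
      by (simp add: mat_app_def sums_iff)
    have uF: "sq_integrable circ (\<lambda>t. u t * F t)"
      by (rule sq_integrable_mult_bounded[OF has_L2_sum_tendsto(1)[OF F] u])
    note bessel = Bessel_inequality[OF uF i]
    have "2 * pi * (\<Sum>l. (cmod (mat_app ?M x l))\<^sup>2) \<le> (\<integral>t. (cmod (u t * F t))\<^sup>2 \<partial>circ)"
      unfolding app by (rule bessel(2))
    also have "\<dots> \<le> (\<integral>t. B\<^sup>2 * (cmod (F t))\<^sup>2 \<partial>circ)"
    proof (rule integral_mono_AE)
      show "integrable circ (\<lambda>t. (cmod (u t * F t))\<^sup>2)" using uF by auto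
      show "integrable circ (\<lambda>t. B\<^sup>2 * (cmod (F t))\<^sup>2)" using has_L2_sum_tendsto(1)[OF F] by auto
      show "AE t in circ. (cmod (u t * F t))\<^sup>2 \<le> B\<^sup>2 * (cmod (F t))\<^sup>2"
        using u(2) by eventually_elim (simp add: norm_mult power_mult_distrib mult_right_mono power_mono)
    qed
    also have "\<dots> = 2 * pi * (B\<^sup>2 * (\<Sum>k. (cmod (x k))\<^sup>2))"
      by (simp add: L2_sum_norm_sq[OF F n])
    finally have "(\<Sum>l. (cmod (mat_app ?M x l))\<^sup>2) \<le> B\<^sup>2 * (\<Sum>k. (cmod (x k))\<^sup>2)" by simp
    then have "ell2_norm (mat_app ?M x) \<le> \<bar>B\<bar> * ell2_norm x"
      unfolding ell2_norm_def using real_sqrt_le_mono by (fastforce simp: real_sqrt_mult)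
    moreover have "mat_app ?M x \<in> ell2"
      unfolding ell2_def app using bessel(1) by simp
    ultimately show ?thesis using sums by (auto simp: sums_iff)
  qed
  then show ?thesis
    unfolding mat_operator_def bounded_on_ell2_def by blast
qed

section \<open>The optimal spectral characteristic and its error\<close>

lemma summable_imp_ell2:
  assumes "summable (\<lambda>k. cmod (a k))"
  shows "a \<in> ell2"
proof -
  have "\<forall>\<^sub>F k in sequentially. cmod (a k) < 1"
    using order_tendstoD(2)[OF summable_LIMSEQ_zero[OF assms], of 1] by simp
  then have "\<forall>\<^sub>F k in sequentially. norm ((cmod (a k))\<^sup>2) \<le> cmod (a k)"
    by eventually_elim (simp add: power2_eq_square mult_left_le)
  then have "summable (\<lambda>k. (cmod (a k))\<^sup>2)"
    by (rule summable_comparison_test_ev) (rule assms)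
  then show ?thesis by (simp add: ell2_def)
qed

lemma A_fun_partial_sum_bound:
  assumes a: "summable (\<lambda>k. cmod (a k))"
  shows "cmod (A_fun a t - trig_sum (\<lambda>k. - int k) a {..<N} t) \<le> (\<Sum>k. cmod (a (k + N)))"
proof -
  have A: "A_fun a t = (\<Sum>k. a k * trig (- int k) t)"
    by (simp add: A_fun_def trig_def)
  have s: "summable (\<lambda>k. a k * trig (- int k) t)"
    by (rule summable_norm_cancel) (use a in \<open>simp add: norm_mult\<close>)
  have "A_fun a t - trig_sum (\<lambda>k. - int k) a {..<N} t = (\<Sum>k. a (k + N) * trig (- int (k + N)) t)"
    unfolding A trig_sum_def by (subst suminf_split_initial_segment[OF s, of N]) simp
  also have "cmod \<dots> \<le> (\<Sum>k. cmod (a (k + N) * trig (- int (k + N)) t))"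
    by (rule summable_norm) (use summable_ignore_initial_segment[OF a, of N] in \<open>simp add: norm_mult\<close>)
  finally show ?thesis by (simp add: norm_mult)
qed

lemma A_fun_measurable:
  assumes a: "summable (\<lambda>k. cmod (a k))"
  shows "A_fun a \<in> borel_measurable circ"
proof (rule borel_measurable_LIMSEQ_metric)
  show "trig_sum (\<lambda>k. - int k) a {..<N} \<in> borel_measurable circ" for N
    using sq_integrable_trig_sum by auto
  fix t
  have "(\<lambda>N. A_fun a t - trig_sum (\<lambda>k. - int k) a {..<N} t) \<longlonglongrightarrow> 0"
    by (rule Lim_null_comparison[OF _ suminf_exist_split2[OF a]])
      (simp add: A_fun_partial_sum_bound[OF a])
  from tendsto_diff[OF tendsto_const[of "A_fun a t"] this]
  show "(\<lambda>N. trig_sum (\<lambda>k. - int k) a {..<N} t) \<longlonglongrightarrow> A_fun a t" by simp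
qed

text \<open>
  The defining series of \<open>A\<close> converges uniformly, in particular in mean square.  This puts \<open>A\<close>
  and \<open>C\<close> on the same footing.
\<close>

lemma A_fun_L2_sum:
  assumes a: "summable (\<lambda>k. cmod (a k))"
  shows "has_L2_sum (\<lambda>k t. a k * trig (- int k) t) (A_fun a)"
proof -
  define tail where "tail N = (\<Sum>k. cmod (a (k + N)))" for N
  have "(\<lambda>N. \<integral>\<^sup>+t. ennreal ((cmod (A_fun a t - trig_sum (\<lambda>k. - int k) a {..<N} t))\<^sup>2) \<partial>circ) \<longlonglongrightarrow> 0"
  proof (rule tendsto_sandwich[of "\<lambda>_. 0"])
    have "(\<lambda>N. ennreal ((tail N)\<^sup>2 * (2 * pi))) \<longlonglongrightarrow> ennreal (0\<^sup>2 * (2 * pi))"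
      unfolding tail_def by (intro tendsto_intros suminf_exist_split2[OF a])
    then show "(\<lambda>N. ennreal ((tail N)\<^sup>2 * (2 * pi))) \<longlonglongrightarrow> 0" by simp
    have "(\<integral>\<^sup>+t. ennreal ((cmod (A_fun a t - trig_sum (\<lambda>k. - int k) a {..<N} t))\<^sup>2) \<partial>circ)
        \<le> ennreal ((tail N)\<^sup>2 * (2 * pi))" for N
    proof -
      have "(\<integral>\<^sup>+t. ennreal ((cmod (A_fun a t - trig_sum (\<lambda>k. - int k) a {..<N} t))\<^sup>2) \<partial>circ)
          \<le> (\<integral>\<^sup>+t. ennreal ((tail N)\<^sup>2) \<partial>circ)"
        unfolding tail_def
        by (intro nn_integral_mono ennreal_leI power_mono A_fun_partial_sum_bound[OF a]) simp
      also have "\<dots> = ennreal ((tail N)\<^sup>2 * (2 * pi))"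
        by (simp add: emeasure_restrict_space ennreal_mult)
      finally show ?thesis .
    qed
    then show "\<forall>\<^sub>F N in sequentially. (\<integral>\<^sup>+t. ennreal ((cmod (A_fun a t - trig_sum (\<lambda>k. - int k) a {..<N} t))\<^sup>2) \<partial>circ)
        \<le> ennreal ((tail N)\<^sup>2 * (2 * pi))" by simp
  qed simp_all
  then show ?thesis
    by (simp add: has_L2_sum_def A_fun_measurable[OF a] trig_sum_def)
qed

locale filtering_problem = admissible_densities f g for f g :: "real \<Rightarrow> real" +
  fixes a :: "nat \<Rightarrow> complex"
  assumes a: "summable (\<lambda>k. cmod (a k))"
begin

definition C_coeff :: "nat \<Rightarrow> complex" where
  "C_coeff = mat_inv_app (mat_P f g) (mat_app (mat_R f g) a)"

definition quadratic_error :: "(real \<Rightarrow> complex) \<Rightarrow> real" where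
  "quadratic_error h =
    (1 / (2 * pi)) * (\<integral>t. (cmod (A_fun a t - h t))\<^sup>2 * f t + (cmod (h t))\<^sup>2 * g t \<partial>circ)"

lemma A_measurable [measurable]: "A_fun a \<in> borel_measurable circ"
  by (rule A_fun_measurable[OF a])

lemma A_sq_integrable: "sq_integrable circ (A_fun a)"
  by (rule has_L2_sum_tendsto(1)[OF A_fun_L2_sum[OF a]])

lemma mat_app_R_in_ell2: "mat_app (mat_R f g) a \<in> ell2"
  using adm summable_imp_ell2[OF a]
  by (auto simp: admissible_pair_def mat_operator_def bounded_on_ell2_def)

lemma bij_P: "bij_betw (mat_app (mat_P f g)) ell2 ell2"
  using adm by (simp add: admissible_pair_def mat_invertible_def)

lemma C_coeff_in_ell2: "C_coeff \<in> ell2"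
  using bij_betw_inv_into[OF bij_P] mat_app_R_in_ell2
  by (auto simp: C_coeff_def mat_inv_app_def bij_betw_def)

lemma mat_app_P_C_coeff: "mat_app (mat_P f g) C_coeff = mat_app (mat_R f g) a"
  unfolding C_coeff_def mat_inv_app_def
  by (rule bij_betw_inv_into_right[OF bij_P mat_app_R_in_ell2])

lemma C_L2_sum: "has_L2_sum (\<lambda>k t. C_coeff k * trig (int k + 1) t) (C_fun a f g)"
proof -
  have "cis (t * real (k + 1)) = trig (int k + 1) t" for t k
    by (simp add: trig_def add.commute)
  then have "C_fun a f g = L2_sum (\<lambda>k t. C_coeff k * trig (int k + 1) t)"
    by (simp add: C_fun_def C_coeff_def)
  moreover have "inj (\<lambda>k. int k + 1)" by (simp add: inj_on_def)
  ultimately show ?thesis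
    using someI_ex[OF Riesz_Fischer[OF _ C_coeff_in_ell2, of "\<lambda>k. int k + 1"]] by (simp add: L2_sum_def)
qed

lemma C_sq_integrable: "sq_integrable circ (C_fun a f g)"
  by (rule has_L2_sum_tendsto(1)[OF C_L2_sum])

lemma C_measurable [measurable]: "C_fun a f g \<in> borel_measurable circ"
  using C_sq_integrable by auto

lemma inverse_sum_bounded:
  obtains U where "AE t in circ. cmod (of_real (1 / (f t + g t))) \<le> U"
proof -
  obtain U where "AE t in circ. 1 / (f t + g t) \<le> U" using inverse_sum_upper by blast
  then have "AE t in circ. cmod (of_real (1 / (f t + g t))) \<le> U"
    using sum_pos by eventually_elim (simp only: norm_of_real, simp)
  then show thesis by (rule that)
qed

lemma ratio_bounded: "AE t in circ. cmod (of_real (f t / (f t + g t))) \<le> 1"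
  using sum_pos nonneg by eventually_elim (simp only: norm_of_real, simp)

lemma harmonic_bounds:
  obtains M where "AE t in circ. 0 \<le> f t * g t / (f t + g t) \<and> f t * g t / (f t + g t) \<le> M"
proof -
  obtain m M where "AE t in circ. m \<le> f t + g t \<and> f t + g t \<le> M"
    by (rule sum_bounds) blast
  then have "AE t in circ. 0 \<le> f t * g t / (f t + g t) \<and> f t * g t / (f t + g t) \<le> M"
    using sum_pos nonneg
  proof eventually_elim
    case (elim t)
    have "f t * g t \<le> (f t + g t) * (f t + g t)" using elim by (intro mult_mono) auto
    then have "f t * g t / (f t + g t) \<le> f t + g t" using elim by (simp add: divide_le_eq)
    then show ?case using elim by simp
  qed
  then show thesis by (rule that)
qed

text \<open>
  This lemma and the next one read the normal equation \<open>P c = R a\<close> as an equality of the Fourier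
  coefficients of \<open>A f / (f + g)\<close> and \<open>C / (f + g)\<close> at all positive frequencies.
\<close>

lemma mat_app_R_fourier_coeff:
  "mat_app (mat_R f g) a l = fourier_coeff (\<lambda>t. of_real (f t / (f t + g t)) * A_fun a t) (int l + 1)"
proof -
  have "(\<lambda>k. fourier_coeff (\<lambda>t. of_real (f t / (f t + g t))) (int l + 1 - (- int k)) * a k)
      sums fourier_coeff (\<lambda>t. of_real (f t / (f t + g t)) * A_fun a t) (int l + 1)"
    by (rule fourier_coeff_bounded_mult_L2_sum[OF _ ratio_bounded A_fun_L2_sum[OF a]]) measurable
  then show ?thesis by (simp add: mat_app_def mat_R_eq_fourier_coeff sums_iff)
qed

lemma mat_app_P_fourier_coeff:
  "mat_app (mat_P f g) C_coeff l = fourier_coeff (\<lambda>t. of_real (1 / (f t + g t)) * C_fun a f g t) (int l + 1)"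
proof -
  obtain U where U: "AE t in circ. cmod (of_real (1 / (f t + g t))) \<le> U" by (rule inverse_sum_bounded)
  have "(\<lambda>k. fourier_coeff (\<lambda>t. of_real (1 / (f t + g t))) (int l + 1 - (int k + 1)) * C_coeff k)
      sums fourier_coeff (\<lambda>t. of_real (1 / (f t + g t)) * C_fun a f g t) (int l + 1)"
    by (rule fourier_coeff_bounded_mult_L2_sum[OF _ U C_L2_sum]) measurable
  then show ?thesis by (simp add: mat_app_def mat_P_eq_fourier_coeff sums_iff)
qed

text \<open>
  Parseval's identity turns both inner products into integrals, the first one after \<open>R a\<close> has been
  replaced by \<open>P c\<close>.
\<close>

lemma operator_error_eq:
  "operator_error a f g =
    (1 / (2 * pi)) * (\<integral>t. (cmod (C_fun a f g t))\<^sup>2 / (f t + g t) \<partial>circ)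
    + (1 / (2 * pi)) * (\<integral>t. (cmod (A_fun a t))\<^sup>2 * (f t * g t / (f t + g t)) \<partial>circ)"
proof -
  obtain U where U: "AE t in circ. cmod (of_real (1 / (f t + g t))) \<le> U" by (rule inverse_sum_bounded)
  obtain M where M: "AE t in circ. 0 \<le> f t * g t / (f t + g t) \<and> f t * g t / (f t + g t) \<le> M"
    by (rule harmonic_bounds)
  let ?q = "\<lambda>t. complex_of_real (f t * g t / (f t + g t))"
  have q: "AE t in circ. cmod (?q t) \<le> M"
    using M by eventually_elim (simp only: norm_of_real abs_of_nonneg)
  have sq: "sq_integrable circ (\<lambda>t. of_real (1 / (f t + g t)) * C_fun a f g t)"
    by (rule sq_integrable_mult_bounded[OF C_sq_integrable _ U]) measurable
  have "(\<lambda>k. mat_app (mat_R f g) a k * cnj (C_coeff k)) sums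
      ((1 / (2 * pi)) * (\<integral>t. of_real (1 / (f t + g t)) * C_fun a f g t * cnj (C_fun a f g t) \<partial>circ))"
    using Parseval_L2_sum[OF C_L2_sum sq] by (simp only: flip: mat_app_P_fourier_coeff mat_app_P_C_coeff)
  then have "ell2_inner (mat_app (mat_R f g) a) C_coeff =
      (1 / (2 * pi)) * (\<integral>t. of_real (1 / (f t + g t)) * C_fun a f g t * cnj (C_fun a f g t) \<partial>circ)"
    by (simp add: ell2_inner_def sums_iff)
  also have "(\<lambda>t. of_real (1 / (f t + g t)) * C_fun a f g t * cnj (C_fun a f g t))
      = (\<lambda>t. of_real ((cmod (C_fun a f g t))\<^sup>2 / (f t + g t)))"
    by (simp add: complex_norm_square del: of_real_power)
  finally have 1: "ell2_inner (mat_app (mat_R f g) a) C_coeff =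
      of_real (1 / (2 * pi)) * of_real (\<integral>t. (cmod (C_fun a f g t))\<^sup>2 / (f t + g t) \<partial>circ)"
    by (simp only: integral_complex_of_real)
  have Qa: "mat_app (mat_Q f g) a l = fourier_coeff (\<lambda>t. ?q t * A_fun a t) (- int l)" for l
  proof -
    have "(\<lambda>k. fourier_coeff ?q (- int l - (- int k)) * a k) sums fourier_coeff (\<lambda>t. ?q t * A_fun a t) (- int l)"
      by (rule fourier_coeff_bounded_mult_L2_sum[OF _ q A_fun_L2_sum[OF a]]) measurable
    then show ?thesis by (simp add: mat_app_def mat_Q_eq_fourier_coeff sums_iff)
  qed
  have sq2: "sq_integrable circ (\<lambda>t. ?q t * A_fun a t)"
    by (rule sq_integrable_mult_bounded[OF A_sq_integrable _ q]) measurable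
  have "(\<lambda>k. mat_app (mat_Q f g) a k * cnj (a k)) sums
      ((1 / (2 * pi)) * (\<integral>t. ?q t * A_fun a t * cnj (A_fun a t) \<partial>circ))"
    unfolding Qa by (rule Parseval_L2_sum[OF A_fun_L2_sum[OF a] sq2])
  then have "ell2_inner (mat_app (mat_Q f g) a) a =
      (1 / (2 * pi)) * (\<integral>t. ?q t * A_fun a t * cnj (A_fun a t) \<partial>circ)"
    by (simp add: ell2_inner_def sums_iff)
  also have "(\<lambda>t. ?q t * A_fun a t * cnj (A_fun a t))
      = (\<lambda>t. of_real ((cmod (A_fun a t))\<^sup>2 * (f t * g t / (f t + g t))))"
    by (simp only: of_real_mult complex_norm_square mult_ac)
  finally have 2: "ell2_inner (mat_app (mat_Q f g) a) a =
      of_real (1 / (2 * pi)) * of_real (\<integral>t. (cmod (A_fun a t))\<^sup>2 * (f t * g t / (f t + g t)) \<partial>circ)"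
    by (simp only: integral_complex_of_real)
  show ?thesis
    unfolding operator_error_def C_coeff_def[symmetric] 1 2 by (simp only: plus_complex.sel Re_complex_of_real flip: of_real_mult)
qed

end

section \<open>Causal spectral characteristics\<close>

text \<open>
  The past in terms of Fourier coefficients.  This form is independent of the weight, and the
  elements of \<open>L2_past F\<close> have it whenever \<open>F\<close> is bounded away from zero.
\<close>

definition causal :: "(real \<Rightarrow> complex) \<Rightarrow> bool" where
  "causal h \<longleftrightarrow> sq_integrable circ h \<and> (\<forall>l::nat. fourier_coeff h (int l + 1) = 0)"

lemma causal_A_fun:
  assumes "summable (\<lambda>k. cmod (a k))"
  shows "causal (A_fun a)"
proof -
  have "int l + 1 \<notin> range (\<lambda>k. - int k)" for l by auto
  then show ?thesis
    unfolding causal_def using A_fun_L2_sum[OF assms]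
    by (intro conjI allI has_L2_sum_tendsto(1) fourier_coeff_L2_sum(2)) (auto simp: inj_on_def)
qed

lemma causal_zero: "causal (\<lambda>t. 0)"
  by (simp add: causal_def sq_integrable_def fourier_coeff_def)

lemma fourier_coeff_diff:
  assumes "integrable circ F" "integrable circ G"
  shows "fourier_coeff (\<lambda>t. F t - G t) m = fourier_coeff F m - fourier_coeff G m"
proof -
  have "integrable circ (\<lambda>t. H t * trig (- m) t)" if H: "integrable circ H" for H
    by (rule Bochner_Integration.integrable_bound[OF H]) (use H in \<open>auto simp: norm_mult\<close>)
  then show ?thesis using assms
    by (simp add: fourier_coeff_def left_diff_distrib right_diff_distrib)
qed

lemma causal_diff: "causal h \<Longrightarrow> causal h' \<Longrightarrow> causal (\<lambda>t. h t - h' t)"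
  by (simp add: causal_def sq_integrable_diff fourier_coeff_diff sq_integrable_imp_integrable[OF circ_finite])

lemma cmod_fourier_coeff_sq_le:
  assumes F: "sq_integrable circ F"
  shows "2 * pi * (cmod (fourier_coeff F m))\<^sup>2 \<le> (\<integral>t. (cmod (F t))\<^sup>2 \<partial>circ)"
proof -
  have inj: "inj (\<lambda>k. m + int k)" by (simp add: inj_on_def)
  have "(cmod (fourier_coeff F m))\<^sup>2 = (\<Sum>k\<in>{0}. (cmod (fourier_coeff F (m + int k)))\<^sup>2)" by simp
  also have "\<dots> \<le> (\<Sum>k. (cmod (fourier_coeff F (m + int k)))\<^sup>2)"
    by (intro sum_le_suminf Bessel_inequality(1)[OF F inj]) auto
  finally have "2 * pi * (cmod (fourier_coeff F m))\<^sup>2 \<le> 2 * pi * (\<Sum>k. (cmod (fourier_coeff F (m + int k)))\<^sup>2)"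
    by simp
  also have "\<dots> \<le> (\<integral>t. (cmod (F t))\<^sup>2 \<partial>circ)" by (rule Bessel_inequality(2)[OF F inj])
  finally show ?thesis .
qed

text \<open>
  Causal polynomials have no positive frequencies, and the weight dominates a positive constant, so
  approximation in the weighted norm makes a Fourier coefficient at a positive frequency arbitrarily
  small.
\<close>

lemma L2_past_imp_causal:
  assumes F: "integrable circ F" and m: "0 < m" "AE t in circ. m \<le> F t" and h: "h \<in> L2_past F"
  shows "causal h"
proof -
  have h_meas: "h \<in> borel_measurable circ" and h_int: "integrable circ (\<lambda>t. (cmod (h t))\<^sup>2 * F t)"
    using h by (auto simp: L2_past_def L2_weighted_def)
  have h_sq: "sq_integrable circ h"
    unfolding sq_integrable_def
  proof
    have "integrable circ (\<lambda>t. (cmod (h t))\<^sup>2 * F t / m)" using h_int by simp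
    then show "integrable circ (\<lambda>t. (cmod (h t))\<^sup>2)"
    proof (rule Bochner_Integration.integrable_bound)
      show "(\<lambda>t. (cmod (h t))\<^sup>2) \<in> borel_measurable circ" using h_meas by measurable
      show "AE t in circ. norm ((cmod (h t))\<^sup>2) \<le> norm ((cmod (h t))\<^sup>2 * F t / m)"
        using m(2)
      proof eventually_elim
        case (elim t)
        have "(cmod (h t))\<^sup>2 * m \<le> (cmod (h t))\<^sup>2 * F t" using elim by (intro mult_left_mono) auto
        then show ?case using m(1) elim by (simp add: pos_le_divide_eq abs_mult)
      qed
    qed
  qed (rule h_meas)
  have "fourier_coeff h (int l + 1) = 0" for l
  proof (rule ccontr)
    assume nz: "fourier_coeff h (int l + 1) \<noteq> 0"
    define e where "e = m * (2 * pi * (cmod (fourier_coeff h (int l + 1)))\<^sup>2)"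
    have "e > 0" using nz m(1) by (simp add: e_def)
    then obtain N b where b: "(\<integral>t. (cmod (h t - (\<Sum>k\<le>N. b k * cis (- t * real (k::nat)))))\<^sup>2 * F t \<partial>circ) < e"
      using h by (auto simp: L2_past_def)
    let ?S = "trig_sum (\<lambda>k. - int k) b {..N}"
    have S: "(\<Sum>k\<le>N. b k * cis (- t * real (k::nat))) = ?S t" for t
      by (simp add: trig_sum_def trig_def)
    have d_sq: "sq_integrable circ (\<lambda>t. h t - ?S t)"
      by (intro sq_integrable_diff h_sq sq_integrable_trig_sum)
    have "fourier_coeff ?S (int l + 1) = 0"
      by (subst fourier_coeff_trig_sum) (auto simp: inj_on_def intro!: sum.neutral)
    then have eq: "fourier_coeff h (int l + 1) = fourier_coeff (\<lambda>t. h t - ?S t) (int l + 1)"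
      by (simp add: fourier_coeff_diff sq_integrable_imp_integrable[OF circ_finite] h_sq sq_integrable_trig_sum)
    have "2 * pi * (cmod (fourier_coeff h (int l + 1)))\<^sup>2 \<le> (\<integral>t. (cmod (h t - ?S t))\<^sup>2 \<partial>circ)"
      unfolding eq by (rule cmod_fourier_coeff_sq_le[OF d_sq])
    then have "e \<le> m * (\<integral>t. (cmod (h t - ?S t))\<^sup>2 \<partial>circ)"
      unfolding e_def using m(1) by (intro mult_left_mono) auto
    also have "\<dots> = (\<integral>t. (cmod (h t - ?S t))\<^sup>2 * m \<partial>circ)" by simp
    also have "\<dots> \<le> (\<integral>t. (cmod (h t - ?S t))\<^sup>2 * F t \<partial>circ)"
    proof (rule integral_mono_AE)
      show "integrable circ (\<lambda>t. (cmod (h t - ?S t))\<^sup>2 * m)" using d_sq by auto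
      show "integrable circ (\<lambda>t. (cmod (h t - ?S t))\<^sup>2 * F t)"
      proof (rule Bochner_Integration.integrable_bound)
        show "integrable circ (\<lambda>t. 2 * ((cmod (h t))\<^sup>2 * F t) + 2 * ((\<Sum>k\<le>N. cmod (b k))\<^sup>2 * F t))"
          using h_int F by simp
        show "(\<lambda>t. (cmod (h t - ?S t))\<^sup>2 * F t) \<in> borel_measurable circ"
          using d_sq F by (auto simp: sq_integrable_def)
        show "AE t in circ. norm ((cmod (h t - ?S t))\<^sup>2 * F t)
            \<le> norm (2 * ((cmod (h t))\<^sup>2 * F t) + 2 * ((\<Sum>k\<le>N. cmod (b k))\<^sup>2 * F t))"
          using m(2)
        proof eventually_elim
          case (elim t)
          have "cmod (?S t) \<le> (\<Sum>k\<le>N. cmod (b k))"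
            unfolding trig_sum_def by (rule sum_norm_le) (simp add: norm_mult)
          then have "(cmod (?S t))\<^sup>2 \<le> (\<Sum>k\<le>N. cmod (b k))\<^sup>2" by (intro power_mono) auto
          moreover have "(cmod (h t - ?S t))\<^sup>2 \<le> 2 * (cmod (h t))\<^sup>2 + 2 * (cmod (?S t))\<^sup>2"
            using cmod_add_sq_le[of "h t" "- ?S t"] by simp
          ultimately have "(cmod (h t - ?S t))\<^sup>2 \<le> 2 * (cmod (h t))\<^sup>2 + 2 * (\<Sum>k\<le>N. cmod (b k))\<^sup>2"
            by linarith
          then have "(cmod (h t - ?S t))\<^sup>2 * F t \<le> (2 * (cmod (h t))\<^sup>2 + 2 * (\<Sum>k\<le>N. cmod (b k))\<^sup>2) * F t"
            using elim m(1) by (intro mult_right_mono) auto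
          moreover have "0 \<le> (cmod (h t - ?S t))\<^sup>2 * F t" using elim m(1) by simp
          ultimately show ?case by (simp add: algebra_simps)
        qed
      qed
      show "AE t in circ. (cmod (h t - ?S t))\<^sup>2 * m \<le> (cmod (h t - ?S t))\<^sup>2 * F t"
        using m(2) by eventually_elim (simp add: mult_left_mono)
    qed
    also have "\<dots> < e" using b unfolding S .
    finally show False by simp
  qed
  with h_sq show ?thesis by (simp add: causal_def)
qed

context filtering_problem
begin

lemma spec_char_eq:
  "spec_char a f g = (\<lambda>t. of_real (f t / (f t + g t)) * A_fun a t - of_real (1 / (f t + g t)) * C_fun a f g t)"
  by (simp add: spec_char_def fun_eq_iff)

lemma spec_char_eq_quotient:
  "spec_char a f g t = (of_real (f t) * A_fun a t - C_fun a f g t) / of_real (f t + g t)"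
  by (simp add: spec_char_def diff_divide_distrib mult.commute)

text \<open>
  By the normal equation the two terms of the spectral characteristic have the same Fourier
  coefficients at positive frequencies.
\<close>

lemma spec_char_causal: "causal (spec_char a f g)"
proof -
  obtain U where U: "AE t in circ. cmod (of_real (1 / (f t + g t))) \<le> U" by (rule inverse_sum_bounded)
  have sqA: "sq_integrable circ (\<lambda>t. of_real (f t / (f t + g t)) * A_fun a t)"
    by (rule sq_integrable_mult_bounded[OF A_sq_integrable _ ratio_bounded]) measurable
  have sqC: "sq_integrable circ (\<lambda>t. of_real (1 / (f t + g t)) * C_fun a f g t)"
    by (rule sq_integrable_mult_bounded[OF C_sq_integrable _ U]) measurable
  have "fourier_coeff (spec_char a f g) (int l + 1) = mat_app (mat_R f g) a l - mat_app (mat_P f g) C_coeff l" for l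
    unfolding spec_char_eq mat_app_R_fourier_coeff mat_app_P_fourier_coeff
    by (intro fourier_coeff_diff sq_integrable_imp_integrable[OF circ_finite] sqA sqC)
  moreover have "sq_integrable circ (spec_char a f g)"
    unfolding spec_char_eq by (rule sq_integrable_diff[OF sqA sqC])
  ultimately show ?thesis by (simp add: causal_def mat_app_P_C_coeff)
qed

lemma spec_char_measurable [measurable]: "spec_char a f g \<in> borel_measurable circ"
  using spec_char_causal by (auto simp: causal_def)

lemma integrable_weighted:
  assumes h: "sq_integrable circ h"
  shows "integrable circ (\<lambda>t. (cmod (h t))\<^sup>2 * f t)" "integrable circ (\<lambda>t. (cmod (h t))\<^sup>2 * g t)"
proof -
  obtain m M where M: "AE t in circ. m \<le> f t + g t \<and> f t + g t \<le> M" by (rule sum_bounds) blast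
  have *: "integrable circ (\<lambda>t. (cmod (h t))\<^sup>2 * w t)"
    if "w \<in> borel_measurable circ" "AE t in circ. 0 \<le> w t \<and> w t \<le> M" for w
  proof (rule Bochner_Integration.integrable_bound)
    show "integrable circ (\<lambda>t. (cmod (h t))\<^sup>2 * M)" using h by auto
    show "(\<lambda>t. (cmod (h t))\<^sup>2 * w t) \<in> borel_measurable circ"
      using h that(1) by (auto simp: sq_integrable_def)
    show "AE t in circ. norm ((cmod (h t))\<^sup>2 * w t) \<le> norm ((cmod (h t))\<^sup>2 * M)"
      using that(2) by eventually_elim (simp add: abs_mult mult_left_mono)
  qed
  show "integrable circ (\<lambda>t. (cmod (h t))\<^sup>2 * f t)"
    by (rule *[OF f_measurable]) (use M nonneg in eventually_elim, auto)
  show "integrable circ (\<lambda>t. (cmod (h t))\<^sup>2 * g t)"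
    by (rule *[OF g_measurable]) (use M nonneg in eventually_elim, auto)
qed

lemma mse_eq_quadratic_error:
  assumes h: "sq_integrable circ h"
  shows "mse a h f g = ennreal (quadratic_error h)"
proof -
  note int = integrable_weighted(1)[OF sq_integrable_diff[OF A_sq_integrable h]] integrable_weighted(2)[OF h]
  have nn: "AE t in circ. 0 \<le> (cmod (A_fun a t - h t))\<^sup>2 * f t" "AE t in circ. 0 \<le> (cmod (h t))\<^sup>2 * g t"
    using nonneg by (eventually_elim, simp)+
  show ?thesis
    unfolding mse_def quadratic_error_def
    using integral_nonneg_AE[OF nn(1)] integral_nonneg_AE[OF nn(2)]
    by (simp add: nn_integral_eq_integral[OF int(1) nn(1)] nn_integral_eq_integral[OF int(2) nn(2)] int
        distrib_left flip: ennreal_mult ennreal_plus)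
qed

lemma integrable_A_harmonic: "integrable circ (\<lambda>t. (cmod (A_fun a t))\<^sup>2 * (f t * g t / (f t + g t)))"
proof -
  obtain M where M: "AE t in circ. 0 \<le> f t * g t / (f t + g t) \<and> f t * g t / (f t + g t) \<le> M"
    by (rule harmonic_bounds)
  show ?thesis
  proof (rule Bochner_Integration.integrable_bound)
    show "integrable circ (\<lambda>t. (cmod (A_fun a t))\<^sup>2 * M)" using A_sq_integrable by auto
    show "AE t in circ. norm ((cmod (A_fun a t))\<^sup>2 * (f t * g t / (f t + g t))) \<le> norm ((cmod (A_fun a t))\<^sup>2 * M)"
      using M
    proof eventually_elim
      case (elim t)
      then have "(cmod (A_fun a t))\<^sup>2 * (f t * g t / (f t + g t)) \<le> (cmod (A_fun a t))\<^sup>2 * M"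
        by (intro mult_left_mono) auto
      moreover have "0 \<le> (cmod (A_fun a t))\<^sup>2 * (f t * g t / (f t + g t))"
        using elim by (intro mult_nonneg_nonneg) auto
      ultimately show ?case by (simp only: real_norm_def)
    qed
  qed measurable
qed

text \<open>
  With \<open>s = f + g\<close> the two parts of the error density are \<open>\<bar>A g + C\<bar>\<^sup>2 f / s\<^sup>2\<close> and
  \<open>\<bar>A f - C\<bar>\<^sup>2 g / s\<^sup>2\<close>.  Their cross terms cancel pointwise, which leaves
  \<open>\<bar>C\<bar>\<^sup>2 / s + \<bar>A\<bar>\<^sup>2 f g / s\<close>.
\<close>

lemma quadratic_error_spec_char: "quadratic_error (spec_char a f g) = operator_error a f g"
proof -
  have sqh: "sq_integrable circ (spec_char a f g)" using spec_char_causal by (simp add: causal_def)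
  let ?A = "A_fun a" and ?C = "C_fun a f g"
  obtain U where U: "AE t in circ. 1 / (f t + g t) \<le> U" using inverse_sum_upper by blast
  have intC: "integrable circ (\<lambda>t. (cmod (?C t))\<^sup>2 / (f t + g t))"
  proof (rule Bochner_Integration.integrable_bound)
    show "integrable circ (\<lambda>t. (cmod (?C t))\<^sup>2 * U)" using C_sq_integrable by auto
    show "AE t in circ. norm ((cmod (?C t))\<^sup>2 / (f t + g t)) \<le> norm ((cmod (?C t))\<^sup>2 * U)"
      using U sum_pos
    proof eventually_elim
      case (elim t)
      have "(cmod (?C t))\<^sup>2 * (1 / (f t + g t)) \<le> (cmod (?C t))\<^sup>2 * \<bar>U\<bar>"
        using elim by (intro mult_left_mono) auto
      then show ?case using elim by (simp add: abs_mult)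
    qed
  qed measurable
  have "AE t in circ. (cmod (?A t - spec_char a f g t))\<^sup>2 * f t + (cmod (spec_char a f g t))\<^sup>2 * g t
      = (cmod (?C t))\<^sup>2 / (f t + g t) + (cmod (?A t))\<^sup>2 * (f t * g t / (f t + g t))"
    using sum_pos
  proof eventually_elim
    case (elim t)
    define s where "s = f t + g t"
    have s: "s > 0" "s \<noteq> 0" using elim by (auto simp: s_def)
    have h: "spec_char a f g t = (of_real (f t) * ?A t - ?C t) / of_real s"
      unfolding s_def by (rule spec_char_eq_quotient)
    have "?A t - spec_char a f g t = (of_real s * ?A t - (of_real (f t) * ?A t - ?C t)) / of_real s"
      using s(2) unfolding h by (simp add: diff_divide_distrib)
    also have "of_real s * ?A t - (of_real (f t) * ?A t - ?C t) = of_real (g t) * ?A t + ?C t"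
      by (simp add: s_def algebra_simps)
    finally have d: "?A t - spec_char a f g t = (of_real (g t) * ?A t + ?C t) / of_real s" .
    have "(cmod (?A t - spec_char a f g t))\<^sup>2 = (cmod (of_real (g t) * ?A t + ?C t))\<^sup>2 / s\<^sup>2"
      unfolding d using s by (simp add: norm_divide power_divide)
    moreover have "(cmod (spec_char a f g t))\<^sup>2 = (cmod (of_real (f t) * ?A t - ?C t))\<^sup>2 / s\<^sup>2"
      unfolding h using s by (simp add: norm_divide power_divide)
    ultimately have "(cmod (?A t - spec_char a f g t))\<^sup>2 * f t + (cmod (spec_char a f g t))\<^sup>2 * g t
        = ((cmod (of_real (g t) * ?A t + ?C t))\<^sup>2 * f t + (cmod (of_real (f t) * ?A t - ?C t))\<^sup>2 * g t) / s\<^sup>2"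
      by (simp only: times_divide_eq_left add_divide_distrib)
    also have "(cmod (of_real (g t) * ?A t + ?C t))\<^sup>2 * f t + (cmod (of_real (f t) * ?A t - ?C t))\<^sup>2 * g t
        = s * ((cmod (?C t))\<^sup>2 + (cmod (?A t))\<^sup>2 * (f t * g t))"
      unfolding cmod_power2 s_def by (simp add: power2_eq_square algebra_simps)
    also have "\<dots> / s\<^sup>2 = (cmod (?C t))\<^sup>2 / s + (cmod (?A t))\<^sup>2 * (f t * g t / s)"
      using s by (simp add: field_simps power2_eq_square)
    finally show ?case by (simp only: s_def)
  qed
  then have "(\<integral>t. (cmod (?A t - spec_char a f g t))\<^sup>2 * f t + (cmod (spec_char a f g t))\<^sup>2 * g t \<partial>circ)
      = (\<integral>t. (cmod (?C t))\<^sup>2 / (f t + g t) + (cmod (?A t))\<^sup>2 * (f t * g t / (f t + g t)) \<partial>circ)"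
    by (intro integral_cong_AE) measurable
  then show ?thesis
    unfolding quadratic_error_def operator_error_eq
    by (simp only: Bochner_Integration.integral_add[OF intC integrable_A_harmonic] distrib_left)
qed

lemma mse_spec_char: "mse a (spec_char a f g) f g = ennreal (operator_error a f g)"
  using spec_char_causal by (simp add: causal_def mse_eq_quadratic_error quadratic_error_spec_char)

text \<open>
  Expansion of the error density about \<open>y\<close>.  The vector \<open>u (x - y) - v y\<close> in the linear term is
  written as \<open>u x - (u + v) y\<close>, which for \<open>x = A\<close>, \<open>y = spec_char a f g\<close>, \<open>u = f\<close> and \<open>v = g\<close>
  is \<open>C\<close>.
\<close>

lemma quadratic_expansion:
  fixes x y z :: complex and u v :: real
  shows "(cmod (x - z))\<^sup>2 * u + (cmod z)\<^sup>2 * v =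
    (cmod (x - y))\<^sup>2 * u + (cmod y)\<^sup>2 * v + (cmod (z - y))\<^sup>2 * (u + v)
    - 2 * Re ((z - y) * cnj (of_real u * x - of_real (u + v) * y))"
  unfolding cmod_power2 by (simp add: power2_eq_square) algebra

text \<open>
  The linear term of the expansion is an inner product with \<open>C\<close>, whose frequencies are positive, so
  it vanishes for a causal difference.
\<close>

lemma quadratic_error_causal:
  assumes h: "causal h"
  shows "quadratic_error h = operator_error a f g
    + (1 / (2 * pi)) * (\<integral>t. (cmod (h t - spec_char a f g t))\<^sup>2 * (f t + g t) \<partial>circ)"
proof -
  let ?A = "A_fun a" and ?C = "C_fun a f g" and ?h = "spec_char a f g"
  have sqh: "sq_integrable circ ?h" using spec_char_causal by (simp add: causal_def)
  have sqh': "sq_integrable circ h" using h by (simp add: causal_def)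
  have d: "causal (\<lambda>t. h t - ?h t)" by (rule causal_diff[OF h spec_char_causal])
  then have sqd: "sq_integrable circ (\<lambda>t. h t - ?h t)" by (simp add: causal_def)
  have int: "integrable circ (\<lambda>t. (h t - ?h t) * cnj (?C t))"
    by (intro integrable_mult_of_sq_integrable sqd sq_integrable_cnj C_sq_integrable)
  have "fourier_coeff (\<lambda>t. h t - ?h t) (int k + 1) = 0" for k
    using d by (simp only: causal_def)
  with Parseval_L2_sum[OF C_L2_sum sqd]
  have "(\<lambda>k. 0) sums ((1 / (2 * pi)) * (\<integral>t. (h t - ?h t) * cnj (?C t) \<partial>circ))"
    by (simp only: mult_zero_left)
  from sums_unique2[OF this sums_zero] have "(\<integral>t. (h t - ?h t) * cnj (?C t) \<partial>circ) = 0" by simp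
  then have orth: "(\<integral>t. Re ((h t - ?h t) * cnj (?C t)) \<partial>circ) = 0"
    using integral_Re[OF int] by simp
  have i1: "integrable circ (\<lambda>t. (cmod (?A t - ?h t))\<^sup>2 * f t + (cmod (?h t))\<^sup>2 * g t)"
    by (intro Bochner_Integration.integrable_add integrable_weighted sq_integrable_diff A_sq_integrable sqh)
  have i2: "integrable circ (\<lambda>t. (cmod (h t - ?h t))\<^sup>2 * (f t + g t))"
    unfolding distrib_left by (intro Bochner_Integration.integrable_add integrable_weighted sqd)
  have i3: "integrable circ (\<lambda>t. 2 * Re ((h t - ?h t) * cnj (?C t)))"
    by (intro integrable_mult_right integrable_Re int)
  have "AE t in circ. (cmod (?A t - h t))\<^sup>2 * f t + (cmod (h t))\<^sup>2 * g t
      = (cmod (?A t - ?h t))\<^sup>2 * f t + (cmod (?h t))\<^sup>2 * g t + (cmod (h t - ?h t))\<^sup>2 * (f t + g t)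
        - 2 * Re ((h t - ?h t) * cnj (?C t))"
    using sum_pos
  proof eventually_elim
    case (elim t)
    define s where "s = f t + g t"
    have "of_real s * ?h t = of_real (f t) * ?A t - ?C t"
      using elim unfolding spec_char_eq_quotient s_def[symmetric] by simp
    then have C: "?C t = of_real (f t) * ?A t - of_real s * ?h t" by simp
    show ?case
      unfolding C s_def by (rule quadratic_expansion)
  qed
  then have "(\<integral>t. (cmod (?A t - h t))\<^sup>2 * f t + (cmod (h t))\<^sup>2 * g t \<partial>circ)
      = (\<integral>t. (cmod (?A t - ?h t))\<^sup>2 * f t + (cmod (?h t))\<^sup>2 * g t + (cmod (h t - ?h t))\<^sup>2 * (f t + g t)
        - 2 * Re ((h t - ?h t) * cnj (?C t)) \<partial>circ)"
    by (intro integral_cong_AE borel_measurable_integrable Bochner_Integration.integrable_diff[OF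
          Bochner_Integration.integrable_add[OF i1 i2] i3])
      (intro Bochner_Integration.integrable_add integrable_weighted sq_integrable_diff A_sq_integrable sqh')
  also have "\<dots> = (\<integral>t. (cmod (?A t - ?h t))\<^sup>2 * f t + (cmod (?h t))\<^sup>2 * g t \<partial>circ)
      + (\<integral>t. (cmod (h t - ?h t))\<^sup>2 * (f t + g t) \<partial>circ) - (\<integral>t. 2 * Re ((h t - ?h t) * cnj (?C t)) \<partial>circ)"
    by (simp only: Bochner_Integration.integral_add[OF i1 i2]
        Bochner_Integration.integral_diff[OF Bochner_Integration.integrable_add[OF i1 i2] i3])
  also have "(\<integral>t. 2 * Re ((h t - ?h t) * cnj (?C t)) \<partial>circ) = 0"
    by (simp only: integral_mult_right_zero orth mult_zero_right)
  finally show ?thesis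
    unfolding quadratic_error_spec_char[symmetric] quadratic_error_def by (simp only: distrib_left diff_zero)
qed

lemma causal_optimal_unique:
  assumes h: "causal h" and le: "quadratic_error h \<le> operator_error a f g"
  shows "AE t in circ. h t = spec_char a f g t"
proof -
  let ?h = "spec_char a f g"
  have sqd: "sq_integrable circ (\<lambda>t. h t - ?h t)"
    using causal_diff[OF h spec_char_causal] by (simp add: causal_def)
  have i: "integrable circ (\<lambda>t. (cmod (h t - ?h t))\<^sup>2 * (f t + g t))"
    unfolding distrib_left by (intro Bochner_Integration.integrable_add integrable_weighted sqd)
  have nn: "AE t in circ. 0 \<le> (cmod (h t - ?h t))\<^sup>2 * (f t + g t)"
    using nonneg by eventually_elim simp
  have "(\<integral>t. (cmod (h t - ?h t))\<^sup>2 * (f t + g t) \<partial>circ) \<le> 0"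
    using le quadratic_error_causal[OF h] by (simp add: pos_divide_le_eq)
  with integral_nonneg_AE[OF nn] have "(\<integral>t. (cmod (h t - ?h t))\<^sup>2 * (f t + g t) \<partial>circ) = 0" by simp
  then have "AE t in circ. (cmod (h t - ?h t))\<^sup>2 * (f t + g t) = 0"
    using integral_nonneg_eq_0_iff_AE[OF i nn] by simp
  then show ?thesis using sum_pos by eventually_elim simp
qed

lemma spec_char_optimal:
  assumes h: "h \<in> L2_past (\<lambda>t. f t + g t)"
  shows "mse a (spec_char a f g) f g \<le> mse a h f g"
proof -
  obtain m M where m: "0 < m" "AE t in circ. m \<le> f t + g t \<and> f t + g t \<le> M" by (rule sum_bounds) blast
  have "causal h"
  proof (rule L2_past_imp_causal[OF _ m(1) _ h])
    show "integrable circ (\<lambda>t. f t + g t)" using f g by (simp add: spectral_density_def)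
    show "AE t in circ. m \<le> f t + g t" using m(2) by eventually_elim simp
  qed
  moreover have "0 \<le> (\<integral>t. (cmod (h t - spec_char a f g t))\<^sup>2 * (f t + g t) \<partial>circ)"
    by (rule integral_nonneg_AE) (use nonneg in eventually_elim, simp)
  ultimately show ?thesis
    by (simp add: mse_spec_char mse_eq_quadratic_error causal_def[of h] quadratic_error_causal ennreal_leI)
qed

end

section \<open>Complementary slackness\<close>

lemma ell2_scale:
  assumes "x \<in> ell2"
  shows "(\<lambda>k. b * x k) \<in> ell2" "ell2_norm (\<lambda>k. b * x k) = cmod b * ell2_norm x"
proof -
  have s: "summable (\<lambda>k. (cmod (x k))\<^sup>2)" using assms by (simp add: ell2_def)
  then show "(\<lambda>k. b * x k) \<in> ell2" by (simp add: ell2_def norm_mult power_mult_distrib summable_mult)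
  have "(\<Sum>k. (cmod (b * x k))\<^sup>2) = (cmod b)\<^sup>2 * (\<Sum>k. (cmod (x k))\<^sup>2)"
    using s by (simp add: norm_mult power_mult_distrib suminf_mult)
  then show "ell2_norm (\<lambda>k. b * x k) = cmod b * ell2_norm x"
    by (simp add: ell2_norm_def real_sqrt_mult)
qed

lemma mat_app_scale:
  assumes "mat_operator M" "x \<in> ell2"
  shows "mat_app (\<lambda>l k. b * M l k) x = (\<lambda>l. b * mat_app M x l)"
  using assms by (auto simp: mat_app_def mat_operator_def mult.assoc suminf_mult)

lemma mat_operator_scale:
  assumes M: "mat_operator M"
  shows "mat_operator (\<lambda>l k. b * M l k)"
proof -
  obtain B where B: "\<And>x. x \<in> ell2 \<Longrightarrow> mat_app M x \<in> ell2 \<and> ell2_norm (mat_app M x) \<le> B * ell2_norm x"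
    using M by (auto simp: mat_operator_def bounded_on_ell2_def)
  have "mat_app (\<lambda>l k. b * M l k) x \<in> ell2 \<and> ell2_norm (mat_app (\<lambda>l k. b * M l k) x) \<le> (cmod b * B) * ell2_norm x"
    if "x \<in> ell2" for x
    using B[OF that] by (simp add: mat_app_scale[OF M that] ell2_scale mult.assoc mult_left_mono)
  then have "bounded_on_ell2 (mat_app (\<lambda>l k. b * M l k))"
    unfolding bounded_on_ell2_def by blast
  then show ?thesis
    using M by (simp add: mat_operator_def mult.assoc summable_mult)
qed

text \<open>
  A perturbation that multiplies both \<open>P\<close> and \<open>R\<close> by \<open>b\<close> leaves \<open>P\<^sup>-\<^sup>1 R a\<close> unchanged.
\<close>

lemma mat_invertible_scale:
  assumes M: "mat_operator M" and inv: "mat_invertible M" and b: "b \<noteq> 0"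
  shows "mat_invertible (\<lambda>l k. b * M l k)"
    and "y \<in> ell2 \<Longrightarrow> mat_inv_app (\<lambda>l k. b * M l k) (\<lambda>k. b * y k) = mat_inv_app M y"
proof -
  let ?M = "\<lambda>l k. b * M l k"
  have bij: "bij_betw (mat_app M) ell2 ell2" using inv by (simp add: mat_invertible_def)
  have scale: "bij_betw (\<lambda>y k. b * y k) ell2 ell2"
    by (rule bij_betw_byWitness[where f' = "\<lambda>y k. inverse b * y k"])
      (use b in \<open>auto intro!: ell2_scale(1) simp: fun_eq_iff simp flip: mult.assoc\<close>)
  have "bij_betw ((\<lambda>y k. b * y k) \<circ> mat_app M) ell2 ell2"
    by (rule bij_betw_trans[OF bij scale])
  then have bij': "bij_betw (mat_app ?M) ell2 ell2"
    by (rule bij_betw_cong[THEN iffD1, rotated]) (simp add: mat_app_scale[OF M])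
  have inv_scale: "mat_inv_app ?M (\<lambda>k. b * y k) = mat_inv_app M y" if y: "y \<in> ell2" for y
  proof -
    have x: "mat_inv_app M y \<in> ell2" "mat_app M (mat_inv_app M y) = y"
      using bij_betw_inv_into[OF bij] bij_betw_inv_into_right[OF bij y] y
      by (auto simp: mat_inv_app_def bij_betw_def)
    then have "mat_app ?M (mat_inv_app M y) = (\<lambda>k. b * y k)"
      by (simp add: mat_app_scale[OF M])
    then show ?thesis
      unfolding mat_inv_app_def[of ?M] using bij' x(1) by (intro inv_into_f_eq) (auto simp: bij_betw_def)
  qed
  then show "y \<in> ell2 \<Longrightarrow> mat_inv_app ?M (\<lambda>k. b * y k) = mat_inv_app M y" .
  obtain B where B: "\<And>y. y \<in> ell2 \<Longrightarrow> mat_inv_app M y \<in> ell2 \<and> ell2_norm (mat_inv_app M y) \<le> B * ell2_norm y"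
    using inv by (auto simp: mat_invertible_def bounded_on_ell2_def)
  have "mat_inv_app ?M y \<in> ell2 \<and> ell2_norm (mat_inv_app ?M y) \<le> (B * cmod (1 / b)) * ell2_norm y"
    if y: "y \<in> ell2" for y
  proof -
    let ?z = "\<lambda>k. (1 / b) * y k"
    have z: "?z \<in> ell2" "ell2_norm ?z = cmod (1 / b) * ell2_norm y"
      by (rule ell2_scale[OF y])+
    have "(\<lambda>k. b * ?z k) = y" using b by simp
    then have "mat_inv_app ?M y = mat_inv_app M ?z"
      using inv_scale[OF z(1)] by simp
    then show ?thesis using B[OF z(1)] z(2) by (simp only: mult.assoc)
  qed
  then show "mat_invertible ?M"
    using bij' unfolding mat_invertible_def bounded_on_ell2_def by blast
qed

lemma fourier_coeff_cmult: "fourier_coeff (\<lambda>t. b * F t) m = b * fourier_coeff F m"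
  by (simp add: fourier_coeff_def mult.assoc)

lemma fourier_coeff_cong_AE:
  assumes "F \<in> borel_measurable circ" "G \<in> borel_measurable circ" "AE t in circ. F t = G t"
  shows "fourier_coeff F m = fourier_coeff G m"
proof -
  have "(\<integral>t. F t * trig (- m) t \<partial>circ) = (\<integral>t. G t * trig (- m) t \<partial>circ)"
    using assms by (intro integral_cong_AE) auto
  then show ?thesis by (simp add: fourier_coeff_def)
qed

context filtering_problem
begin

text \<open>
  Under these hypotheses \<open>P\<close> and \<open>R\<close> are scaled by \<open>1 / (1 + e)\<close>, so \<open>C\<close> is the same function for
  both pairs.  The matrix \<open>Q\<close> does change, but its symbol stays below \<open>f' + g'\<close>, which is bounded.
\<close>

lemma perturbed_pair:
  fixes f' g' :: "real \<Rightarrow> real" and e :: real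
  assumes e: "0 < e" and f': "spectral_density f'" and g': "spectral_density g'"
    and sum: "\<And>t. f' t + g' t = (1 + e) * (f t + g t)"
    and R: "\<And>l m. mat_R f' g' l m = of_real (1 / (1 + e)) * mat_R f g l m"
  shows "admissible_pair f' g'"
    and "operator_error a f' g' =
      (1 / (1 + e)) * ((1 / (2 * pi)) * (\<integral>t. (cmod (C_fun a f g t))\<^sup>2 / (f t + g t) \<partial>circ))
      + (1 / (2 * pi)) * (\<integral>t. (cmod (A_fun a t))\<^sup>2 * (f' t * g' t / (f' t + g' t)) \<partial>circ)"
proof -
  let ?b = "complex_of_real (1 / (1 + e))"
  have b: "?b \<noteq> 0" using e by (simp del: of_real_divide)
  have P: "mat_P f' g' = (\<lambda>l k. ?b * mat_P f g l k)"
  proof (intro ext)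
    fix l k
    have "complex_of_real (1 / (f' t + g' t)) = ?b * of_real (1 / (f t + g t))" for t
      unfolding sum by (simp only: flip: of_real_mult) simp
    then show "mat_P f' g' l k = ?b * mat_P f g l k"
      unfolding mat_P_eq_fourier_coeff by (simp only: fourier_coeff_cmult)
  qed
  have R': "mat_R f' g' = (\<lambda>l k. ?b * mat_R f g l k)" using R by (intro ext)
  have ops: "mat_operator (mat_P f g)" "mat_operator (mat_R f g)" "mat_invertible (mat_P f g)"
    using adm by (simp_all add: admissible_pair_def)
  have [measurable]: "f' \<in> borel_measurable circ" "g' \<in> borel_measurable circ"
    using f' g' by (auto simp: spectral_density_def)
  have nonneg': "AE t in circ. 0 \<le> f' t \<and> 0 \<le> g' t"
    using f' g' by (intro AE_I2) (auto simp: spectral_density_def)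
  obtain m M where M: "AE t in circ. m \<le> f t + g t \<and> f t + g t \<le> M"
    by (rule sum_bounds) blast
  have "mat_operator (\<lambda>l k. fourier_coeff (\<lambda>t. of_real (f' t * g' t / (f' t + g' t))) (- int l - (- int k)))"
  proof (rule mat_operator_bounded_symbol)
    show "AE t in circ. cmod (of_real (f' t * g' t / (f' t + g' t))) \<le> (1 + e) * M"
      using M nonneg' sum_pos
    proof eventually_elim
      case (elim t)
      have pos: "0 < f' t + g' t" using elim e by (simp add: sum)
      have "f' t * g' t \<le> (f' t + g' t) * (f' t + g' t)" using elim by (intro mult_mono) auto
      then have "f' t * g' t / (f' t + g' t) \<le> f' t + g' t" using pos by (simp add: divide_le_eq)
      also have "\<dots> \<le> (1 + e) * M" unfolding sum using elim e by (intro mult_left_mono) auto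
      finally show ?case using elim pos by (simp only: norm_of_real) simp
    qed
  qed (auto simp: inj_on_def)
  then have Q: "mat_operator (mat_Q f' g')"
    by (simp add: mat_Q_eq_fourier_coeff[abs_def])
  have "(\<integral>\<^sup>+t. inverse (ennreal (f' t + g' t)) \<partial>circ) \<le> (\<integral>\<^sup>+t. inverse (ennreal (f t + g t)) \<partial>circ)"
  proof (rule nn_integral_mono_AE)
    show "AE t in circ. inverse (ennreal (f' t + g' t)) \<le> inverse (ennreal (f t + g t))"
      using sum_pos
    proof eventually_elim
      case (elim t)
      have "f t + g t \<le> f' t + g' t" unfolding sum using mult_right_mono[of 1 "1 + e" "f t + g t"] elim e by simp
      then show ?case using elim by (simp add: inverse_ennreal ennreal_leI le_imp_inverse_le)
    qed
  qed
  also have "\<dots> < \<infinity>" using adm by (simp add: admissible_pair_def)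
  finally show adm': "admissible_pair f' g'"
    unfolding admissible_pair_def P R'
    by (intro conjI Q[unfolded P] mat_operator_scale ops mat_invertible_scale(1)[OF ops(1,3) b])
  interpret F: filtering_problem f' g' a
    using f' g' adm' a by unfold_locales
  have "mat_inv_app (mat_P f' g') (mat_app (mat_R f' g') a) = mat_inv_app (mat_P f g) (mat_app (mat_R f g) a)"
    unfolding P R' mat_app_scale[OF ops(2) summable_imp_ell2[OF a]]
    by (rule mat_invertible_scale(2)[OF ops(1,3) b mat_app_R_in_ell2])
  then have C: "C_fun a f' g' = C_fun a f g" by (simp only: C_fun_def)
  have "(cmod (C_fun a f g t))\<^sup>2 / (f' t + g' t) = (1 / (1 + e)) * ((cmod (C_fun a f g t))\<^sup>2 / (f t + g t))" for t
    unfolding sum by simp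
  then have "(\<integral>t. (cmod (C_fun a f g t))\<^sup>2 / (f' t + g' t) \<partial>circ)
      = (1 / (1 + e)) * (\<integral>t. (cmod (C_fun a f g t))\<^sup>2 / (f t + g t) \<partial>circ)"
    by (simp only: integral_mult_right_zero)
  then show "operator_error a f' g' =
      (1 / (1 + e)) * ((1 / (2 * pi)) * (\<integral>t. (cmod (C_fun a f g t))\<^sup>2 / (f t + g t) \<partial>circ))
      + (1 / (2 * pi)) * (\<integral>t. (cmod (A_fun a t))\<^sup>2 * (f' t * g' t / (f' t + g' t)) \<partial>circ)"
    unfolding F.operator_error_eq C by simp
qed

text \<open>
  The new symbol is \<open>(f / (f + g) + e) / (1 + e)\<close>, and the constant \<open>e\<close> contributes nothing because
  the entries of a Hankel matrix of type \<open>R\<close> are coefficients at frequencies \<open>l + 1 + m > 0\<close>.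
\<close>

lemma mat_R_perturb_signal:
  assumes e: "0 < e"
  shows "mat_R (\<lambda>t. f t + e * (f t + g t)) g l m = of_real (1 / (1 + e)) * mat_R f g l m"
proof -
  let ?n = "int l + 1 + int m"
  let ?r = "\<lambda>t. complex_of_real (f t / (f t + g t))"
  let ?r' = "\<lambda>t. complex_of_real ((f t + e * (f t + g t)) / (f t + e * (f t + g t) + g t))"
  have "AE t in circ. ?r' t = of_real (1 / (1 + e)) * (?r t - of_real (- e))"
    using sum_pos
  proof eventually_elim
    case (elim t)
    have "f t + e * (f t + g t) + g t = (1 + e) * (f t + g t)" by (simp add: algebra_simps)
    then have "(f t + e * (f t + g t)) / (f t + e * (f t + g t) + g t) = (1 / (1 + e)) * (f t / (f t + g t) - (- e))"
      using elim e by (simp add: add_divide_distrib)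
    then show ?case by (simp only: of_real_mult of_real_diff)
  qed
  then have "fourier_coeff ?r' ?n = fourier_coeff (\<lambda>t. of_real (1 / (1 + e)) * (?r t - of_real (- e))) ?n"
    by (intro fourier_coeff_cong_AE) measurable
  also have "\<dots> = of_real (1 / (1 + e)) * (fourier_coeff ?r ?n - fourier_coeff (\<lambda>t. of_real (- e)) ?n)"
  proof -
    have "integrable circ ?r"
      by (rule sq_integrable_imp_integrable[OF circ_finite sq_integrable_bounded[OF circ_finite _ ratio_bounded]])
        measurable
    then show ?thesis
      unfolding fourier_coeff_cmult
      by (subst fourier_coeff_diff) (auto intro: finite_measure.integrable_const[OF circ_finite])
  qed
  also have "fourier_coeff (\<lambda>t. complex_of_real (- e)) ?n = 0"
    by (simp add: fourier_coeff_def integral_trig)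
  finally show ?thesis by (simp add: mat_R_eq_fourier_coeff)
qed

lemma mat_R_perturb_noise:
  "mat_R f (\<lambda>t. g t + e * (f t + g t)) l m = of_real (1 / (1 + e)) * mat_R f g l m"
proof -
  have "complex_of_real (f t / (f t + (g t + e * (f t + g t)))) = of_real (1 / (1 + e)) * of_real (f t / (f t + g t))" for t
  proof -
    have "f t + (g t + e * (f t + g t)) = (1 + e) * (f t + g t)" by (simp add: algebra_simps)
    then show ?thesis by (simp only: flip: of_real_mult) simp
  qed
  then show ?thesis unfolding mat_R_eq_fourier_coeff by (simp only: fourier_coeff_cmult)
qed

text \<open>
  For the perturbed pair the error is \<open>(E + e W) / (1 + e)\<close>, where \<open>E\<close> is the original error and
  \<open>W\<close> the normalized integral of \<open>\<bar>A\<bar>\<^sup>2 w\<close>; it is at most \<open>E\<close> only if \<open>W \<le> E\<close>.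
\<close>

lemma perturbation_error_le:
  assumes e: "0 < e" and f': "spectral_density f'" and g': "spectral_density g'"
    and sum: "\<And>t. f' t + g' t = (1 + e) * (f t + g t)"
    and R: "\<And>l m. mat_R f' g' l m = of_real (1 / (1 + e)) * mat_R f g l m"
    and w: "integrable circ (\<lambda>t. (cmod (A_fun a t))\<^sup>2 * w t)"
      "\<And>t. f' t * g' t = (f t + g t) * (e * w t) + f t * g t"
    and le: "operator_error a f' g' \<le> operator_error a f g"
  shows "(1 / (2 * pi)) * (\<integral>t. (cmod (A_fun a t))\<^sup>2 * w t \<partial>circ) \<le> operator_error a f g"
proof -
  have [measurable]: "f' \<in> borel_measurable circ" "g' \<in> borel_measurable circ"
    using f' g' by (auto simp: spectral_density_def)
  let ?q = "\<lambda>t. (cmod (A_fun a t))\<^sup>2 * (f t * g t / (f t + g t))"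
  let ?w = "\<lambda>t. (cmod (A_fun a t))\<^sup>2 * w t"
  have "AE t in circ. (cmod (A_fun a t))\<^sup>2 * (f' t * g' t / (f' t + g' t)) = (1 / (1 + e)) * (?q t + e * ?w t)"
    using sum_pos
  proof eventually_elim
    case (elim t)
    have "f' t * g' t / (f' t + g' t) = (1 / (1 + e)) * (e * w t + f t * g t / (f t + g t))"
      unfolding w(2) sum using elim e by (simp add: add_divide_distrib)
    then show ?case by (simp only: algebra_simps)
  qed
  then have "(\<integral>t. (cmod (A_fun a t))\<^sup>2 * (f' t * g' t / (f' t + g' t)) \<partial>circ) = (\<integral>t. (1 / (1 + e)) * (?q t + e * ?w t) \<partial>circ)"
    by (intro integral_cong_AE borel_measurable_integrable[OF integrable_mult_right]
        Bochner_Integration.integrable_add integrable_A_harmonic integrable_mult_right w(1)) measurable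
  also have "\<dots> = (1 / (1 + e)) * ((\<integral>t. ?q t \<partial>circ) + e * (\<integral>t. ?w t \<partial>circ))"
    by (subst integral_mult_right_zero, subst Bochner_Integration.integral_add)
      (auto intro!: integrable_A_harmonic integrable_mult_right w(1) simp del: times_divide_eq_right)
  finally have int: "(\<integral>t. (cmod (A_fun a t))\<^sup>2 * (f' t * g' t / (f' t + g' t)) \<partial>circ)
      = (1 / (1 + e)) * ((\<integral>t. ?q t \<partial>circ) + e * (\<integral>t. ?w t \<partial>circ))" .
  have alg: "u * (K * X) + K * (u * (Y + e * Z)) = u * (K * X + K * Y + e * (K * Z))" for u K X Y Z :: real
    by (simp add: algebra_simps)
  have "operator_error a f' g' = (1 / (1 + e)) *
      (operator_error a f g + e * ((1 / (2 * pi)) * (\<integral>t. ?w t \<partial>circ)))"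
    unfolding perturbed_pair(2)[OF e f' g' sum R] operator_error_eq int by (rule alg)
  with le have "(1 / (1 + e)) * (operator_error a f g + e * ((1 / (2 * pi)) * (\<integral>t. ?w t \<partial>circ))) \<le> operator_error a f g"
    by simp
  moreover have "W \<le> E" if "(1 / (1 + e)) * (E + e * W) \<le> E" for E W :: real
  proof -
    have "E + e * W \<le> E * (1 + e)" using that e by (simp add: divide_le_eq)
    then have "e * W \<le> e * E" by (simp add: algebra_simps)
    then show ?thesis using e by simp
  qed
  ultimately show ?thesis by blast
qed

text \<open>
  Here \<open>W\<close> is the normalized integral of \<open>\<bar>A\<bar>\<^sup>2 g\<close>, the error of the characteristic \<open>A\<close>, which is
  therefore optimal too.
\<close>

lemma power_slack_f:
  assumes e: "0 < e" and le: "operator_error a (\<lambda>t. f t + e * (f t + g t)) g \<le> operator_error a f g"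
  shows "AE t in circ. A_fun a t = spec_char a f g t"
proof (rule causal_optimal_unique[OF causal_A_fun[OF a]])
  have "(1 / (2 * pi)) * (\<integral>t. (cmod (A_fun a t))\<^sup>2 * g t \<partial>circ) \<le> operator_error a f g"
  proof (rule perturbation_error_le[OF e _ g _ mat_R_perturb_signal[OF e] _ _ le])
    show "spectral_density (\<lambda>t. f t + e * (f t + g t))"
      using f g e by (auto simp: spectral_density_def)
    show "integrable circ (\<lambda>t. (cmod (A_fun a t))\<^sup>2 * g t)"
      by (rule integrable_weighted(2)[OF A_sq_integrable])
  qed (simp_all add: algebra_simps)
  then show "quadratic_error (A_fun a) \<le> operator_error a f g"
    by (simp add: quadratic_error_def)
qed

text \<open>
  Here \<open>W\<close> is the normalized integral of \<open>\<bar>A\<bar>\<^sup>2 f\<close>, the error of the characteristic \<open>0\<close>.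
\<close>

lemma power_slack_g:
  assumes e: "0 < e" and le: "operator_error a f (\<lambda>t. g t + e * (f t + g t)) \<le> operator_error a f g"
  shows "AE t in circ. spec_char a f g t = 0"
proof -
  have "(1 / (2 * pi)) * (\<integral>t. (cmod (A_fun a t))\<^sup>2 * f t \<partial>circ) \<le> operator_error a f g"
  proof (rule perturbation_error_le[OF e f _ _ mat_R_perturb_noise _ _ le])
    show "spectral_density (\<lambda>t. g t + e * (f t + g t))"
      using f g e by (auto simp: spectral_density_def)
    show "integrable circ (\<lambda>t. (cmod (A_fun a t))\<^sup>2 * f t)"
      by (rule integrable_weighted(1)[OF A_sq_integrable])
  qed (simp_all add: algebra_simps)
  then have "quadratic_error (\<lambda>t. 0) \<le> operator_error a f g"
    by (simp add: quadratic_error_def)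
  from causal_optimal_unique[OF causal_zero this] show ?thesis by eventually_elim simp
qed

end

section \<open>Bounded causal functions lie in every weighted past\<close>

lemma Cesaro_mean_null:
  fixes x :: "nat \<Rightarrow> real"
  assumes x: "x \<longlonglongrightarrow> 0" and nn: "\<And>n. 0 \<le> x n"
  shows "(\<lambda>n. (\<Sum>j<Suc n. x j) / real (Suc n)) \<longlonglongrightarrow> 0"
proof (rule LIMSEQ_I)
  fix e :: real assume e: "0 < e"
  obtain N where N: "\<And>j. j \<ge> N \<Longrightarrow> x j < e / 2"
    using order_tendstoD(2)[OF x, of "e / 2"] e by (auto simp: eventually_sequentially)
  define K where "K = (\<Sum>j<N. x j)"
  have K: "0 \<le> K" unfolding K_def by (intro sum_nonneg nn)
  obtain n0 :: nat where n0: "2 * K / e < real n0" using reals_Archimedean2 by blast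
  show "\<exists>n0. \<forall>n\<ge>n0. norm ((\<Sum>j<Suc n. x j) / real (Suc n) - 0) < e"
  proof (intro exI allI impI)
    fix n assume n: "n \<ge> n0"
    have "(\<Sum>j<Suc n. x j) \<le> (\<Sum>j<Suc n. (if j < N then x j else 0) + e / 2)"
      using N e nn by (intro sum_mono) (auto intro: less_imp_le simp: not_less)
    also have "\<dots> = (\<Sum>j<Suc n. if j < N then x j else 0) + real (Suc n) * (e / 2)"
      by (simp add: sum.distrib)
    also have "(\<Sum>j<Suc n. if j < N then x j else 0) = (\<Sum>j\<in>{..<Suc n} \<inter> {j. j < N}. x j)"
      by (subst sum.inter_restrict) auto
    also have "\<dots> \<le> K" unfolding K_def by (intro sum_mono2 nn) auto
    finally have "(\<Sum>j<Suc n. x j) \<le> K + real (Suc n) * (e / 2)" by simp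
    moreover have "K < real (Suc n) * (e / 2)"
    proof -
      have "2 * K / e < real (Suc n)" using n0 n by linarith
      then show ?thesis using e by (simp add: field_simps)
    qed
    ultimately have "(\<Sum>j<Suc n. x j) < real (Suc n) * e" by simp
    moreover have "0 \<le> (\<Sum>j<Suc n. x j)" by (intro sum_nonneg nn)
    ultimately show "norm ((\<Sum>j<Suc n. x j) / real (Suc n) - 0) < e"
      by (simp add: divide_less_eq mult.commute del: sum.lessThan_Suc)
  qed
qed

lemma cmod_mean_sq_le:
  "(cmod ((\<Sum>j<Suc n. y j) / of_nat (Suc n)))\<^sup>2 \<le> (\<Sum>j<Suc n. (cmod (y j))\<^sup>2) / real (Suc n)"
proof -
  have "(cmod (\<Sum>j<Suc n. y j))\<^sup>2 \<le> (\<Sum>j<Suc n. cmod (y j) * 1)\<^sup>2"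
    by (intro power_mono) (auto intro!: order_trans[OF norm_sum] simp del: sum.lessThan_Suc)
  also have "\<dots> \<le> (\<Sum>j<Suc n. (cmod (y j))\<^sup>2) * (\<Sum>j<Suc n. 1\<^sup>2)"
    by (rule Cauchy_Schwarz_ineq_sum)
  also have "\<dots> = (\<Sum>j<Suc n. (cmod (y j))\<^sup>2) * real (Suc n)" by simp
  finally have *: "(cmod (\<Sum>j<Suc n. y j))\<^sup>2 \<le> (\<Sum>j<Suc n. (cmod (y j))\<^sup>2) * real (Suc n)" .
  have "(cmod ((\<Sum>j<Suc n. y j) / of_nat (Suc n)))\<^sup>2 = (cmod (\<Sum>j<Suc n. y j))\<^sup>2 / (real (Suc n))\<^sup>2"
    by (simp only: norm_divide power_divide norm_of_nat)
  also have "\<dots> \<le> ((\<Sum>j<Suc n. (cmod (y j))\<^sup>2) * real (Suc n)) / (real (Suc n))\<^sup>2"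
    by (intro divide_right_mono *) simp
  also have "\<dots> = (\<Sum>j<Suc n. (cmod (y j))\<^sup>2) / real (Suc n)"
    by (simp add: power2_eq_square del: sum.lessThan_Suc of_nat_Suc)
  finally show ?thesis .
qed

lemma AE_circ_constD:
  assumes "AE t in circ. Q"
  shows Q
proof (rule ccontr)
  assume "\<not> Q"
  with assms have "ae_filter circ = bot" by (simp add: trivial_limit_def)
  then show False by (simp add: ae_filter_eq_bot_iff emeasure_restrict_space)
qed

definition past_sum :: "(real \<Rightarrow> complex) \<Rightarrow> nat \<Rightarrow> real \<Rightarrow> complex" where
  "past_sum h N = trig_sum (\<lambda>k. - int k) (\<lambda>k. fourier_coeff h (- int k)) {..<N}"

definition fejer_mean :: "(real \<Rightarrow> complex) \<Rightarrow> nat \<Rightarrow> real \<Rightarrow> complex" where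
  "fejer_mean h n t = (\<Sum>j<Suc n. past_sum h (Suc j) t) / of_nat (Suc n)"

text \<open>
  The series of the coefficients at nonpositive frequencies has a mean-square sum \<open>H\<close>, and \<open>h - H\<close>
  has no Fourier coefficients left.
\<close>

lemma past_sum_tendsto:
  assumes h: "causal h"
  shows "(\<lambda>N. \<integral>t. (cmod (h t - past_sum h N t))\<^sup>2 \<partial>circ) \<longlonglongrightarrow> 0"
proof -
  let ?n = "\<lambda>k. - int k" and ?d = "\<lambda>k. fourier_coeff h (- int k)"
  have inj: "inj ?n" by (simp add: inj_on_def)
  have sq: "sq_integrable circ h" using h by (simp add: causal_def)
  have d: "?d \<in> ell2" using Bessel_inequality(1)[OF sq inj] by (simp add: ell2_def)
  obtain H where H: "has_L2_sum (\<lambda>k t. ?d k * trig (?n k) t) H"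
    using Riesz_Fischer[OF inj d] by blast
  have sqH: "sq_integrable circ H" by (rule has_L2_sum_tendsto(1)[OF H])
  have "fourier_coeff (\<lambda>t. h t - H t) m = 0" for m
  proof (cases "m \<le> 0")
    case True
    then have "m = - int (nat (- m))" by simp
    then obtain k where "m = ?n k" by blast
    then show ?thesis
      using fourier_coeff_L2_sum(1)[OF H inj, of k] 
      by (simp add: fourier_coeff_diff sq_integrable_imp_integrable[OF circ_finite] sq sqH)
  next
    case False
    then have "m = int (nat (m - 1)) + 1" by simp
    then obtain l where m: "m = int l + 1" by blast
    have "fourier_coeff H m = 0"
      by (rule fourier_coeff_L2_sum(2)[OF H inj]) (use False in auto)
    moreover have "fourier_coeff h m = 0" using h m by (simp add: causal_def)
    ultimately show ?thesis
      by (simp add: fourier_coeff_diff sq_integrable_imp_integrable[OF circ_finite] sq sqH)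
  qed
  then have "AE t in circ. h t - H t = 0"
    by (intro AE_zero_if_fourier_coeff_zero sq_integrable_imp_integrable[OF circ_finite] sq_integrable_diff sq sqH)
  then have ae: "AE t in circ. (cmod (h t - past_sum h N t))\<^sup>2 = (cmod (H t - past_sum h N t))\<^sup>2" for N
    by eventually_elim simp
  have "(\<integral>t. (cmod (h t - past_sum h N t))\<^sup>2 \<partial>circ) = (\<integral>t. (cmod (H t - past_sum h N t))\<^sup>2 \<partial>circ)" for N
    by (intro integral_cong_AE[OF _ _ ae] borel_measurable_integrable sq_integrable_integrable sq_integrable_diff sq sqH)
      (simp_all add: past_sum_def sq_integrable_trig_sum)
  then show ?thesis
    using has_L2_sum_tendsto(2)[OF H] by (simp add: past_sum_def)
qed

lemma sq_integrable_past_sum: "sq_integrable circ (past_sum h N)"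
  unfolding past_sum_def by (rule sq_integrable_trig_sum)

lemma sq_integrable_fejer_mean: "sq_integrable circ (fejer_mean h n)"
proof -
  have "sq_integrable circ (\<lambda>t. (1 / of_nat (Suc n)) * (\<Sum>j<Suc n. past_sum h (Suc j) t))"
    by (intro sq_integrable_cmult sq_integrable_sum sq_integrable_past_sum)
  then show ?thesis by (simp add: fejer_mean_def[abs_def])
qed

lemma fejer_mean_tendsto:
  assumes h: "causal h"
  shows "(\<lambda>n. \<integral>t. (cmod (h t - fejer_mean h n t))\<^sup>2 \<partial>circ) \<longlonglongrightarrow> 0"
proof (rule Lim_null_comparison)
  have sq: "sq_integrable circ h" using h by (simp add: causal_def)
  let ?x = "\<lambda>j. \<integral>t. (cmod (h t - past_sum h (Suc j) t))\<^sup>2 \<partial>circ"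
  show "(\<lambda>n. (\<Sum>j<Suc n. ?x j) / real (Suc n)) \<longlonglongrightarrow> 0"
    by (rule Cesaro_mean_null) (use LIMSEQ_Suc[OF past_sum_tendsto[OF h]] in auto)
  have "(\<integral>t. (cmod (h t - fejer_mean h n t))\<^sup>2 \<partial>circ) \<le> (\<Sum>j<Suc n. ?x j) / real (Suc n)" for n
  proof -
    have int: "integrable circ (\<lambda>t. (cmod (h t - past_sum h (Suc j) t))\<^sup>2)" for j
      by (intro sq_integrable_integrable sq_integrable_diff sq sq_integrable_past_sum)
    have "(\<integral>t. (cmod (h t - fejer_mean h n t))\<^sup>2 \<partial>circ)
        \<le> (\<integral>t. (\<Sum>j<Suc n. (cmod (h t - past_sum h (Suc j) t))\<^sup>2) / real (Suc n) \<partial>circ)"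
    proof (rule integral_mono)
      show "integrable circ (\<lambda>t. (cmod (h t - fejer_mean h n t))\<^sup>2)"
        by (intro sq_integrable_integrable sq_integrable_diff sq sq_integrable_fejer_mean)
      show "integrable circ (\<lambda>t. (\<Sum>j<Suc n. (cmod (h t - past_sum h (Suc j) t))\<^sup>2) / real (Suc n))"
        by (intro integrable_divide Bochner_Integration.integrable_sum int)
      fix t
      have eq: "h t - fejer_mean h n t = (\<Sum>j<Suc n. h t - past_sum h (Suc j) t) / of_nat (Suc n)"
        by (simp add: fejer_mean_def sum_subtractf diff_divide_distrib del: sum.lessThan_Suc of_nat_Suc)
      show "(cmod (h t - fejer_mean h n t))\<^sup>2 \<le> (\<Sum>j<Suc n. (cmod (h t - past_sum h (Suc j) t))\<^sup>2) / real (Suc n)"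
        unfolding eq by (rule cmod_mean_sq_le)
    qed
    also have "\<dots> = (\<Sum>j<Suc n. ?x j) / real (Suc n)"
      by (subst integral_divide_zero, subst Bochner_Integration.integral_sum) (auto intro: int)
    finally show ?thesis .
  qed
  then show "\<forall>\<^sub>F n in sequentially. norm (\<integral>t. (cmod (h t - fejer_mean h n t))\<^sup>2 \<partial>circ)
      \<le> (\<Sum>j<Suc n. ?x j) / real (Suc n)"
    by (intro always_eventually allI) (simp del: sum.lessThan_Suc of_nat_Suc)
qed

text \<open>
  The Fejer mean at \<open>x\<close> is the average of \<open>h\<close> against the kernel \<open>\<bar>D\<bar>\<^sup>2 / (n + 1)\<close>, where
  \<open>D t = (\<Sum>j\<le>n. cis (j * (t - x)))\<close>.  This kernel is nonnegative with mean one.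
\<close>

lemma cmod_fejer_mean_le:
  assumes h: "causal h" and B: "AE t in circ. cmod (h t) \<le> B"
  shows "cmod (fejer_mean h n x) \<le> B"
proof -
  define D where "D = trig_sum int (\<lambda>j. trig (- int j) x) {..<Suc n}"
  have sq: "sq_integrable circ h" using h by (simp add: causal_def)
  have sqD: "sq_integrable circ D" unfolding D_def by (rule sq_integrable_trig_sum)
  have B0: "0 \<le> B"
  proof (rule ccontr)
    assume "\<not> 0 \<le> B"
    then have "\<not> cmod (h t) \<le> B" for t
      using norm_ge_zero[of "h t"] by linarith
    with B have "AE t in circ. False" by simp
    then show False by (rule AE_circ_constD)
  qed
  have Db: "cmod (D t) \<le> real (Suc n)" for t
    unfolding D_def trig_sum_def
    by (rule order_trans[OF norm_sum]) (simp add: norm_mult)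
  have hD: "sq_integrable circ (\<lambda>t. h t * D t)"
    using sq_integrable_mult_bounded[OF sq, of D "real (Suc n)"] sqD Db by (auto simp: mult.commute)
  have coeff: "fourier_coeff (\<lambda>t. h t * D t) l = (\<Sum>k<Suc n. fourier_coeff h (l - int k) * trig (- int k) x)" for l
    unfolding D_def by (rule fourier_coeff_mult_trig_sum[OF sq_integrable_imp_integrable[OF circ_finite sq]])
  have "(\<integral>t. (h t * D t) * cnj (D t) \<partial>circ)
      = (2 * pi) * (\<Sum>l<Suc n. fourier_coeff (\<lambda>t. h t * D t) (int l) * cnj (trig (- int l) x))"
    by (rule integral_mult_cnj_trig_sum[OF hD, of int "\<lambda>j. trig (- int j) x" "{..<Suc n}", folded D_def])
  also have "(\<Sum>l<Suc n. fourier_coeff (\<lambda>t. h t * D t) (int l) * cnj (trig (- int l) x))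
      = (\<Sum>l<Suc n. \<Sum>k<Suc n. fourier_coeff h (int l - int k) * trig (int l - int k) x)"
    unfolding coeff sum_distrib_right cnj_trig
    by (intro sum.cong refl) (simp add: mult.assoc flip: trig_add)
  also have "\<dots> = (\<Sum>k<Suc n. \<Sum>l<Suc n. fourier_coeff h (int l - int k) * trig (int l - int k) x)"
    by (rule sum.swap)
  also have "\<dots> = (\<Sum>k<Suc n. past_sum h (Suc k) x)"
  proof (intro sum.cong refl)
    fix k assume k: "k \<in> {..<Suc n}"
    have "(\<Sum>l<Suc n. fourier_coeff h (int l - int k) * trig (int l - int k) x)
        = (\<Sum>l<Suc k. fourier_coeff h (int l - int k) * trig (int l - int k) x)"
    proof (intro sum.mono_neutral_right ballI)
      fix l assume "l \<in> {..<Suc n} - {..<Suc k}"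
      then have "Suc k \<le> l" by simp
      then obtain m where "l = Suc k + m" using le_Suc_ex by blast
      then have "int l - int k = int m + 1" by simp
      then have "fourier_coeff h (int l - int k) = 0" using h unfolding causal_def by metis
      then show "fourier_coeff h (int l - int k) * trig (int l - int k) x = 0" by simp
    qed (use k in auto)
    also have "\<dots> = (\<Sum>l<Suc k. fourier_coeff h (int (Suc k - Suc l) - int k) * trig (int (Suc k - Suc l) - int k) x)"
      by (rule sum.nat_diff_reindex[symmetric])
    also have "\<dots> = past_sum h (Suc k) x"
    proof -
      have "int (Suc k - Suc l) - int k = - int l" if "l \<in> {..<Suc k}" for l
        using that by (simp add: of_nat_diff)
      then show ?thesis
        unfolding past_sum_def trig_sum_def by (intro sum.cong refl) (simp only:)
    qed
    finally show "(\<Sum>l<Suc n. fourier_coeff h (int l - int k) * trig (int l - int k) x) = past_sum h (Suc k) x" .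
  qed
  also have "\<dots> = of_nat (Suc n) * fejer_mean h n x"
    by (simp add: fejer_mean_def del: sum.lessThan_Suc of_nat_Suc)
  finally have eq: "(\<integral>t. (h t * D t) * cnj (D t) \<partial>circ) = (2 * pi) * (of_nat (Suc n) * fejer_mean h n x)" .
  have "2 * pi * (real (Suc n) * cmod (fejer_mean h n x)) = cmod (\<integral>t. (h t * D t) * cnj (D t) \<partial>circ)"
    unfolding eq norm_mult norm_of_nat by simp
  also have "\<dots> \<le> (\<integral>t. cmod ((h t * D t) * cnj (D t)) \<partial>circ)" by (rule integral_norm_bound)
  also have "\<dots> \<le> (\<integral>t. B * (cmod (D t))\<^sup>2 \<partial>circ)"
  proof (rule integral_mono_AE)
    show "integrable circ (\<lambda>t. cmod ((h t * D t) * cnj (D t)))"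
      by (intro integrable_norm integrable_mult_of_sq_integrable hD sq_integrable_cnj sqD)
    show "integrable circ (\<lambda>t. B * (cmod (D t))\<^sup>2)" using sqD by auto
    show "AE t in circ. cmod ((h t * D t) * cnj (D t)) \<le> B * (cmod (D t))\<^sup>2"
      using B by eventually_elim (simp add: norm_mult power2_eq_square mult.assoc mult_right_mono)
  qed
  also have "\<dots> = 2 * pi * (real (Suc n) * B)"
    unfolding D_def by (simp add: integral_trig_sum_sq inj_on_def del: sum.lessThan_Suc)
  finally show ?thesis by simp
qed

lemma fejer_mean_polynomial: "\<exists>b. \<forall>t. fejer_mean h n t = (\<Sum>k\<le>n. b k * cis (- t * real k))"
proof (intro exI allI)
  fix t
  let ?d = "\<lambda>k. fourier_coeff h (- int k)"
  have "past_sum h (Suc j) t = (\<Sum>k\<le>n. (if k \<le> j then ?d k else 0) * cis (- t * real k))" if "j < Suc n" for j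
    unfolding past_sum_def trig_sum_def
    by (rule sum.mono_neutral_cong_left) (use that in \<open>auto simp: trig_def\<close>)
  then have "(\<Sum>j<Suc n. past_sum h (Suc j) t) = (\<Sum>j<Suc n. \<Sum>k\<le>n. (if k \<le> j then ?d k else 0) * cis (- t * real k))"
    by (intro sum.cong) auto
  also have "\<dots> = (\<Sum>k\<le>n. \<Sum>j<Suc n. (if k \<le> j then ?d k else 0) * cis (- t * real k))"
    by (rule sum.swap)
  finally show "fejer_mean h n t = (\<Sum>k\<le>n. ((\<Sum>j<Suc n. if k \<le> j then ?d k else 0) / of_nat (Suc n)) * cis (- t * real k))"
    unfolding fejer_mean_def by (simp only: sum_distrib_right sum_divide_distrib times_divide_eq_left)
qed

text \<open>
  Fejer means are used instead of partial sums because they obey the bound of \<open>h\<close>: dominated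
  convergence then applies to an arbitrary integrable weight, bounded or not.
\<close>

lemma bounded_causal_in_L2_past:
  assumes h: "causal h" and B: "AE t in circ. cmod (h t) \<le> B"
    and F: "integrable circ F" "AE t in circ. 0 \<le> F t"
  shows "h \<in> L2_past F"
proof -
  have sq: "sq_integrable circ h" using h by (simp add: causal_def)
  note [measurable] = sq_integrable_measurable[OF sq] borel_measurable_integrable[OF F(1)]
    sq_integrable_measurable[OF sq_integrable_fejer_mean]
  have hF: "integrable circ (\<lambda>t. (cmod (h t))\<^sup>2 * F t)"
  proof (rule Bochner_Integration.integrable_bound)
    show "integrable circ (\<lambda>t. B\<^sup>2 * F t)" using F by simp
    show "AE t in circ. norm ((cmod (h t))\<^sup>2 * F t) \<le> norm (B\<^sup>2 * F t)"
      using B by eventually_elim (simp add: abs_mult mult_right_mono power_mono)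
  qed measurable
  obtain r where r: "strict_mono r" "AE t in circ. (\<lambda>n. (cmod (h t - fejer_mean h (r n) t))\<^sup>2) \<longlonglongrightarrow> 0"
    using tendsto_L1_AE_subseq[of circ "\<lambda>n t. (cmod (h t - fejer_mean h n t))\<^sup>2"] fejer_mean_tendsto[OF h]
      sq_integrable_integrable[OF sq_integrable_diff[OF sq sq_integrable_fejer_mean]] by auto
  have "(\<lambda>n. \<integral>t. (cmod (h t - fejer_mean h (r n) t))\<^sup>2 * F t \<partial>circ) \<longlonglongrightarrow> (\<integral>t. 0 \<partial>circ)"
  proof (rule integral_dominated_convergence)
    show "integrable circ (\<lambda>t. (2 * B)\<^sup>2 * F t)" using F by simp
    show "AE t in circ. (\<lambda>n. (cmod (h t - fejer_mean h (r n) t))\<^sup>2 * F t) \<longlonglongrightarrow> 0"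
      using r(2) by eventually_elim (rule tendsto_mult_left_zero)
    show "AE t in circ. norm ((cmod (h t - fejer_mean h (r n) t))\<^sup>2 * F t) \<le> (2 * B)\<^sup>2 * F t" for n
      using B F(2)
    proof eventually_elim
      case (elim t)
      have "cmod (h t - fejer_mean h (r n) t) \<le> 2 * B"
        using norm_triangle_ineq4[of "h t" "fejer_mean h (r n) t"] elim(1) cmod_fejer_mean_le[OF h B, of "r n" t]
        by linarith
      then have "(cmod (h t - fejer_mean h (r n) t))\<^sup>2 \<le> (2 * B)\<^sup>2" by (intro power_mono) auto
      then show ?case using elim by (simp add: abs_mult mult_right_mono)
    qed
  qed measurable
  then have lim: "(\<lambda>n. \<integral>t. (cmod (h t - fejer_mean h (r n) t))\<^sup>2 * F t \<partial>circ) \<longlonglongrightarrow> 0" by simp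
  have "\<exists>N b. (\<integral>t. (cmod (h t - (\<Sum>k\<le>N. b k * cis (- t * real (k::nat)))))\<^sup>2 * F t \<partial>circ) < e" if e: "e > 0" for e
  proof -
    obtain n where n: "(\<integral>t. (cmod (h t - fejer_mean h (r n) t))\<^sup>2 * F t \<partial>circ) < e"
      using order_tendstoD(2)[OF lim e] by (auto simp: eventually_sequentially)
    obtain b where b: "\<And>t. fejer_mean h (r n) t = (\<Sum>k\<le>r n. b k * cis (- t * real k))"
      using fejer_mean_polynomial by metis
    show ?thesis using n unfolding b by blast
  qed
  then show ?thesis using hF by (simp add: L2_past_def L2_weighted_def)
qed

section \<open>The saddle point\<close>

lemma mse_constant_moduli:
  assumes f: "spectral_density f" and g: "spectral_density g"
    and \<alpha>: "AE t in circ. cmod (A_fun a t - h t) = \<alpha>" and \<beta>: "AE t in circ. cmod (h t) = \<beta>"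
  shows "mse a h f g = ennreal (\<alpha>\<^sup>2 * ((1 / (2 * pi)) * (\<integral>t. f t \<partial>circ)) + \<beta>\<^sup>2 * ((1 / (2 * pi)) * (\<integral>t. g t \<partial>circ)))"
proof -
  have weighted: "ennreal (1 / (2 * pi)) * (\<integral>\<^sup>+t. ennreal ((cmod (u t))\<^sup>2 * w t) \<partial>circ)
      = ennreal (\<gamma>\<^sup>2 * ((1 / (2 * pi)) * (\<integral>t. w t \<partial>circ)))"
    "0 \<le> \<gamma>\<^sup>2 * ((1 / (2 * pi)) * (\<integral>t. w t \<partial>circ))"
    if w: "spectral_density w" and \<gamma>: "AE t in circ. cmod (u t) = \<gamma>" for u :: "real \<Rightarrow> complex" and w \<gamma>
  proof -
    have nn: "AE t in circ. 0 \<le> \<gamma>\<^sup>2 * w t" using w by (intro AE_I2) (auto simp: spectral_density_def)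
    have int: "integrable circ (\<lambda>t. \<gamma>\<^sup>2 * w t)" using w by (simp add: spectral_density_def)
    have "(\<integral>\<^sup>+t. ennreal ((cmod (u t))\<^sup>2 * w t) \<partial>circ) = (\<integral>\<^sup>+t. ennreal (\<gamma>\<^sup>2 * w t) \<partial>circ)"
      by (rule nn_integral_cong_AE) (use \<gamma> in eventually_elim, simp)
    also have "\<dots> = ennreal (\<gamma>\<^sup>2 * (\<integral>t. w t \<partial>circ))"
      unfolding nn_integral_eq_integral[OF int nn] by simp
    finally have eq: "(\<integral>\<^sup>+t. ennreal ((cmod (u t))\<^sup>2 * w t) \<partial>circ) = ennreal (\<gamma>\<^sup>2 * (\<integral>t. w t \<partial>circ))" .
    have "ennreal (1 / (2 * pi)) * (\<integral>\<^sup>+t. ennreal ((cmod (u t))\<^sup>2 * w t) \<partial>circ)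
        = ennreal ((1 / (2 * pi)) * (\<gamma>\<^sup>2 * (\<integral>t. w t \<partial>circ)))"
      unfolding eq by (rule ennreal_mult'[symmetric]) simp
    then show "ennreal (1 / (2 * pi)) * (\<integral>\<^sup>+t. ennreal ((cmod (u t))\<^sup>2 * w t) \<partial>circ)
      = ennreal (\<gamma>\<^sup>2 * ((1 / (2 * pi)) * (\<integral>t. w t \<partial>circ)))"
      by (simp only: mult.left_commute)
    have "0 \<le> (\<integral>t. w t \<partial>circ)"
      by (rule integral_nonneg_AE) (use w in \<open>auto simp: spectral_density_def\<close>)
    then show "0 \<le> \<gamma>\<^sup>2 * ((1 / (2 * pi)) * (\<integral>t. w t \<partial>circ))" by simp
  qed
  show ?thesis
    unfolding mse_def weighted(1)[OF f \<alpha>] weighted(1)[OF g \<beta>]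
    by (rule ennreal_plus[symmetric]) (rule weighted(2)[OF f \<alpha>], rule weighted(2)[OF g \<beta>])
qed

context filtering_problem
begin

lemma A_minus_spec_char:
  assumes "f t + g t > 0"
  shows "of_real (f t + g t) * (A_fun a t - spec_char a f g t) = A_fun a t * of_real (g t) + C_fun a f g t"
    and "of_real (f t + g t) * spec_char a f g t = A_fun a t * of_real (f t) - C_fun a f g t"
proof -
  define s where "s = f t + g t"
  show 1: "of_real (f t + g t) * spec_char a f g t = A_fun a t * of_real (f t) - C_fun a f g t"
    using assms unfolding spec_char_eq_quotient s_def[symmetric] by (simp add: mult.commute)
  show "of_real (f t + g t) * (A_fun a t - spec_char a f g t) = A_fun a t * of_real (g t) + C_fun a f g t"
    unfolding right_diff_distrib 1 by (simp add: algebra_simps)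
qed

lemma cmod_spec_char_constant:
  assumes "AE t in circ. cmod (A_fun a t * of_real (g t) + C_fun a f g t) = \<alpha> * (f t + g t)"
    and "AE t in circ. cmod (A_fun a t * of_real (f t) - C_fun a f g t) = \<beta> * (f t + g t)"
  shows "AE t in circ. cmod (A_fun a t - spec_char a f g t) = \<alpha>"
    and "AE t in circ. cmod (spec_char a f g t) = \<beta>"
proof -
  show "AE t in circ. cmod (A_fun a t - spec_char a f g t) = \<alpha>"
    using assms(1) sum_pos
  proof eventually_elim
    case (elim t)
    have "(f t + g t) * cmod (A_fun a t - spec_char a f g t) = (f t + g t) * \<alpha>"
      using elim unfolding A_minus_spec_char(1)[OF elim(2), symmetric] norm_mult norm_of_real
      by (simp add: mult.commute)
    then show ?case using elim(2) by simp
  qed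
  show "AE t in circ. cmod (spec_char a f g t) = \<beta>"
    using assms(2) sum_pos
  proof eventually_elim
    case (elim t)
    have "(f t + g t) * cmod (spec_char a f g t) = (f t + g t) * \<beta>"
      using elim unfolding A_minus_spec_char(2)[OF elim(2), symmetric] norm_mult norm_of_real
      by (simp add: mult.commute)
    then show ?case using elim(2) by simp
  qed
qed

lemma small_perturbation_in_class:
  assumes w: "spectral_density w" and less: "(1 / (2 * pi)) * (\<integral>t. w t \<partial>circ) < P"
  obtains e where "0 < e" "(\<lambda>t. w t + e * (f t + g t)) \<in> density_class P"
proof -
  define S where "S = (\<integral>t. f t + g t \<partial>circ)"
  have int: "integrable circ w" "integrable circ (\<lambda>t. f t + g t)"
    using w f g by (auto simp: spectral_density_def)
  have S: "0 \<le> S"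
    unfolding S_def by (rule integral_nonneg_AE) (use nonneg in eventually_elim, simp)
  define d where "d = 2 * pi * P - (\<integral>t. w t \<partial>circ)"
  have d: "0 < d" using less by (simp add: d_def field_simps)
  \<comment> \<open>the summand 1 keeps the quotient meaningful when \<open>S = 0\<close>\<close>
  define e where "e = d / (1 + S)"
  have e: "0 < e" "e * S \<le> d" using d S by (auto simp: e_def field_simps)
  have "(\<integral>t. w t + e * (f t + g t) \<partial>circ) = (\<integral>t. w t \<partial>circ) + e * S"
    unfolding S_def
    by (subst Bochner_Integration.integral_add) (use int in \<open>auto simp del: distrib_left\<close>)
  then have "(\<integral>t. w t + e * (f t + g t) \<partial>circ) \<le> 2 * pi * P" using e(2) by (simp add: d_def)
  then have "(1 / (2 * pi)) * (\<integral>t. w t + e * (f t + g t) \<partial>circ) \<le> P" by (simp add: field_simps)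
  moreover have "spectral_density (\<lambda>t. w t + e * (f t + g t))"
    using w f g e(1) by (auto simp: spectral_density_def)
  ultimately show thesis using e(1) by (intro that) (auto simp: density_class_def)
qed

end

theorem theorem4:
  fixes a :: "nat \<Rightarrow> complex" and f0 g0 :: "real \<Rightarrow> real" and P1 P2 \<alpha>1 \<alpha>2 :: real
  assumes a_abs: "summable (\<lambda>k. cmod (a k))"
    and a_sq: "summable (\<lambda>k. (real k + 1) * (cmod (a k))\<^sup>2)"
    and P_pos: "P1 > 0" "P2 > 0"
    and f0: "f0 \<in> density_class P1"
    and g0: "g0 \<in> density_class P2"
    and adm: "admissible_pair f0 g0"
    and hf_bounded: "\<exists>B. AE t in circ.
          cmod (A_fun a t * of_real (g0 t) + C_fun a f0 g0 t) / (f0 t + g0 t) \<le> B"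
    and hg_bounded: "\<exists>B. AE t in circ.
          cmod (A_fun a t * of_real (f0 t) - C_fun a f0 g0 t) / (f0 t + g0 t) \<le> B"
    and eq1: "AE t in circ.
          cmod (A_fun a t * of_real (g0 t) + C_fun a f0 g0 t) = \<alpha>1 * (f0 t + g0 t)"
    and eq2: "AE t in circ.
          cmod (A_fun a t * of_real (f0 t) - C_fun a f0 g0 t) = \<alpha>2 * (f0 t + g0 t)"
    and \<alpha>_nonneg: "\<alpha>1 \<ge> 0" "\<alpha>2 \<ge> 0"
    and \<alpha>1: "(\<integral>t. f0 t \<partial>circ) = 2 * pi * P1 \<Longrightarrow> \<alpha>1 \<noteq> 0"
    and \<alpha>2: "(\<integral>t. g0 t \<partial>circ) = 2 * pi * P2 \<Longrightarrow> \<alpha>2 \<noteq> 0"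
    and opt: "\<forall>(f, g) \<in> density_class P1 \<times> density_class P2. admissible_pair f g \<longrightarrow>
          operator_error a f g \<le> operator_error a f0 g0"
  shows "least_favorable a (density_class P1 \<times> density_class P2) f0 g0 \<and>
         minimax_robust a (density_class P1 \<times> density_class P2) (spec_char a f0 g0)"
proof -
  let ?D = "density_class P1 \<times> density_class P2"
  let ?h0 = "spec_char a f0 g0"
  have sd: "spectral_density f0" "spectral_density g0"
    using f0 g0 by (auto simp: density_class_def)
  interpret L: filtering_problem f0 g0 a
    using sd adm a_abs by unfold_locales
  have mod1: "AE t in circ. cmod (A_fun a t - ?h0 t) = \<alpha>1"
    and mod2: "AE t in circ. cmod (?h0 t) = \<alpha>2"
    by (rule L.cmod_spec_char_constant[OF eq1 eq2])+
  have opt': "operator_error a f g \<le> operator_error a f0 g0"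
    if "f \<in> density_class P1" "g \<in> density_class P2" "admissible_pair f g" for f g
    using opt that by blast
  have least: "least_favorable a ?D f0 g0"
    unfolding least_favorable_def
  proof (intro conjI)
    show "\<forall>(f, g)\<in>?D. admissible_pair f g \<longrightarrow> mse a (spec_char a f g) f g \<le> mse a ?h0 f0 g0"
    proof (clarify)
      fix f g assume fg: "f \<in> density_class P1" "g \<in> density_class P2" "admissible_pair f g"
      interpret X: filtering_problem f g a
        using fg a_abs by unfold_locales (auto simp: density_class_def)
      show "mse a (spec_char a f g) f g \<le> mse a ?h0 f0 g0"
        unfolding X.mse_spec_char L.mse_spec_char by (intro ennreal_leI opt' fg)
    qed
  qed (use f0 g0 adm in auto)
  have slack1: "\<alpha>1 = 0" if "(1 / (2 * pi)) * (\<integral>t. f0 t \<partial>circ) \<noteq> P1"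
  proof -
    have "(1 / (2 * pi)) * (\<integral>t. f0 t \<partial>circ) < P1" using f0 that by (simp add: density_class_def)
    from L.small_perturbation_in_class[OF sd(1) this]
    obtain e where e: "0 < e" "(\<lambda>t. f0 t + e * (f0 t + g0 t)) \<in> density_class P1" by blast
    have "admissible_pair (\<lambda>t. f0 t + e * (f0 t + g0 t)) g0"
      by (rule L.perturbed_pair(1)[OF e(1) _ sd(2) _ L.mat_R_perturb_signal[OF e(1)]])
        (use e(2) in \<open>auto simp: density_class_def algebra_simps\<close>)
    then have "AE t in circ. A_fun a t = ?h0 t"
      by (intro L.power_slack_f[OF e(1)] opt' e(2) g0)
    with mod1 have "AE t in circ. \<alpha>1 = 0" by eventually_elim simp
    then show ?thesis by (rule AE_circ_constD)
  qed
  have slack2: "\<alpha>2 = 0" if "(1 / (2 * pi)) * (\<integral>t. g0 t \<partial>circ) \<noteq> P2"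
  proof -
    have "(1 / (2 * pi)) * (\<integral>t. g0 t \<partial>circ) < P2" using g0 that by (simp add: density_class_def)
    from L.small_perturbation_in_class[OF sd(2) this]
    obtain e where e: "0 < e" "(\<lambda>t. g0 t + e * (f0 t + g0 t)) \<in> density_class P2" by blast
    have "admissible_pair f0 (\<lambda>t. g0 t + e * (f0 t + g0 t))"
      by (rule L.perturbed_pair(1)[OF e(1) sd(1) _ _ L.mat_R_perturb_noise])
        (use e(2) in \<open>auto simp: density_class_def algebra_simps\<close>)
    then have "AE t in circ. ?h0 t = 0"
      by (intro L.power_slack_g[OF e(1)] opt' e(2) f0)
    with mod2 have "AE t in circ. \<alpha>2 = 0" by eventually_elim simp
    then show ?thesis by (rule AE_circ_constD)
  qed
  let ?v = "ennreal (\<alpha>1\<^sup>2 * P1 + \<alpha>2\<^sup>2 * P2)"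
  \<comment> \<open>complementary slackness: either the power of \<open>f0\<close> is \<open>P1\<close> or \<open>\<alpha>1 = 0\<close>, and likewise for \<open>g0\<close>\<close>
  have exhaust1: "\<alpha>1\<^sup>2 * ((1 / (2 * pi)) * (\<integral>t. f0 t \<partial>circ)) = \<alpha>1\<^sup>2 * P1"
    using slack1 by (metis mult_zero_left zero_power2)
  have exhaust2: "\<alpha>2\<^sup>2 * ((1 / (2 * pi)) * (\<integral>t. g0 t \<partial>circ)) = \<alpha>2\<^sup>2 * P2"
    using slack2 by (metis mult_zero_left zero_power2)
  have val: "mse a ?h0 f0 g0 = ?v"
    by (simp only: mse_constant_moduli[OF sd mod1 mod2] exhaust1 exhaust2)
  have upper: "mse a ?h0 f g \<le> ?v" if "(f, g) \<in> ?D" for f g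
  proof -
    have "spectral_density f" "spectral_density g" "(1 / (2 * pi)) * (\<integral>t. f t \<partial>circ) \<le> P1" "(1 / (2 * pi)) * (\<integral>t. g t \<partial>circ) \<le> P2"
      using that by (auto simp: density_class_def)
    then show ?thesis
      by (simp only: mse_constant_moduli[OF _ _ mod1 mod2]) (intro ennreal_leI add_mono mult_left_mono; simp)
  qed
  have h0_H: "?h0 \<in> H_class ?D"
    unfolding H_class_def
  proof (clarsimp)
    fix f g assume fg: "f \<in> density_class P1" "g \<in> density_class P2"
    show "?h0 \<in> L2_past (\<lambda>t. f t + g t)"
    proof (rule bounded_causal_in_L2_past[OF L.spec_char_causal])
      show "AE t in circ. cmod (?h0 t) \<le> \<alpha>2" using mod2 by eventually_elim simp
      show "integrable circ (\<lambda>t. f t + g t)" using fg by (simp add: density_class_def spectral_density_def)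
      show "AE t in circ. 0 \<le> f t + g t"
        using fg by (intro AE_I2) (auto simp: density_class_def spectral_density_def)
    qed
  qed
  have f0g0: "(f0, g0) \<in> ?D" using f0 g0 by simp
  have sup0: "(SUP (f, g)\<in>?D. mse a ?h0 f g) = ?v"
  proof (rule antisym)
    show "(SUP (f, g)\<in>?D. mse a ?h0 f g) \<le> ?v"
      by (rule SUP_least) (use upper in auto)
    show "?v \<le> (SUP (f, g)\<in>?D. mse a ?h0 f g)"
      using SUP_upper[OF f0g0, of "\<lambda>(f, g). mse a ?h0 f g"] val by simp
  qed
  have "(INF h\<in>H_class ?D. SUP (f, g)\<in>?D. mse a h f g) = ?v"
  proof (rule antisym)
    show "(INF h\<in>H_class ?D. SUP (f, g)\<in>?D. mse a h f g) \<le> ?v"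
      using INF_lower[OF h0_H, of "\<lambda>h. SUP (f, g)\<in>?D. mse a h f g"] sup0 by simp
    show "?v \<le> (INF h\<in>H_class ?D. SUP (f, g)\<in>?D. mse a h f g)"
    proof (rule INF_greatest)
      fix h assume "h \<in> H_class ?D"
      then have "h \<in> L2_past (\<lambda>t. f0 t + g0 t)" using f0g0 by (auto simp: H_class_def)
      then have "?v \<le> mse a h f0 g0" using L.spec_char_optimal val by simp
      also have "\<dots> \<le> (SUP (f, g)\<in>?D. mse a h f g)"
        using SUP_upper[OF f0g0, of "\<lambda>(f, g). mse a h f g"] by simp
      finally show "?v \<le> (SUP (f, g)\<in>?D. mse a h f g)" .
    qed
  qed
  with least h0_H sup0 show ?thesis by (simp add: minimax_robust_def)
qed

end
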